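(* Let $k$ be an algebraically closed field, let $m,n\ge 1$, and let $E\in GL(m,k)$ and $F\in GL(n,k)$. Assume that $\mathcal B(E,F)\neq 0$. Then $\mathcal B(E,F)$, with the coactions $\alpha$ and $\beta$ defined in the context, is a $\mathcal B(E)$-$\mathcal B(F)$-bigalois extension.
   Context: ${}^tx$ denotes the transpose of a matrix $x$ (with $({}^tx)_{ij}=x_{ji}$). For $E\in GL(m,k)$, $\mathcal B(E)$ is the universal $k$-algebra with generators $a_{ij}$, $1\le i,j\le m$, and relations $E^{-1}\,{}^ta\,E\,a=I=a\,E^{-1}\,{}^ta\,E$, where $a=(a_{ij})$. It is a Hopf algebra with $\Delta(a_{ij})=\sum_{l} a_{il}\otimes a_{lj}$, $\varepsilon(a_{ij})=\delta_{ij}$, $S(a)=E^{-1}\,{}^ta\,E$. The generators of $\mathcal B(F)$, for $F\in GL(n,k)$, are denoted $b_{ij}$, $1\le i,j\le n$. $\mathcal B(E,F)$ is the universal $k$-algebra with generators $z_{ij}$, $1\le i\le m$, $1\le j\le n$, and relations $F^{-1}\,{}^tz\,E\,z=I_n$ and $z\,F^{-1}\,{}^tz\,E=I_m$, where $z=(z_{ij})$. The algebra morphism $\alpha:\mathcal B(E,F)\to\mathcal B(E)\otimes\mathcal B(E,F)$, $\alpha(z_{ij})=\sum_{l=1}^m a_{il}\otimes z_{lj}$, makes $\mathcal B(E,F)$ a left $\mathcal B(E)$-comodule algebra, and the algebra morphism $\beta:\mathcal B(E,F)\to\mathcal B(E,F)\otimes\mathcal B(F)$, $\beta(z_{ij})=\sum_{l=1}^n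 z_{il}\otimes b_{lj}$, makes it a right $\mathcal B(F)$-comodule algebra. Let $A,B$ be Hopf algebras. A left $A$-Galois extension (of $k$) is a non-zero left $A$-comodule algebra $Z$, with coaction $\alpha$ and multiplication $m_Z$, such that $\kappa_l=(1_A\otimes m_Z)\circ(\alpha\otimes 1_Z):Z\otimes Z\to A\otimes Z$ is bijective. A right $B$-Galois extension is a non-zero right $B$-comodule algebra $Z$, with coaction $\beta$, such that $\kappa_r=(m_Z\otimes 1_B)\circ(1_Z\otimes\beta):Z\otimes Z\to Z\otimes B$ is bijective. An $A$-$B$-bigalois extension is an algebra $Z$ which is both a left $A$-Galois extension and a right $B$-Galois extension and which is an $A$-$B$-bicomodule, i.e. $(\alpha\otimes 1_B)\circ\beta=(1_A\otimes\beta)\circ\alpha$. *)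

theory Defs
  imports
    "HOL-Algebra.Algebra"
    "HOL-Library.Poly_Mapping"
    "HOL-Computational_Algebra.Polynomial"
    "HOL-Analysis.Analysis"
begin

section \<open>Algebras over a field\<close>

text \<open>The scalars are the elements of a type of class \<^class>\<open>field\<close>; algebras are carrier-based,
  since the algebras below depend on matrices. Algebras are associative and unital, and the zero
  algebra is allowed.\<close>

definition field_algebra :: "('k::field, 'k) module" where
  "field_algebra = \<lparr>carrier = UNIV, monoid.mult = (*), one = 1, ring.zero = 0, add = (+),
     module.smult = (*)\<rparr>"

locale assoc_algebra = A: Module.module "field_algebra :: ('k::field, 'k) module" A + A: ring A
  for A :: "('k::field, 'a, 's) module_scheme" +
  assumes smult_mult_left: "x \<in> carrier A \<Longrightarrow> y \<in> carrier A \<Longrightarrow>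
      (c \<odot>\<^bsub>A\<^esub> x) \<otimes>\<^bsub>A\<^esub> y = c \<odot>\<^bsub>A\<^esub> (x \<otimes>\<^bsub>A\<^esub> y)"
    and smult_mult_right: "x \<in> carrier A \<Longrightarrow> y \<in> carrier A \<Longrightarrow>
      x \<otimes>\<^bsub>A\<^esub> (c \<odot>\<^bsub>A\<^esub> y) = c \<odot>\<^bsub>A\<^esub> (x \<otimes>\<^bsub>A\<^esub> y)"

definition linear_maps ::
  "('k::field, 'a, 's) module_scheme \<Rightarrow> ('k, 'b, 't) module_scheme \<Rightarrow> ('a \<Rightarrow> 'b) set" where
  "linear_maps V W = {h \<in> carrier V \<rightarrow> carrier W.
     (\<forall>x\<in>carrier V. \<forall>y\<in>carrier V. h (x \<oplus>\<^bsub>V\<^esub> y) = h x \<oplus>\<^bsub>W\<^esub> h y) \<and>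
     (\<forall>c. \<forall>x\<in>carrier V. h (c \<odot>\<^bsub>V\<^esub> x) = c \<odot>\<^bsub>W\<^esub> h x)}"

definition algebra_homs ::
  "('k::field, 'a, 's) module_scheme \<Rightarrow> ('k, 'b, 't) module_scheme \<Rightarrow> ('a \<Rightarrow> 'b) set" where
  "algebra_homs A B = ring_hom A B \<inter> linear_maps A B"

definition opposite_algebra ::
  "('k::field, 'a, 's) module_scheme \<Rightarrow> ('k, 'a, 's) module_scheme" where
  "opposite_algebra A = A\<lparr>monoid.mult := (\<lambda>x y. y \<otimes>\<^bsub>A\<^esub> x)\<rparr>"

text \<open>The factor ring \<^term>\<open>A Quot I\<close>, with the induced scalar multiplication.\<close>

definition quotient_algebra ::
  "('k::field, 'a, 's) module_scheme \<Rightarrow> 'a set \<Rightarrow> ('k, 'a set) module" where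
  "quotient_algebra A I =
    \<lparr>carrier = carrier (A Quot I),
     monoid.mult = monoid.mult (A Quot I),
     one = one (A Quot I),
     ring.zero = ring.zero (A Quot I),
     add = add (A Quot I),
     module.smult = (\<lambda>c K. \<Union>x\<in>K. I +>\<^bsub>A\<^esub> (c \<odot>\<^bsub>A\<^esub> x))\<rparr>"

text \<open>The monoid algebra \<open>k[M]\<close>: finitely supported functions on the carrier of \<open>M\<close>.\<close>

definition monoid_algebra :: "('x, 's) monoid_scheme \<Rightarrow> ('k::field, 'x \<Rightarrow>\<^sub>0 'k) module" where
  "monoid_algebra M =
    \<lparr>carrier = {p. Poly_Mapping.keys p \<subseteq> carrier M},
     monoid.mult = (\<lambda>p q. \<Sum>x\<in>Poly_Mapping.keys p. \<Sum>y\<in>Poly_Mapping.keys q.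
        Poly_Mapping.single (x \<otimes>\<^bsub>M\<^esub> y) (Poly_Mapping.lookup p x * Poly_Mapping.lookup q y)),
     one = Poly_Mapping.single \<one>\<^bsub>M\<^esub> 1,
     ring.zero = 0,
     add = (+),
     module.smult = (\<lambda>c. Poly_Mapping.map ((*) c))\<rparr>"

text \<open>Linear extension to finitely supported functions of a map defined on basis elements.\<close>

definition linear_extension ::
  "('k::field, 'b, 's) module_scheme \<Rightarrow> ('x \<Rightarrow> 'b) \<Rightarrow> ('x \<Rightarrow>\<^sub>0 'k) \<Rightarrow> 'b" where
  "linear_extension V f p =
     (\<Oplus>\<^bsub>V\<^esub>x\<in>Poly_Mapping.keys p. Poly_Mapping.lookup p x \<odot>\<^bsub>V\<^esub> f x)"


section \<open>Universal algebras given by generators and relations\<close>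

text \<open>The free algebra on the type \<open>'x\<close> is the monoid algebra of the words over \<open>'x\<close>.\<close>

definition free_algebra :: "('k::field, 'x list \<Rightarrow>\<^sub>0 'k) module" where
  "free_algebra = monoid_algebra \<lparr>carrier = UNIV, monoid.mult = (@), one = []\<rparr>"

definition free_generator :: "'x \<Rightarrow> ('x list \<Rightarrow>\<^sub>0 'k::field)" where
  "free_generator x = Poly_Mapping.single [x] 1"

text \<open>A relation \<open>u = v\<close> is represented by the element \<open>u - v\<close> of the free algebra;
  \<^const>\<open>genideal\<close> is the two-sided ideal generated by a set.\<close>

definition presented_algebra ::
  "('x list \<Rightarrow>\<^sub>0 'k::field) set \<Rightarrow> ('k, ('x list \<Rightarrow>\<^sub>0 'k) set) module" where
  "presented_algebra R = quotient_algebra free_algebra (Idl\<^bsub>free_algebra\<^esub> R)"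

definition presented_generator ::
  "('x list \<Rightarrow>\<^sub>0 'k::field) set \<Rightarrow> 'x \<Rightarrow> ('x list \<Rightarrow>\<^sub>0 'k) set" where
  "presented_generator R x = (Idl\<^bsub>free_algebra\<^esub> R) +>\<^bsub>free_algebra\<^esub> free_generator x"

text \<open>The algebra morphism into \<open>A\<close> with prescribed values \<open>g\<close> on the generators. The elements of
  a presented algebra are cosets; the value on a coset is the common value on its representatives
  (which exists whenever \<open>g\<close> satisfies the defining relations).\<close>

definition presented_lift ::
  "('k::field, 'a, 's) module_scheme \<Rightarrow> ('x \<Rightarrow> 'a) \<Rightarrow> ('x list \<Rightarrow>\<^sub>0 'k) set \<Rightarrow> 'a" where
  "presented_lift A g K =
     the_elem (linear_extension A (\<lambda>w. foldr (\<lambda>x y. g x \<otimes>\<^bsub>A\<^esub> y) w \<one>\<^bsub>A\<^esub>) ` K)"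


section \<open>Tensor products\<close>

definition bilinearity_relations ::
  "('k::field, 'a, 's) module_scheme \<Rightarrow> ('k, 'b, 't) module_scheme \<Rightarrow> ('a \<times> 'b \<Rightarrow>\<^sub>0 'k) set" where
  "bilinearity_relations A B =
     {Poly_Mapping.single (x \<oplus>\<^bsub>A\<^esub> x', y) 1 - Poly_Mapping.single (x, y) 1
        - Poly_Mapping.single (x', y) 1 | x x' y.
        x \<in> carrier A \<and> x' \<in> carrier A \<and> y \<in> carrier B} \<union>
     {Poly_Mapping.single (x, y \<oplus>\<^bsub>B\<^esub> y') 1 - Poly_Mapping.single (x, y) 1
        - Poly_Mapping.single (x, y') 1 | x y y'.
        x \<in> carrier A \<and> y \<in> carrier B \<and> y' \<in> carrier B} \<union>
     {Poly_Mapping.single (c \<odot>\<^bsub>A\<^esub> x, y) 1 - Poly_Mapping.single (x, y) c | c x y.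
        x \<in> carrier A \<and> y \<in> carrier B} \<union>
     {Poly_Mapping.single (x, c \<odot>\<^bsub>B\<^esub> y) 1 - Poly_Mapping.single (x, y) c | c x y.
        x \<in> carrier A \<and> y \<in> carrier B}"

text \<open>The span of the bilinearity relations. It is taken in the vector space of all finitely
  supported functions, which gives the span in those supported on \<open>carrier A \<times> carrier B\<close>.\<close>

definition bilinearity_span ::
  "('k::field, 'a, 's) module_scheme \<Rightarrow> ('k, 'b, 't) module_scheme \<Rightarrow> ('a \<times> 'b \<Rightarrow>\<^sub>0 'k) set" where
  "bilinearity_span A B =
     Modules.module.span (\<lambda>c. Poly_Mapping.map ((*) c)) (bilinearity_relations A B)"

text \<open>\<open>A \<otimes> B\<close> is the free vector space on \<open>carrier A \<times> carrier B\<close> modulo bilinearity, with product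
  \<open>(x \<otimes> y) (x' \<otimes> y') = x x' \<otimes> y y'\<close>. The free vector space with the bilinear
  product \<open>(x, y) (x', y') = (x x', y y')\<close> is the monoid algebra of the product of the
  multiplicative monoids.\<close>

definition tensor ::
  "('k::field, 'a, 's) module_scheme \<Rightarrow> ('k, 'b, 't) module_scheme \<Rightarrow>
   ('k, ('a \<times> 'b \<Rightarrow>\<^sub>0 'k) set) module" where
  "tensor A B = quotient_algebra (monoid_algebra (A \<times>\<times> B)) (bilinearity_span A B)"

definition pure_tensor ::
  "('k::field, 'a, 's) module_scheme \<Rightarrow> ('k, 'b, 't) module_scheme \<Rightarrow> 'a \<Rightarrow> 'b \<Rightarrow>
   ('a \<times> 'b \<Rightarrow>\<^sub>0 'k) set" where
  "pure_tensor A B x y =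
     bilinearity_span A B +>\<^bsub>monoid_algebra (A \<times>\<times> B)\<^esub> Poly_Mapping.single (x, y) 1"

text \<open>The linear map \<open>x \<otimes> y \<mapsto> f (x, y)\<close> into \<open>V\<close>, for \<open>f\<close> bilinear.\<close>

definition tensor_lift ::
  "('k::field, 'c, 's) module_scheme \<Rightarrow> ('a \<times> 'b \<Rightarrow> 'c) \<Rightarrow> ('a \<times> 'b \<Rightarrow>\<^sub>0 'k) set \<Rightarrow> 'c" where
  "tensor_lift V f K = the_elem (linear_extension V f ` K)"

text \<open>\<open>f \<otimes> g\<close>, with target \<open>C \<otimes> D\<close>.\<close>

definition tensor_map ::
  "('k::field, 'c, 's) module_scheme \<Rightarrow> ('k, 'd, 't) module_scheme \<Rightarrow> ('a \<Rightarrow> 'c) \<Rightarrow> ('b \<Rightarrow> 'd) \<Rightarrow>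
   ('a \<times> 'b \<Rightarrow>\<^sub>0 'k) set \<Rightarrow> ('c \<times> 'd \<Rightarrow>\<^sub>0 'k) set" where
  "tensor_map C D f g = tensor_lift (tensor C D) (\<lambda>(x, y). pure_tensor C D (f x) (g y))"

text \<open>The canonical identifications \<open>(A \<otimes> B) \<otimes> C \<rightarrow> A \<otimes> (B \<otimes> C)\<close> and back.\<close>

definition tensor_assoc ::
  "('k::field, 'a, 's) module_scheme \<Rightarrow> ('k, 'b, 't) module_scheme \<Rightarrow> ('k, 'c, 'u) module_scheme \<Rightarrow>
   (('a \<times> 'b \<Rightarrow>\<^sub>0 'k) set \<times> 'c \<Rightarrow>\<^sub>0 'k) set \<Rightarrow> ('a \<times> ('b \<times> 'c \<Rightarrow>\<^sub>0 'k) set \<Rightarrow>\<^sub>0 'k) set" where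
  "tensor_assoc A B C =
     tensor_lift (tensor A (tensor B C)) (\<lambda>(t, z).
       tensor_lift (tensor A (tensor B C)) (\<lambda>(x, y).
         pure_tensor A (tensor B C) x (pure_tensor B C y z)) t)"

definition tensor_assoc_inv ::
  "('k::field, 'a, 's) module_scheme \<Rightarrow> ('k, 'b, 't) module_scheme \<Rightarrow> ('k, 'c, 'u) module_scheme \<Rightarrow>
   ('a \<times> ('b \<times> 'c \<Rightarrow>\<^sub>0 'k) set \<Rightarrow>\<^sub>0 'k) set \<Rightarrow> (('a \<times> 'b \<Rightarrow>\<^sub>0 'k) set \<times> 'c \<Rightarrow>\<^sub>0 'k) set" where
  "tensor_assoc_inv A B C =
     tensor_lift (tensor (tensor A B) C) (\<lambda>(x, t).
       tensor_lift (tensor (tensor A B) C) (\<lambda>(y, z).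
         pure_tensor (tensor A B) C (pure_tensor A B x y) z) t)"

definition multiplication ::
  "('k::field, 'a, 's) module_scheme \<Rightarrow> ('a \<times> 'a \<Rightarrow>\<^sub>0 'k) set \<Rightarrow> 'a" where
  "multiplication A = tensor_lift A (\<lambda>(x, y). x \<otimes>\<^bsub>A\<^esub> y)"


section \<open>Hopf algebras and Galois extensions\<close>

record (overloaded) ('k, 'a) hopf = "('k::field, 'a) module" +
  comult :: "'a \<Rightarrow> ('a \<times> 'a \<Rightarrow>\<^sub>0 'k) set"
  counit :: "'a \<Rightarrow> 'k"
  antipode :: "'a \<Rightarrow> 'a"

text \<open>The counit axioms use the identifications of \<open>k \<otimes> V\<close> and \<open>V \<otimes> k\<close> with \<open>V\<close>.\<close>

locale hopf_algebra = assoc_algebra A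
  for A :: "('k::field, 'a, 's) hopf_scheme" +
  assumes comult_hom: "comult A \<in> algebra_homs A (tensor A A)"
    and counit_hom: "counit A \<in> algebra_homs A field_algebra"
    and coassoc: "x \<in> carrier A \<Longrightarrow>
      tensor_assoc A A A (tensor_map (tensor A A) A (comult A) id (comult A x))
        = tensor_map A (tensor A A) id (comult A) (comult A x)"
    and counit_left: "x \<in> carrier A \<Longrightarrow>
      tensor_lift A (\<lambda>(y, z). counit A y \<odot>\<^bsub>A\<^esub> z) (comult A x) = x"
    and counit_right: "x \<in> carrier A \<Longrightarrow>
      tensor_lift A (\<lambda>(y, z). counit A z \<odot>\<^bsub>A\<^esub> y) (comult A x) = x"
    and antipode_linear: "antipode A \<in> linear_maps A A"
    and antipode_left: "x \<in> carrier A \<Longrightarrow>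
      multiplication A (tensor_map A A (antipode A) id (comult A x)) = counit A x \<odot>\<^bsub>A\<^esub> \<one>\<^bsub>A\<^esub>"
    and antipode_right: "x \<in> carrier A \<Longrightarrow>
      multiplication A (tensor_map A A id (antipode A) (comult A x)) = counit A x \<odot>\<^bsub>A\<^esub> \<one>\<^bsub>A\<^esub>"

locale left_comodule_algebra = A: hopf_algebra A + Z: assoc_algebra Z
  for A :: "('k::field, 'a, 's) hopf_scheme"
    and Z :: "('k, 'z, 't) module_scheme"
    and \<alpha> :: "'z \<Rightarrow> ('a \<times> 'z \<Rightarrow>\<^sub>0 'k) set" +
  assumes left_coaction_hom: "\<alpha> \<in> algebra_homs Z (tensor A Z)"
    and left_coaction_coassoc: "z \<in> carrier Z \<Longrightarrow>
      tensor_assoc A A Z (tensor_map (tensor A A) Z (comult A) id (\<alpha> z))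
        = tensor_map A (tensor A Z) id \<alpha> (\<alpha> z)"
    and left_coaction_counit: "z \<in> carrier Z \<Longrightarrow>
      tensor_lift Z (\<lambda>(x, y). counit A x \<odot>\<^bsub>Z\<^esub> y) (\<alpha> z) = z"

locale right_comodule_algebra = B: hopf_algebra B + Z: assoc_algebra Z
  for B :: "('k::field, 'b, 's) hopf_scheme"
    and Z :: "('k, 'z, 't) module_scheme"
    and \<beta> :: "'z \<Rightarrow> ('z \<times> 'b \<Rightarrow>\<^sub>0 'k) set" +
  assumes right_coaction_hom: "\<beta> \<in> algebra_homs Z (tensor Z B)"
    and right_coaction_coassoc: "z \<in> carrier Z \<Longrightarrow>
      tensor_assoc Z B B (tensor_map (tensor Z B) B \<beta> id (\<beta> z))
        = tensor_map Z (tensor B B) id (comult B) (\<beta> z)"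
    and right_coaction_counit: "z \<in> carrier Z \<Longrightarrow>
      tensor_lift Z (\<lambda>(x, y). counit B y \<odot>\<^bsub>Z\<^esub> x) (\<beta> z) = z"

definition kappa_left ::
  "('k::field, 'a, 's) hopf_scheme \<Rightarrow> ('k, 'z, 't) module_scheme \<Rightarrow>
   ('z \<Rightarrow> ('a \<times> 'z \<Rightarrow>\<^sub>0 'k) set) \<Rightarrow> ('z \<times> 'z \<Rightarrow>\<^sub>0 'k) set \<Rightarrow> ('a \<times> 'z \<Rightarrow>\<^sub>0 'k) set" where
  "kappa_left A Z \<alpha> =
     tensor_map A Z id (multiplication Z) \<circ> tensor_assoc A Z Z \<circ> tensor_map (tensor A Z) Z \<alpha> id"

definition kappa_right ::
  "('k::field, 'b, 's) hopf_scheme \<Rightarrow> ('k, 'z, 't) module_scheme \<Rightarrow>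
   ('z \<Rightarrow> ('z \<times> 'b \<Rightarrow>\<^sub>0 'k) set) \<Rightarrow> ('z \<times> 'z \<Rightarrow>\<^sub>0 'k) set \<Rightarrow> ('z \<times> 'b \<Rightarrow>\<^sub>0 'k) set" where
  "kappa_right B Z \<beta> =
     tensor_map Z B (multiplication Z) id \<circ> tensor_assoc_inv Z Z B \<circ> tensor_map Z (tensor Z B) id \<beta>"

locale left_galois_extension = left_comodule_algebra A Z \<alpha>
  for A :: "('k::field, 'a, 's) hopf_scheme"
    and Z :: "('k, 'z, 't) module_scheme"
    and \<alpha> :: "'z \<Rightarrow> ('a \<times> 'z \<Rightarrow>\<^sub>0 'k) set" +
  assumes nonzero: "carrier Z \<noteq> {\<zero>\<^bsub>Z\<^esub>}"
    and kappa_left_bij: "bij_betw (kappa_left A Z \<alpha>) (carrier (tensor Z Z)) (carrier (tensor A Z))"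

locale right_galois_extension = right_comodule_algebra B Z \<beta>
  for B :: "('k::field, 'b, 's) hopf_scheme"
    and Z :: "('k, 'z, 't) module_scheme"
    and \<beta> :: "'z \<Rightarrow> ('z \<times> 'b \<Rightarrow>\<^sub>0 'k) set" +
  assumes nonzero: "carrier Z \<noteq> {\<zero>\<^bsub>Z\<^esub>}"
    and kappa_right_bij: "bij_betw (kappa_right B Z \<beta>) (carrier (tensor Z Z)) (carrier (tensor Z B))"

locale bigalois_extension =
  left: left_galois_extension A Z \<alpha> + right: right_galois_extension B Z \<beta>
  for A :: "('k::field, 'a, 's) hopf_scheme"
    and B :: "('k, 'b, 't) hopf_scheme"
    and Z :: "('k, 'z, 'u) module_scheme"
    and \<alpha> :: "'z \<Rightarrow> ('a \<times> 'z \<Rightarrow>\<^sub>0 'k) set"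
    and \<beta> :: "'z \<Rightarrow> ('z \<times> 'b \<Rightarrow>\<^sub>0 'k) set" +
  assumes bicomodule: "z \<in> carrier Z \<Longrightarrow>
      tensor_assoc A Z B (tensor_map (tensor A Z) B \<alpha> id (\<beta> z))
        = tensor_map A (tensor Z B) id \<beta> (\<alpha> z)"


section \<open>The algebras \<open>\<B>(E)\<close> and \<open>\<B>(E,F)\<close>\<close>

text \<open>Matrices over an algebra, which need not be commutative, are functions of two indices.\<close>

definition mat_mult ::
  "('a, 's) ring_scheme \<Rightarrow> ('i \<Rightarrow> 'l::finite \<Rightarrow> 'a) \<Rightarrow> ('l \<Rightarrow> 'j \<Rightarrow> 'a) \<Rightarrow> 'i \<Rightarrow> 'j \<Rightarrow> 'a" where
  "mat_mult R x y = (\<lambda>i j. \<Oplus>\<^bsub>R\<^esub>l\<in>UNIV. x i l \<otimes>\<^bsub>R\<^esub> y l j)"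

definition mat_one :: "('a, 's) ring_scheme \<Rightarrow> 'i \<Rightarrow> 'i \<Rightarrow> 'a" where
  "mat_one R = (\<lambda>i j. if i = j then \<one>\<^bsub>R\<^esub> else \<zero>\<^bsub>R\<^esub>)"

definition mat_transpose :: "('i \<Rightarrow> 'j \<Rightarrow> 'a) \<Rightarrow> 'j \<Rightarrow> 'i \<Rightarrow> 'a" where
  "mat_transpose x = (\<lambda>i j. x j i)"

definition scalar_mat ::
  "('k::field, 'a, 's) module_scheme \<Rightarrow> 'k^'j^'i \<Rightarrow> 'i \<Rightarrow> 'j \<Rightarrow> 'a" where
  "scalar_mat A M = (\<lambda>i j. (M $ i $ j) \<odot>\<^bsub>A\<^esub> \<one>\<^bsub>A\<^esub>)"

text \<open>The elements representing the entrywise relations \<open>x = y\<close>.\<close>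

definition mat_relations ::
  "('a, 's) ring_scheme \<Rightarrow> ('i \<Rightarrow> 'j \<Rightarrow> 'a) \<Rightarrow> ('i \<Rightarrow> 'j \<Rightarrow> 'a) \<Rightarrow> 'a set" where
  "mat_relations R x y = {x i j \<ominus>\<^bsub>R\<^esub> y i j | i j. True}"

definition B_relations :: "'k::field^'m^'m \<Rightarrow> (('m \<times> 'm) list \<Rightarrow>\<^sub>0 'k) set" where
  "B_relations E =
    (let R = free_algebra;
         a = (\<lambda>i j. free_generator (i, j));
         E' = scalar_mat R E;
         E_inv = scalar_mat R (matrix_inv E)
     in mat_relations R
          (mat_mult R (mat_mult R (mat_mult R E_inv (mat_transpose a)) E') a) (mat_one R) \<union>
        mat_relations R
          (mat_mult R (mat_mult R (mat_mult R a E_inv) (mat_transpose a)) E') (mat_one R))"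

definition B_gen :: "'k::field^'m^'m \<Rightarrow> 'm \<Rightarrow> 'm \<Rightarrow> (('m \<times> 'm) list \<Rightarrow>\<^sub>0 'k) set" where
  "B_gen E i j = presented_generator (B_relations E) (i, j)"

text \<open>The antipode is the algebra morphism into the opposite algebra (i.e. the anti-morphism)
  with \<open>S(a) = E\<^sup>-\<^sup>1 \<^sup>ta E\<close>.\<close>

definition B_hopf :: "'k::field^'m^'m \<Rightarrow> ('k, (('m \<times> 'm) list \<Rightarrow>\<^sub>0 'k) set) hopf" where
  "B_hopf E =
    (let A = presented_algebra (B_relations E); a = B_gen E in
     \<lparr>carrier = carrier A, monoid.mult = monoid.mult A, one = one A,
      ring.zero = ring.zero A, add = add A, module.smult = module.smult A,
      comult = presented_lift (tensor A A)
        (\<lambda>(i, j). \<Oplus>\<^bsub>tensor A A\<^esub>l\<in>UNIV. pure_tensor A A (a i l) (a l j)),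
      counit = presented_lift field_algebra (\<lambda>(i, j). if i = j then 1 else 0),
      antipode = presented_lift (opposite_algebra A)
        (\<lambda>(i, j). mat_mult A (mat_mult A (scalar_mat A (matrix_inv E)) (mat_transpose a))
           (scalar_mat A E) i j)\<rparr>)"

definition BB_relations ::
  "'k::field^'m^'m \<Rightarrow> 'k^'n^'n \<Rightarrow> (('m \<times> 'n) list \<Rightarrow>\<^sub>0 'k) set" where
  "BB_relations E F =
    (let R = free_algebra;
         z = (\<lambda>i j. free_generator (i, j));
         E' = scalar_mat R E;
         F_inv = scalar_mat R (matrix_inv F)
     in mat_relations R
          (mat_mult R (mat_mult R (mat_mult R F_inv (mat_transpose z)) E') z) (mat_one R) \<union>
        mat_relations R
          (mat_mult R (mat_mult R (mat_mult R z F_inv) (mat_transpose z)) E') (mat_one R))"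

definition BB_algebra ::
  "'k::field^'m^'m \<Rightarrow> 'k^'n^'n \<Rightarrow> ('k, (('m \<times> 'n) list \<Rightarrow>\<^sub>0 'k) set) module" where
  "BB_algebra E F = presented_algebra (BB_relations E F)"

definition BB_gen ::
  "'k::field^'m^'m \<Rightarrow> 'k^'n^'n \<Rightarrow> 'm \<Rightarrow> 'n \<Rightarrow> (('m \<times> 'n) list \<Rightarrow>\<^sub>0 'k) set" where
  "BB_gen E F i j = presented_generator (BB_relations E F) (i, j)"

definition BB_left_coaction ::
  "'k::field^'m^'m \<Rightarrow> 'k^'n^'n \<Rightarrow> (('m \<times> 'n) list \<Rightarrow>\<^sub>0 'k) set \<Rightarrow>
   ((('m \<times> 'm) list \<Rightarrow>\<^sub>0 'k) set \<times> (('m \<times> 'n) list \<Rightarrow>\<^sub>0 'k) set \<Rightarrow>\<^sub>0 'k) set" where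
  "BB_left_coaction E F =
    (let A = B_hopf E; Z = BB_algebra E F in
     presented_lift (tensor A Z)
       (\<lambda>(i, j). \<Oplus>\<^bsub>tensor A Z\<^esub>l\<in>UNIV. pure_tensor A Z (B_gen E i l) (BB_gen E F l j)))"

definition BB_right_coaction ::
  "'k::field^'m^'m \<Rightarrow> 'k^'n^'n \<Rightarrow> (('m \<times> 'n) list \<Rightarrow>\<^sub>0 'k) set \<Rightarrow>
   ((('m \<times> 'n) list \<Rightarrow>\<^sub>0 'k) set \<times> (('n \<times> 'n) list \<Rightarrow>\<^sub>0 'k) set \<Rightarrow>\<^sub>0 'k) set" where
  "BB_right_coaction E F =
    (let B = B_hopf F; Z = BB_algebra E F in
     presented_lift (tensor Z B)
       (\<lambda>(i, j). \<Oplus>\<^bsub>tensor Z B\<^esub>l\<in>UNIV. pure_tensor Z B (BB_gen E F i l) (B_gen F l j)))"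

end

theory Submission
  imports Defs
begin

text \<open>The algebras \<open>\<B>(E,F)\<close>, for all invertible matrices \<open>E, F\<close> of all sizes, form a cogroupoid: they
  behave like the coordinate algebras of the arrows of a groupoid, and the Hopf algebras
  \<open>\<B>(E) = \<B>(E,E)\<close> belong to its vertex groups. The theorem is a formal consequence of this.

  Call a matrix \<open>x\<close> over an algebra \<open>R\<close> an \<open>(E,F)\<close>-point if \<open>x\<^sup>* = F\<^sup>-\<^sup>1 \<^sup>tx E\<close> is a two-sided inverse
  of \<open>x\<close>. Algebra morphisms \<open>\<B>(E,F) \<rightarrow> R\<close> are the same as \<open>(E,F)\<close>-points of \<open>R\<close>. Three
  constructions of points give the structure maps:
  \<^item> If \<open>x\<close> is an \<open>(E,F)\<close>-point and \<open>y\<close> an \<open>(F,G)\<close>-point whose entries commute with those of \<open>x\<close>,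
    then \<open>(xy)\<^sup>* = y\<^sup>* x\<^sup>*\<close>, so that \<open>xy\<close> is an \<open>(E,G)\<close>-point (\<open>BB_point_mult\<close>). In
    \<open>\<B>(E,F) \<otimes> \<B>(F,G)\<close> this yields \<open>\<Delta> : \<B>(E,G) \<rightarrow> \<B>(E,F) \<otimes> \<B>(F,G)\<close> (\<open>BB_comult\<close>).
  \<^item> The identity matrix is an \<open>(E,E)\<close>-point of the ground field; this is \<open>\<epsilon>\<close> (\<open>BB_counit\<close>).
  \<^item> If \<open>y\<close> is an \<open>(F,E)\<close>-point of \<open>R\<close>, then \<open>y\<^sup>*\<close> is an \<open>(E,F)\<close>-point of the opposite algebra
    (\<open>BB_point_twisted_transpose\<close>); this is the anti-morphism
    \<open>S : \<B>(E,F) \<rightarrow> \<B>(F,E)\<close> (\<open>BB_antipode\<close>).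

  Coassociativity and the counit laws (\<open>BB_coassoc\<close>, \<open>BB_counit_left\<close>, \<open>BB_counit_right\<close>) are equalities
  of algebra morphisms and are checked on generators. The antipode laws
  \<open>x\<^sub>1 S(x\<^sub>2) = \<epsilon>(x) 1 = S(x\<^sub>1) x\<^sub>2\<close> (\<open>BB_antipode_right\<close>, \<open>BB_antipode_left\<close>), for \<open>x\<close> in \<open>\<B>(E,E)\<close>
  with \<open>x\<^sub>1 \<otimes> x\<^sub>2\<close> in \<open>\<B>(E,F) \<otimes> \<B>(F,E)\<close>, hold on generators by the definition of a point and
  propagate to products because \<open>S\<close> reverses products.

  Since \<open>\<alpha>\<close> and \<open>\<beta>\<close> are the maps \<open>\<Delta>\<close> with target \<open>\<B>(E,E) \<otimes> \<B>(E,F)\<close> and \<open>\<B>(E,F) \<otimes> \<B>(F,F)\<close>, the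
  Hopf algebra, comodule and bicomodule axioms are instances of these laws. The inverse of
  \<open>\<kappa>\<^sub>l : x \<otimes> y \<mapsto> x\<^sub>1 \<otimes> x\<^sub>2 y\<close> is \<open>a \<otimes> y \<mapsto> a\<^sub>1 \<otimes> S(a\<^sub>2) y\<close>, where now \<open>a\<^sub>1 \<otimes> a\<^sub>2\<close> is taken
  in \<open>\<B>(E,F) \<otimes> \<B>(F,E)\<close>: the composites send \<open>x \<otimes> y\<close> to \<open>x\<^sub>1 \<otimes> S(x\<^sub>2) x\<^sub>3 y = x \<otimes> y\<close> and \<open>a \<otimes> y\<close> to
  \<open>a\<^sub>1 \<otimes> a\<^sub>2 S(a\<^sub>3) y = a \<otimes> y\<close>. In the same way \<open>x \<otimes> b \<mapsto> x S(b\<^sub>1) \<otimes> b\<^sub>2\<close> is inverse to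
  \<open>\<kappa>\<^sub>r\<close> (\<open>BB_galois_left_bij\<close>, \<open>BB_galois_right_bij\<close>).

  All this rests on the universal properties of presented algebras and of tensor products in
  their concrete form as sets of cosets of finitely supported functions.\<close>


section \<open>Linear maps and algebra morphisms\<close>

lemma field_algebra_simps [simp]:
  "carrier field_algebra = UNIV" "x \<otimes>\<^bsub>field_algebra\<^esub> y = x * y" "\<one>\<^bsub>field_algebra\<^esub> = 1"
  "\<zero>\<^bsub>field_algebra\<^esub> = 0" "x \<oplus>\<^bsub>field_algebra\<^esub> y = x + y" "x \<odot>\<^bsub>field_algebra\<^esub> y = x * y"
  by (simp_all add: field_algebra_def)

lemma cring_field_algebra: "cring (field_algebra :: ('k::field, 'k) module)"
proof (rule cringI)
  show "abelian_group (field_algebra :: ('k, 'k) module)"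
  proof (rule abelian_groupI)
    fix x :: 'k
    show "\<exists>y\<in>carrier field_algebra. y \<oplus>\<^bsub>field_algebra\<^esub> x = \<zero>\<^bsub>field_algebra\<^esub>"
      by (rule bexI[of _ "- x"]) auto
  qed (auto simp: algebra_simps)
  show "Group.comm_monoid (field_algebra :: ('k, 'k) module)"
    by (rule comm_monoidI) (auto simp: algebra_simps)
qed (auto simp: algebra_simps)

lemma assoc_algebraI:
  fixes A :: "('k::field, 'a, 's) module_scheme"
  assumes "ring A"
    and "\<And>c x. x \<in> carrier A \<Longrightarrow> c \<odot>\<^bsub>A\<^esub> x \<in> carrier A"
    and "\<And>c d x. x \<in> carrier A \<Longrightarrow> (c + d) \<odot>\<^bsub>A\<^esub> x = c \<odot>\<^bsub>A\<^esub> x \<oplus>\<^bsub>A\<^esub> d \<odot>\<^bsub>A\<^esub> x"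
    and "\<And>c x y. x \<in> carrier A \<Longrightarrow> y \<in> carrier A \<Longrightarrow>
      c \<odot>\<^bsub>A\<^esub> (x \<oplus>\<^bsub>A\<^esub> y) = c \<odot>\<^bsub>A\<^esub> x \<oplus>\<^bsub>A\<^esub> c \<odot>\<^bsub>A\<^esub> y"
    and "\<And>c d x. x \<in> carrier A \<Longrightarrow> (c * d) \<odot>\<^bsub>A\<^esub> x = c \<odot>\<^bsub>A\<^esub> (d \<odot>\<^bsub>A\<^esub> x)"
    and "\<And>x. x \<in> carrier A \<Longrightarrow> 1 \<odot>\<^bsub>A\<^esub> x = x"
    and "\<And>c x y. x \<in> carrier A \<Longrightarrow> y \<in> carrier A \<Longrightarrow>
      (c \<odot>\<^bsub>A\<^esub> x) \<otimes>\<^bsub>A\<^esub> y = c \<odot>\<^bsub>A\<^esub> (x \<otimes>\<^bsub>A\<^esub> y)"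
    and "\<And>c x y. x \<in> carrier A \<Longrightarrow> y \<in> carrier A \<Longrightarrow>
      x \<otimes>\<^bsub>A\<^esub> (c \<odot>\<^bsub>A\<^esub> y) = c \<odot>\<^bsub>A\<^esub> (x \<otimes>\<^bsub>A\<^esub> y)"
  shows "assoc_algebra A"
proof -
  interpret ring A by fact
  have "Module.module (field_algebra :: ('k, 'k) module) A"
    by (rule moduleI) (use assms cring_field_algebra in \<open>auto intro: is_abelian_group\<close>)
  then show ?thesis
    by (intro assoc_algebra.intro assoc_algebra_axioms.intro assms)
qed

lemma assoc_algebra_field_algebra: "assoc_algebra (field_algebra :: ('k::field, 'k) module)"
  by (rule assoc_algebraI) (auto simp: algebra_simps cring.axioms(1) cring_field_algebra)

context assoc_algebra
begin

lemma smult_closed [simp, intro]: "x \<in> carrier A \<Longrightarrow> c \<odot>\<^bsub>A\<^esub> x \<in> carrier A"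
  using A.smult_closed[of c x] by simp

lemma smult_add_left: "x \<in> carrier A \<Longrightarrow> (c + d) \<odot>\<^bsub>A\<^esub> x = c \<odot>\<^bsub>A\<^esub> x \<oplus>\<^bsub>A\<^esub> d \<odot>\<^bsub>A\<^esub> x"
  using A.smult_l_distr[of c d x] by simp

lemma smult_add_right: "x \<in> carrier A \<Longrightarrow> y \<in> carrier A \<Longrightarrow>
    c \<odot>\<^bsub>A\<^esub> (x \<oplus>\<^bsub>A\<^esub> y) = c \<odot>\<^bsub>A\<^esub> x \<oplus>\<^bsub>A\<^esub> c \<odot>\<^bsub>A\<^esub> y"
  using A.smult_r_distr[of c x y] by simp

lemma smult_smult: "x \<in> carrier A \<Longrightarrow> c \<odot>\<^bsub>A\<^esub> (d \<odot>\<^bsub>A\<^esub> x) = (c * d) \<odot>\<^bsub>A\<^esub> x"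
  using A.smult_assoc1[of c d x] by simp

lemma one_smult [simp]: "x \<in> carrier A \<Longrightarrow> 1 \<odot>\<^bsub>A\<^esub> x = x"
  using A.smult_one[of x] by simp

lemma zero_smult [simp]: "x \<in> carrier A \<Longrightarrow> 0 \<odot>\<^bsub>A\<^esub> x = \<zero>\<^bsub>A\<^esub>"
  using A.smult_l_null[of x] by simp

lemma smult_zero [simp]: "c \<odot>\<^bsub>A\<^esub> \<zero>\<^bsub>A\<^esub> = \<zero>\<^bsub>A\<^esub>"
  using A.smult_r_null[of c] by simp

lemma uminus_smult: "x \<in> carrier A \<Longrightarrow> \<ominus>\<^bsub>A\<^esub> x = (- 1) \<odot>\<^bsub>A\<^esub> x"
  by (rule A.minus_equality)
    (use smult_add_left[of x "- 1" 1] in auto)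

lemma smult_finsum:
  "finite I \<Longrightarrow> (\<And>i. i \<in> I \<Longrightarrow> f i \<in> carrier A) \<Longrightarrow>
    c \<odot>\<^bsub>A\<^esub> (\<Oplus>\<^bsub>A\<^esub>i\<in>I. f i) = (\<Oplus>\<^bsub>A\<^esub>i\<in>I. c \<odot>\<^bsub>A\<^esub> f i)"
  using A.finsum_smult_ldistr[of I c f] by auto

end

text \<open>In this pointwise form the membership conditions are discharged by the simplifier.\<close>

lemma (in abelian_monoid) finsum_in_carrier [simp]:
  "(\<And>i. i \<in> I \<Longrightarrow> f i \<in> carrier G) \<Longrightarrow> finsum G f I \<in> carrier G"
  by (rule finsum_closed) auto

lemma linear_mapsI:
  assumes "\<And>x. x \<in> carrier V \<Longrightarrow> h x \<in> carrier W"
    and "\<And>x y. x \<in> carrier V \<Longrightarrow> y \<in> carrier V \<Longrightarrow> h (x \<oplus>\<^bsub>V\<^esub> y) = h x \<oplus>\<^bsub>W\<^esub> h y"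
    and "\<And>c x. x \<in> carrier V \<Longrightarrow> h (c \<odot>\<^bsub>V\<^esub> x) = c \<odot>\<^bsub>W\<^esub> h x"
  shows "h \<in> linear_maps V W"
  using assms by (auto simp: linear_maps_def)

lemma linear_mapsD:
  assumes "h \<in> linear_maps V W"
  shows "x \<in> carrier V \<Longrightarrow> h x \<in> carrier W"
    and "x \<in> carrier V \<Longrightarrow> y \<in> carrier V \<Longrightarrow> h (x \<oplus>\<^bsub>V\<^esub> y) = h x \<oplus>\<^bsub>W\<^esub> h y"
    and "x \<in> carrier V \<Longrightarrow> h (c \<odot>\<^bsub>V\<^esub> x) = c \<odot>\<^bsub>W\<^esub> h x"
  using assms by (auto simp: linear_maps_def)

lemma linear_maps_id: "id \<in> linear_maps V V"
  by (auto intro: linear_mapsI)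

lemma linear_maps_comp:
  "g \<in> linear_maps W U \<Longrightarrow> f \<in> linear_maps V W \<Longrightarrow> (\<lambda>x. g (f x)) \<in> linear_maps V U"
  by (rule linear_mapsI) (auto simp: linear_mapsD)

lemma linear_map_zero:
  assumes "assoc_algebra V" "assoc_algebra W" "h \<in> linear_maps V W"
  shows "h \<zero>\<^bsub>V\<^esub> = \<zero>\<^bsub>W\<^esub>"
proof -
  interpret V: assoc_algebra V by fact
  interpret W: assoc_algebra W by fact
  show ?thesis
    using linear_mapsD(3)[OF assms(3), of "\<zero>\<^bsub>V\<^esub>" 0] linear_mapsD(1)[OF assms(3), of "\<zero>\<^bsub>V\<^esub>"]
    by simp
qed

lemma linear_map_finsum:
  assumes "assoc_algebra V" "assoc_algebra W" "h \<in> linear_maps V W"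
    and "finite I" "\<And>i. i \<in> I \<Longrightarrow> f i \<in> carrier V"
  shows "h (\<Oplus>\<^bsub>V\<^esub>i\<in>I. f i) = (\<Oplus>\<^bsub>W\<^esub>i\<in>I. h (f i))"
proof -
  interpret V: assoc_algebra V by fact
  interpret W: assoc_algebra W by fact
  from assms(4,5) show ?thesis
  proof (induction I rule: finite_induct)
    case empty
    then show ?case using linear_map_zero[OF assms(1-3)] by simp
  next
    case (insert i I)
    have "h (\<Oplus>\<^bsub>V\<^esub>i\<in>insert i I. f i) = h (f i) \<oplus>\<^bsub>W\<^esub> h (\<Oplus>\<^bsub>V\<^esub>i\<in>I. f i)"
      using insert by (subst V.A.finsum_insert) (auto simp: linear_mapsD(2)[OF assms(3)])
    also have "\<dots> = (\<Oplus>\<^bsub>W\<^esub>i\<in>insert i I. h (f i))"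
      using insert by (subst W.A.finsum_insert) (auto simp: linear_mapsD(1)[OF assms(3)])
    finally show ?case .
  qed
qed

lemma linear_map_minus:
  assumes "assoc_algebra V" "assoc_algebra W" "h \<in> linear_maps V W"
    and "x \<in> carrier V" "y \<in> carrier V"
  shows "h (x \<ominus>\<^bsub>V\<^esub> y) = h x \<ominus>\<^bsub>W\<^esub> h y"
proof -
  interpret V: assoc_algebra V by fact
  interpret W: assoc_algebra W by fact
  show ?thesis
    using assms by (simp add: a_minus_def V.uminus_smult W.uminus_smult linear_mapsD)
qed

lemma linear_maps_cong:
  assumes "assoc_algebra V" "\<And>x. x \<in> carrier V \<Longrightarrow> f x = g x"
  shows "f \<in> linear_maps V W \<longleftrightarrow> g \<in> linear_maps V W"
proof -
  interpret V: assoc_algebra V by fact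
  show ?thesis
    using assms(2) by (auto simp: linear_maps_def Pi_iff)
qed

lemma linear_maps_add:
  assumes "assoc_algebra W" "f \<in> linear_maps V W" "g \<in> linear_maps V W"
  shows "(\<lambda>x. f x \<oplus>\<^bsub>W\<^esub> g x) \<in> linear_maps V W"
proof -
  interpret W: assoc_algebra W by fact
  show ?thesis
    by (rule linear_mapsI)
      (auto simp: linear_mapsD[OF assms(2)] linear_mapsD[OF assms(3)] W.A.a_ac W.smult_add_right)
qed

lemma (in assoc_algebra) mult_linear:
  assumes "u \<in> carrier A"
  shows "(\<lambda>t. t \<otimes>\<^bsub>A\<^esub> u) \<in> linear_maps A A" and "(\<lambda>t. u \<otimes>\<^bsub>A\<^esub> t) \<in> linear_maps A A"
  using assms
  by (auto intro!: linear_mapsI simp: A.l_distr A.r_distr smult_mult_left smult_mult_right)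

lemma algebra_homsI:
  assumes "h \<in> linear_maps A B"
    and "\<And>x y. x \<in> carrier A \<Longrightarrow> y \<in> carrier A \<Longrightarrow> h (x \<otimes>\<^bsub>A\<^esub> y) = h x \<otimes>\<^bsub>B\<^esub> h y"
    and "h \<one>\<^bsub>A\<^esub> = \<one>\<^bsub>B\<^esub>"
  shows "h \<in> algebra_homs A B"
  using assms by (auto simp: algebra_homs_def ring_hom_def linear_maps_def)

lemma algebra_homsD:
  assumes "h \<in> algebra_homs A B"
  shows "h \<in> linear_maps A B"
    and "x \<in> carrier A \<Longrightarrow> h x \<in> carrier B"
    and "x \<in> carrier A \<Longrightarrow> y \<in> carrier A \<Longrightarrow> h (x \<otimes>\<^bsub>A\<^esub> y) = h x \<otimes>\<^bsub>B\<^esub> h y"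
    and "h \<one>\<^bsub>A\<^esub> = \<one>\<^bsub>B\<^esub>"
  using assms by (auto simp: algebra_homs_def ring_hom_def)

lemma algebra_homs_id: "id \<in> algebra_homs A A"
  by (rule algebra_homsI) (auto simp: linear_maps_id)

lemma algebra_homs_comp:
  "g \<in> algebra_homs B C \<Longrightarrow> f \<in> algebra_homs A B \<Longrightarrow> (\<lambda>x. g (f x)) \<in> algebra_homs A C"
  by (rule algebra_homsI) (auto simp: algebra_homsD intro: linear_maps_comp[of g B C f A])

lemma assoc_algebra_opposite:
  assumes "assoc_algebra A"
  shows "assoc_algebra (opposite_algebra A)"
proof -
  interpret assoc_algebra A by fact
  have [simp]: "carrier (opposite_algebra A) = carrier A" "\<one>\<^bsub>opposite_algebra A\<^esub> = \<one>\<^bsub>A\<^esub>"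
    "x \<otimes>\<^bsub>opposite_algebra A\<^esub> y = y \<otimes>\<^bsub>A\<^esub> x" "\<zero>\<^bsub>opposite_algebra A\<^esub> = \<zero>\<^bsub>A\<^esub>"
    "x \<oplus>\<^bsub>opposite_algebra A\<^esub> y = x \<oplus>\<^bsub>A\<^esub> y" "c \<odot>\<^bsub>opposite_algebra A\<^esub> x = c \<odot>\<^bsub>A\<^esub> x" for c x y
    by (simp_all add: opposite_algebra_def)
  show ?thesis
  proof (rule assoc_algebraI)
    show "ring (opposite_algebra A)"
    proof (rule ringI)
      show "abelian_group (opposite_algebra A)"
        by (rule abelian_groupI) (auto simp: A.a_ac intro: A.l_neg A.a_inv_closed)
      show "Group.monoid (opposite_algebra A)"
        by (rule monoidI) (auto simp: A.m_assoc)
    qed (auto simp: A.l_distr A.r_distr)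
  qed (auto simp: smult_add_left smult_add_right smult_smult smult_mult_left smult_mult_right)
qed


section \<open>Linear extension to finitely supported functions\<close>

text \<open>Scaling by \<^term>\<open>c\<close> is \<^const>\<open>Poly_Mapping.map\<close> of a multiplication; it is well behaved
  because the zero scalar is mapped to itself.\<close>

lemma lookup_scale [simp]: "Poly_Mapping.lookup (Poly_Mapping.map ((*) c) p) x = c * Poly_Mapping.lookup p x"
  for c :: "'k::field"
  by (transfer) (auto simp: when_def)

lemma keys_scale: "Poly_Mapping.keys (Poly_Mapping.map ((*) c) p) \<subseteq> Poly_Mapping.keys p"
  for c :: "'k::field"
  by (auto simp: in_keys_iff)

lemma scale_single [simp]:
  "Poly_Mapping.map ((*) c) (Poly_Mapping.single x d) = Poly_Mapping.single x (c * d)" for c :: "'k::field"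
  by (rule poly_mapping_eqI) (auto simp: lookup_single when_def)

lemma scale_minus_one: "Poly_Mapping.map ((*) (- 1)) p = - (p :: 'x \<Rightarrow>\<^sub>0 'k::field)"
  by (rule poly_mapping_eqI) simp

text \<open>The span of the bilinearity relations is taken with respect to this module structure.\<close>

lemma module_scale: "Modules.module (\<lambda>c. Poly_Mapping.map ((*) (c::'k::field)) :: ('x \<Rightarrow>\<^sub>0 'k) \<Rightarrow> _)"
  by unfold_locales (rule poly_mapping_eqI, simp add: lookup_add algebra_simps)+

context assoc_algebra
begin

text \<open>Sums over different supports are compared by enlarging them to sums over a common finite set.\<close>

lemma linear_extension_superset:
  assumes "finite S" "Poly_Mapping.keys p \<subseteq> S" "f \<in> S \<rightarrow> carrier A"
  shows "linear_extension A f p = (\<Oplus>\<^bsub>A\<^esub>x\<in>S. Poly_Mapping.lookup p x \<odot>\<^bsub>A\<^esub> f x)"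
  unfolding linear_extension_def
  using assms
  by (intro A.add.finprod_mono_neutral_cong_left) (auto simp: in_keys_iff Pi_iff)

lemma linear_extension_closed:
  "f \<in> Poly_Mapping.keys p \<rightarrow> carrier A \<Longrightarrow> linear_extension A f p \<in> carrier A"
  unfolding linear_extension_def by (auto simp: Pi_iff)

lemma linear_extension_add:
  assumes "f \<in> Poly_Mapping.keys p \<union> Poly_Mapping.keys q \<rightarrow> carrier A"
  shows "linear_extension A f (p + q) = linear_extension A f p \<oplus>\<^bsub>A\<^esub> linear_extension A f q"
proof -
  let ?S = "Poly_Mapping.keys p \<union> Poly_Mapping.keys q"
  have 1: "linear_extension A f r = (\<Oplus>\<^bsub>A\<^esub>x\<in>?S. Poly_Mapping.lookup r x \<odot>\<^bsub>A\<^esub> f x)"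
    if "Poly_Mapping.keys r \<subseteq> ?S" for r
    using that assms by (intro linear_extension_superset) auto
  have 2: "f x \<in> carrier A" if "x \<in> ?S" for x
    using assms that by auto
  show ?thesis
    using assms by (subst 1 1 1, simp add: keys_add, simp, simp)+
      (subst A.finsum_addf[symmetric], auto simp: lookup_add smult_add_left Pi_iff
        intro!: A.finsum_cong')
qed

lemma linear_extension_scale:
  assumes "f \<in> Poly_Mapping.keys p \<rightarrow> carrier A"
  shows "linear_extension A f (Poly_Mapping.map ((*) c) p) = c \<odot>\<^bsub>A\<^esub> linear_extension A f p"
proof -
  have "linear_extension A f (Poly_Mapping.map ((*) c) p)
      = (\<Oplus>\<^bsub>A\<^esub>x\<in>Poly_Mapping.keys p. (c * Poly_Mapping.lookup p x) \<odot>\<^bsub>A\<^esub> f x)"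
    using assms keys_scale[of c p] by (subst linear_extension_superset[of "Poly_Mapping.keys p"]) auto
  also have "\<dots> = (\<Oplus>\<^bsub>A\<^esub>x\<in>Poly_Mapping.keys p. c \<odot>\<^bsub>A\<^esub> (Poly_Mapping.lookup p x \<odot>\<^bsub>A\<^esub> f x))"
    using assms by (intro A.finsum_cong') (auto simp: smult_smult Pi_iff)
  also have "\<dots> = c \<odot>\<^bsub>A\<^esub> linear_extension A f p"
    unfolding linear_extension_def using assms by (subst smult_finsum) (auto simp: Pi_iff)
  finally show ?thesis .
qed

lemma linear_extension_single:
  assumes "f x \<in> carrier A"
  shows "linear_extension A f (Poly_Mapping.single x c) = c \<odot>\<^bsub>A\<^esub> f x"
  using assms by (subst linear_extension_superset[of "{x}"]) auto

lemma linear_extension_zero [simp]: "linear_extension A f 0 = \<zero>\<^bsub>A\<^esub>"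
  unfolding linear_extension_def by simp

end

text \<open>Every finitely supported function is the sum of the point masses on its support. As each summand is
  supported in \<open>S\<close>, so are all partial sums, and the induction never leaves the functions
  supported in \<open>S\<close>.\<close>

lemma poly_mapping_supported_induct [consumes 1, case_names zero single add]:
  fixes p :: "'x \<Rightarrow>\<^sub>0 'k::field"
  assumes "Poly_Mapping.keys p \<subseteq> S"
    and "P 0"
    and "\<And>x c. x \<in> S \<Longrightarrow> P (Poly_Mapping.single x c)"
    and "\<And>p q. Poly_Mapping.keys p \<subseteq> S \<Longrightarrow> Poly_Mapping.keys q \<subseteq> S \<Longrightarrow> P p \<Longrightarrow> P q \<Longrightarrow> P (p + q)"
  shows "P p"
proof -
  have *: "P (\<Sum>x\<in>T. Poly_Mapping.single x (f x)) \<and>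
      Poly_Mapping.keys (\<Sum>x\<in>T. Poly_Mapping.single x (f x)) \<subseteq> S"
    if "finite T" "T \<subseteq> S" for T and f :: "'x \<Rightarrow> 'k"
    using that
  proof (induction T rule: finite_induct)
    case empty
    then show ?case using assms(2) by simp
  next
    case (insert x T)
    have s: "Poly_Mapping.keys (Poly_Mapping.single x (f x)) \<subseteq> S"
      using insert.prems by simp
    moreover have "Poly_Mapping.keys (Poly_Mapping.single x (f x) + (\<Sum>x\<in>T. Poly_Mapping.single x (f x))) \<subseteq> S"
      using s insert keys_add[of "Poly_Mapping.single x (f x)" "\<Sum>x\<in>T. Poly_Mapping.single x (f x)"]
      by blast
    ultimately show ?case
      using insert assms(3)[of x "f x"] assms(4) by auto
  qed
  have "p = (\<Sum>x\<in>Poly_Mapping.keys p. Poly_Mapping.single x (Poly_Mapping.lookup p x))"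
    by (rule poly_mapping_eqI) (auto simp: lookup_sum lookup_single when_def in_keys_iff)
  then show ?thesis
    using *[of "Poly_Mapping.keys p" "Poly_Mapping.lookup p"] assms(1) by simp
qed


section \<open>Quotient algebras\<close>

locale algebra_ideal = assoc_algebra A + I: ideal I A
  for A :: "('k::field, 'a, 's) module_scheme" and I
begin

abbreviation Q where "Q \<equiv> quotient_algebra A I"

abbreviation proj where "proj x \<equiv> I +>\<^bsub>A\<^esub> x"

text \<open>A two-sided ideal is a linear subspace, since scaling is multiplication by a multiple of the unit.\<close>

lemma smult_ideal: "x \<in> I \<Longrightarrow> c \<odot>\<^bsub>A\<^esub> x \<in> I"
  using I.I_l_closed[of x "c \<odot>\<^bsub>A\<^esub> \<one>\<^bsub>A\<^esub>"] smult_mult_left[of "\<one>\<^bsub>A\<^esub>" x c] I.a_Hcarr[of x] by simp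

lemma proj_eq_iff: "x \<in> carrier A \<Longrightarrow> y \<in> carrier A \<Longrightarrow> proj x = proj y \<longleftrightarrow> x \<ominus>\<^bsub>A\<^esub> y \<in> I"
  using A.quotient_eq_iff_same_a_r_cos[OF I.is_ideal] by blast

lemma mem_proj_iff: "x \<in> carrier A \<Longrightarrow> y \<in> proj x \<longleftrightarrow> y \<in> carrier A \<and> y \<ominus>\<^bsub>A\<^esub> x \<in> I"
  by (metis I.a_elemrcos_carrier I.a_rcos_self proj_eq_iff I.a_repr_independence')

text \<open>The union that defines the scalar multiplication of a quotient runs over equal cosets.\<close>

lemma proj_smult:
  assumes "x \<in> carrier A"
  shows "(\<Union>y\<in>proj x. proj (c \<odot>\<^bsub>A\<^esub> y)) = proj (c \<odot>\<^bsub>A\<^esub> x)"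
proof -
  have "proj (c \<odot>\<^bsub>A\<^esub> y) = proj (c \<odot>\<^bsub>A\<^esub> x)" if "y \<in> proj x" for y
  proof -
    from that assms have y: "y \<in> carrier A" "y \<ominus>\<^bsub>A\<^esub> x \<in> I"
      by (simp_all add: mem_proj_iff)
    have "c \<odot>\<^bsub>A\<^esub> y \<ominus>\<^bsub>A\<^esub> c \<odot>\<^bsub>A\<^esub> x = c \<odot>\<^bsub>A\<^esub> (y \<ominus>\<^bsub>A\<^esub> x)"
      using assms y(1) by (simp add: a_minus_def uminus_smult smult_add_right smult_smult mult.commute)
    then show ?thesis
      using assms y smult_ideal[OF y(2), of c] by (simp add: proj_eq_iff)
  qed
  moreover have "x \<in> proj x"
    using assms by (rule I.a_rcos_self)
  ultimately show ?thesis by blast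
qed

lemma quotient_simps:
  "carrier Q = proj ` carrier A"
  "\<one>\<^bsub>Q\<^esub> = proj \<one>\<^bsub>A\<^esub>"
  "\<zero>\<^bsub>Q\<^esub> = proj \<zero>\<^bsub>A\<^esub>"
  "x \<in> carrier A \<Longrightarrow> y \<in> carrier A \<Longrightarrow> proj x \<otimes>\<^bsub>Q\<^esub> proj y = proj (x \<otimes>\<^bsub>A\<^esub> y)"
  "x \<in> carrier A \<Longrightarrow> y \<in> carrier A \<Longrightarrow> proj x \<oplus>\<^bsub>Q\<^esub> proj y = proj (x \<oplus>\<^bsub>A\<^esub> y)"
  "x \<in> carrier A \<Longrightarrow> c \<odot>\<^bsub>Q\<^esub> proj x = proj (c \<odot>\<^bsub>A\<^esub> x)"
  using A.a_rcos_zero[OF I.is_ideal I.zero_closed]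
  by (auto simp: quotient_algebra_def FactRing_def A_RCOSETS_def' I.rcoset_mult_add I.a_rcos_sum
      proj_smult)

lemma quotient_assoc_algebra: "assoc_algebra Q"
proof (rule assoc_algebraI)
  have [simp]: "carrier Q = carrier (A Quot I)" "x \<otimes>\<^bsub>Q\<^esub> y = x \<otimes>\<^bsub>A Quot I\<^esub> y" "\<one>\<^bsub>Q\<^esub> = \<one>\<^bsub>A Quot I\<^esub>"
    "\<zero>\<^bsub>Q\<^esub> = \<zero>\<^bsub>A Quot I\<^esub>" "x \<oplus>\<^bsub>Q\<^esub> y = x \<oplus>\<^bsub>A Quot I\<^esub> y" for x y
    by (simp_all add: quotient_algebra_def)
  interpret R: ring "A Quot I" by (rule I.quotient_is_ring)
  show "ring Q"
  proof (rule ringI)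
    show "abelian_group Q"
      by (rule abelian_groupI) (auto simp: R.a_ac intro: R.l_neg R.a_inv_closed)
    show "Group.monoid Q"
      by (rule monoidI) (auto simp: R.m_assoc)
  qed (auto simp: R.l_distr R.r_distr)
qed (auto simp: quotient_simps smult_add_left smult_add_right smult_smult smult_mult_left smult_mult_right)

lemma proj_hom: "(\<lambda>x. proj x) \<in> algebra_homs A Q"
  by (intro algebra_homsI linear_mapsI) (auto simp: quotient_simps)

text \<open>A linear map that vanishes on the ideal is constant on cosets, so that the set of its values
  on a coset is a singleton.\<close>

lemma the_elem_proj:
  assumes "assoc_algebra B" "h \<in> linear_maps A B" "\<And>y. y \<in> I \<Longrightarrow> h y = \<zero>\<^bsub>B\<^esub>" "x \<in> carrier A"
  shows "the_elem (h ` proj x) = h x"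
proof -
  interpret B: assoc_algebra B by fact
  have "h y = h x" if "y \<in> proj x" for y
  proof -
    from that assms have y: "y \<in> carrier A" "y \<ominus>\<^bsub>A\<^esub> x \<in> I"
      by (simp_all add: mem_proj_iff)
    have "h y \<ominus>\<^bsub>B\<^esub> h x = \<zero>\<^bsub>B\<^esub>"
      using linear_map_minus[OF assoc_algebra_axioms assms(1,2) y(1) assms(4)] assms(3)[OF y(2)] by simp
    then show ?thesis
      using y(1) assms by (simp add: linear_mapsD)
  qed
  moreover have "x \<in> proj x"
    using assms by (intro I.a_rcos_self)
  ultimately have "h ` proj x = {h x}" by blast
  then show ?thesis by simp
qed

lemma induced_linear_map:
  assumes "assoc_algebra B" "h \<in> linear_maps A B" "\<And>y. y \<in> I \<Longrightarrow> h y = \<zero>\<^bsub>B\<^esub>"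
  shows "(\<lambda>K. the_elem (h ` K)) \<in> linear_maps Q B"
  using the_elem_proj[OF assms]
  by (intro linear_mapsI) (auto simp: quotient_simps linear_mapsD[OF assms(2)])

lemma induced_algebra_hom:
  assumes "assoc_algebra B" "h \<in> algebra_homs A B" "\<And>y. y \<in> I \<Longrightarrow> h y = \<zero>\<^bsub>B\<^esub>"
  shows "(\<lambda>K. the_elem (h ` K)) \<in> algebra_homs Q B"
  using the_elem_proj[OF assms(1) algebra_homsD(1)[OF assms(2)] assms(3)]
  by (intro algebra_homsI induced_linear_map algebra_homsD(1)[OF assms(2)] assms(1,3))
    (auto simp: quotient_simps algebra_homsD[OF assms(2)])

end


section \<open>Monoid algebras\<close>

context
  fixes M :: "('x, 's) monoid_scheme"
begin

private abbreviation K :: "('k::field, 'x \<Rightarrow>\<^sub>0 'k) module" where "K \<equiv> monoid_algebra M"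

lemma monoid_algebra_simps:
  "carrier K = {p. Poly_Mapping.keys p \<subseteq> carrier M}" "\<one>\<^bsub>K\<^esub> = Poly_Mapping.single \<one>\<^bsub>M\<^esub> 1"
  "\<zero>\<^bsub>K\<^esub> = 0" "p \<oplus>\<^bsub>K\<^esub> q = p + q" "c \<odot>\<^bsub>K\<^esub> p = Poly_Mapping.map ((*) c) p"
  by (simp_all add: monoid_algebra_def)

text \<open>The double sum over supports is not visibly bilinear, as the supports vary; over fixed
  larger index sets it is.\<close>

lemma monoid_algebra_mult_superset:
  assumes "finite S" "finite T" "Poly_Mapping.keys p \<subseteq> S" "Poly_Mapping.keys q \<subseteq> T"
  shows "p \<otimes>\<^bsub>K\<^esub> q = (\<Sum>x\<in>S. \<Sum>y\<in>T.
    Poly_Mapping.single (x \<otimes>\<^bsub>M\<^esub> y) (Poly_Mapping.lookup p x * Poly_Mapping.lookup q y))"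
proof -
  have "(\<Sum>y\<in>T. Poly_Mapping.single (x \<otimes>\<^bsub>M\<^esub> y) (Poly_Mapping.lookup p x * Poly_Mapping.lookup q y))
      = (\<Sum>y\<in>Poly_Mapping.keys q.
          Poly_Mapping.single (x \<otimes>\<^bsub>M\<^esub> y) (Poly_Mapping.lookup p x * Poly_Mapping.lookup q y))" for x
    using assms by (intro sum.mono_neutral_right) (auto simp: in_keys_iff)
  moreover have "(\<Sum>x\<in>S. \<Sum>y\<in>Poly_Mapping.keys q.
        Poly_Mapping.single (x \<otimes>\<^bsub>M\<^esub> y) (Poly_Mapping.lookup p x * Poly_Mapping.lookup q y))
      = p \<otimes>\<^bsub>K\<^esub> q"
    unfolding monoid_algebra_def
    using assms by (simp, intro sum.mono_neutral_right) (auto simp: in_keys_iff)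
  ultimately show ?thesis by simp
qed

lemma monoid_algebra_mult_add_left: "(p + p') \<otimes>\<^bsub>K\<^esub> q = p \<otimes>\<^bsub>K\<^esub> q + p' \<otimes>\<^bsub>K\<^esub> q"
proof -
  let ?S = "Poly_Mapping.keys p \<union> Poly_Mapping.keys p'"
  note 1 = monoid_algebra_mult_superset[of ?S "Poly_Mapping.keys q" _ q]
  show ?thesis
    by (subst 1 1 1; (simp add: keys_add)?)+
      (simp add: lookup_add distrib_right single_add sum.distrib)
qed

lemma monoid_algebra_mult_add_right: "p \<otimes>\<^bsub>K\<^esub> (q + q') = p \<otimes>\<^bsub>K\<^esub> q + p \<otimes>\<^bsub>K\<^esub> q'"
proof -
  let ?S = "Poly_Mapping.keys q \<union> Poly_Mapping.keys q'"
  note 1 = monoid_algebra_mult_superset[of "Poly_Mapping.keys p" ?S p]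
  show ?thesis
    by (subst 1 1 1; (simp add: keys_add)?)+
      (simp add: lookup_add distrib_left single_add sum.distrib)
qed

lemma scale_sum:
  "Poly_Mapping.map ((*) c) (\<Sum>x\<in>S. f x) = (\<Sum>x\<in>S. Poly_Mapping.map ((*) c) (f x))" for c :: "'k::field"
  by (rule poly_mapping_eqI) (simp add: lookup_sum sum_distrib_left)

lemma monoid_algebra_mult_scale_left:
  "Poly_Mapping.map ((*) c) p \<otimes>\<^bsub>K\<^esub> q = Poly_Mapping.map ((*) c) (p \<otimes>\<^bsub>K\<^esub> q)"
  using keys_scale[of c p]
  by (simp add: monoid_algebra_mult_superset[of "Poly_Mapping.keys p" "Poly_Mapping.keys q"]
      scale_sum mult_ac)

lemma monoid_algebra_mult_scale_right:
  "p \<otimes>\<^bsub>K\<^esub> Poly_Mapping.map ((*) c) q = Poly_Mapping.map ((*) c) (p \<otimes>\<^bsub>K\<^esub> q)"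
  using keys_scale[of c q]
  by (simp add: monoid_algebra_mult_superset[of "Poly_Mapping.keys p" "Poly_Mapping.keys q"]
      scale_sum mult_ac)

lemma monoid_algebra_mult_single:
  "Poly_Mapping.single x c \<otimes>\<^bsub>K\<^esub> Poly_Mapping.single y d = Poly_Mapping.single (x \<otimes>\<^bsub>M\<^esub> y) (c * d)"
  by (subst monoid_algebra_mult_superset[of "{x}" "{y}"]) auto

lemma monoid_algebra_mult_zero: "0 \<otimes>\<^bsub>K\<^esub> q = 0" "q \<otimes>\<^bsub>K\<^esub> 0 = 0"
  by (simp_all add: monoid_algebra_def)

lemmas monoid_algebra_mult_simps = monoid_algebra_mult_add_left monoid_algebra_mult_add_right
  monoid_algebra_mult_scale_left monoid_algebra_mult_scale_right monoid_algebra_mult_single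
  monoid_algebra_mult_zero

text \<open>The product is bilinear, so the ring laws reduce to point masses, where they are the laws of
  the monoid.\<close>

lemma assoc_algebra_monoid_algebra:
  assumes "Group.monoid M"
  shows "assoc_algebra (K :: ('k::field, 'x \<Rightarrow>\<^sub>0 'k) module)"
proof -
  interpret M: Group.monoid M by fact
  let ?K = "K :: ('k, 'x \<Rightarrow>\<^sub>0 'k) module"
  let ?supp = "\<lambda>p. Poly_Mapping.keys (p :: 'x \<Rightarrow>\<^sub>0 'k) \<subseteq> carrier M"
  have add_mem: "x \<in> Poly_Mapping.keys (p + q) \<Longrightarrow> ?supp p \<Longrightarrow> ?supp q \<Longrightarrow> x \<in> carrier M" for x p q
    using keys_add[of p q] by blast
  have mult_closed: "?supp (p \<otimes>\<^bsub>?K\<^esub> q)" if "?supp p" "?supp q" for p q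
    using that(1)
  proof (induction rule: poly_mapping_supported_induct)
    case (single x c)
    from that(2) show ?case
      by (induction rule: poly_mapping_supported_induct)
        (use single in \<open>auto simp: monoid_algebra_mult_simps dest: add_mem\<close>)
  qed (auto simp: monoid_algebra_mult_simps dest: add_mem)
  have assoc: "(p \<otimes>\<^bsub>?K\<^esub> q) \<otimes>\<^bsub>?K\<^esub> r = p \<otimes>\<^bsub>?K\<^esub> (q \<otimes>\<^bsub>?K\<^esub> r)"
    if p: "?supp p" and q: "?supp q" and r: "?supp r" for p q r
    using p
  proof (induction rule: poly_mapping_supported_induct)
    case p: (single x c)
    from q show ?case
    proof (induction rule: poly_mapping_supported_induct)
      case q: (single y d)
      from r show ?case
        by (induction rule: poly_mapping_supported_induct)
          (use p q in \<open>auto simp: monoid_algebra_mult_simps M.m_assoc mult.assoc\<close>)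
    qed (auto simp: monoid_algebra_mult_simps)
  qed (auto simp: monoid_algebra_mult_simps)
  have one: "\<one>\<^bsub>?K\<^esub> \<otimes>\<^bsub>?K\<^esub> p = p" "p \<otimes>\<^bsub>?K\<^esub> \<one>\<^bsub>?K\<^esub> = p" if "?supp p" for p
    using that by (induction rule: poly_mapping_supported_induct)
      (auto simp: monoid_algebra_mult_simps monoid_algebra_simps)
  have scale_closed: "?supp (Poly_Mapping.map ((*) c) p)" if "?supp p" for c p
    using that keys_scale[of c p] by blast
  have minus: "\<exists>q. ?supp q \<and> q + p = 0" if "?supp p" for p
    using that by (intro exI[of _ "- p"]) auto
  show ?thesis
  proof (rule assoc_algebraI)
    show "ring ?K"
    proof (rule ringI)
      show "abelian_group ?K"
        by (rule abelian_groupI) (use minus in \<open>auto simp: monoid_algebra_simps add_ac dest: add_mem\<close>)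
      show "Group.monoid ?K"
        by (rule monoidI)
          (auto simp: monoid_algebra_simps(1) assoc one dest: mult_closed[THEN subsetD],
            auto simp: monoid_algebra_simps)
    qed (auto simp: monoid_algebra_simps monoid_algebra_mult_simps)
  qed (use scale_closed in \<open>auto simp: monoid_algebra_simps monoid_algebra_mult_simps
      intro!: poly_mapping_eqI simp: lookup_add algebra_simps\<close>)
qed

end


section \<open>Algebras given by generators and relations\<close>

lemma assoc_algebra_free_algebra: "assoc_algebra (free_algebra :: ('k::field, 'x list \<Rightarrow>\<^sub>0 'k) module)"
  unfolding free_algebra_def
  by (rule assoc_algebra_monoid_algebra) (auto intro: monoidI)

lemma free_algebra_simps:
  "carrier free_algebra = UNIV" "\<one>\<^bsub>free_algebra\<^esub> = Poly_Mapping.single [] 1"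
  "\<zero>\<^bsub>free_algebra\<^esub> = 0" "p \<oplus>\<^bsub>free_algebra\<^esub> q = p + q"
  "c \<odot>\<^bsub>free_algebra\<^esub> p = Poly_Mapping.map ((*) c) p"
  by (simp_all add: free_algebra_def monoid_algebra_simps)

text \<open>The map on representatives that \<^const>\<open>presented_lift\<close> descends to cosets: the algebra morphism
  that extends \<open>g\<close> from the letters to the free algebra.\<close>

definition free_lift :: "('k::field, 'a, 's) module_scheme \<Rightarrow> ('x \<Rightarrow> 'a) \<Rightarrow> ('x list \<Rightarrow>\<^sub>0 'k) \<Rightarrow> 'a" where
  "free_lift A g = linear_extension A (\<lambda>w. foldr (\<lambda>x y. g x \<otimes>\<^bsub>A\<^esub> y) w \<one>\<^bsub>A\<^esub>)"

context assoc_algebra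
begin

lemma foldr_mult_closed:
  "(\<And>x. g x \<in> carrier A) \<Longrightarrow> foldr (\<lambda>x y. g x \<otimes>\<^bsub>A\<^esub> y) w \<one>\<^bsub>A\<^esub> \<in> carrier A"
  by (induction w) auto

lemma foldr_mult_append:
  "(\<And>x. g x \<in> carrier A) \<Longrightarrow> foldr (\<lambda>x y. g x \<otimes>\<^bsub>A\<^esub> y) (v @ w) \<one>\<^bsub>A\<^esub> =
    foldr (\<lambda>x y. g x \<otimes>\<^bsub>A\<^esub> y) v \<one>\<^bsub>A\<^esub> \<otimes>\<^bsub>A\<^esub> foldr (\<lambda>x y. g x \<otimes>\<^bsub>A\<^esub> y) w \<one>\<^bsub>A\<^esub>"
  using foldr_mult_closed[of g] by (induction v) (auto simp: A.m_assoc)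

lemma free_lift_hom:
  assumes "\<And>x. g x \<in> carrier A"
  shows "free_lift A g \<in> algebra_homs free_algebra A"
proof -
  note closed = foldr_mult_closed[of g, OF assms]
  have add: "free_lift A g (p + q) = free_lift A g p \<oplus>\<^bsub>A\<^esub> free_lift A g q" for p q
    unfolding free_lift_def using closed by (intro linear_extension_add) auto
  have scale: "free_lift A g (Poly_Mapping.map ((*) c) p) = c \<odot>\<^bsub>A\<^esub> free_lift A g p" for c p
    unfolding free_lift_def using closed by (intro linear_extension_scale) auto
  have lift_single: "free_lift A g (Poly_Mapping.single w c) = c \<odot>\<^bsub>A\<^esub> foldr (\<lambda>x y. g x \<otimes>\<^bsub>A\<^esub> y) w \<one>\<^bsub>A\<^esub>" for w c
    unfolding free_lift_def using closed by (intro linear_extension_single) auto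
  have zero: "free_lift A g 0 = \<zero>\<^bsub>A\<^esub>"
    by (simp add: free_lift_def)
  have lift_closed [simp]: "free_lift A g p \<in> carrier A" for p
    unfolding free_lift_def using closed by (intro linear_extension_closed) auto
  have mult: "free_lift A g (p \<otimes>\<^bsub>free_algebra\<^esub> q) = free_lift A g p \<otimes>\<^bsub>A\<^esub> free_lift A g q" for p q
    using subset_UNIV[of "Poly_Mapping.keys p"]
  proof (induction rule: poly_mapping_supported_induct)
    case p: (single x c)
    show ?case
      using subset_UNIV[of "Poly_Mapping.keys q"]
    proof (induction rule: poly_mapping_supported_induct)
      case (single y d)
      show ?case
        by (simp add: free_algebra_def monoid_algebra_mult_simps lift_single foldr_mult_append assms closed
            smult_mult_left smult_mult_right smult_smult mult.commute del: foldr_append)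
    qed (auto simp: free_algebra_def monoid_algebra_mult_simps add zero A.r_distr)
  qed (auto simp: free_algebra_def monoid_algebra_mult_simps add zero A.l_distr)
  show ?thesis
    by (intro algebra_homsI linear_mapsI)
      (auto simp: free_algebra_simps add scale mult lift_single)
qed

lemma free_lift_generator: "(\<And>x. g x \<in> carrier A) \<Longrightarrow> free_lift A g (free_generator x) = g x"
  unfolding free_lift_def free_generator_def
  using linear_extension_single[of "\<lambda>w. foldr (\<lambda>x y. g x \<otimes>\<^bsub>A\<^esub> y) w \<one>\<^bsub>A\<^esub>" "[x]" 1]
  by simp

text \<open>The kernel of a morphism is an ideal; once it contains the relations, it contains the ideal that
  they generate.\<close>

lemma free_lift_genideal:
  fixes R :: "('x list \<Rightarrow>\<^sub>0 'k) set"
  assumes "\<And>x. g x \<in> carrier A" "\<And>r. r \<in> R \<Longrightarrow> free_lift A g r = \<zero>\<^bsub>A\<^esub>" "r \<in> Idl\<^bsub>free_algebra\<^esub> R"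
  shows "free_lift A g r = \<zero>\<^bsub>A\<^esub>"
proof -
  interpret F: assoc_algebra "free_algebra :: ('k, 'x list \<Rightarrow>\<^sub>0 'k) module"
    by (rule assoc_algebra_free_algebra)
  have "free_lift A g \<in> ring_hom free_algebra A"
    using free_lift_hom[of g, OF assms(1)] by (simp add: algebra_homs_def)
  then have hom: "ring_hom_ring free_algebra A (free_lift A g)"
    by (rule ring_hom_ringI2[OF F.A.ring_axioms A.ring_axioms])
  have "Idl\<^bsub>free_algebra\<^esub> R \<subseteq> a_kernel free_algebra A (free_lift A g)"
    by (rule F.A.genideal_minimal[OF ring_hom_ring.kernel_is_ideal[OF hom]])
      (auto simp: a_kernel_def' free_algebra_simps assms)
  with assms(3) show ?thesis
    by (auto simp: a_kernel_def')
qed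

end

lemma algebra_ideal_presented:
  fixes R :: "('x list \<Rightarrow>\<^sub>0 'k::field) set"
  shows "algebra_ideal free_algebra (Idl\<^bsub>free_algebra\<^esub> R)"
proof -
  interpret F: assoc_algebra "free_algebra :: ('k, 'x list \<Rightarrow>\<^sub>0 'k) module"
    by (rule assoc_algebra_free_algebra)
  show ?thesis
    by (intro algebra_ideal.intro assoc_algebra_free_algebra F.A.genideal_ideal)
      (simp add: free_algebra_simps)
qed

lemma assoc_algebra_presented: "assoc_algebra (presented_algebra R)"
  unfolding presented_algebra_def
  by (rule algebra_ideal.quotient_assoc_algebra[OF algebra_ideal_presented])

lemma presented_generator_closed: "presented_generator R x \<in> carrier (presented_algebra R)"
  unfolding presented_generator_def presented_algebra_def
  by (auto simp: algebra_ideal.quotient_simps[OF algebra_ideal_presented] free_algebra_simps)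

lemma presented_lift_conv: "presented_lift A g = (\<lambda>K. the_elem (free_lift A g ` K))"
  by (simp add: presented_lift_def free_lift_def fun_eq_iff)

lemma
  assumes A: "assoc_algebra A" and g: "\<And>x. g x \<in> carrier A"
    and R: "\<And>r. r \<in> R \<Longrightarrow> free_lift A g r = \<zero>\<^bsub>A\<^esub>"
  shows presented_lift_hom: "presented_lift A g \<in> algebra_homs (presented_algebra R) A"
    and presented_lift_generator: "presented_lift A g (presented_generator R x) = g x"
proof -
  interpret A: assoc_algebra A by fact
  note kernel = A.free_lift_genideal[of g R, OF g R]
  show "presented_lift A g \<in> algebra_homs (presented_algebra R) A"
    unfolding presented_lift_conv presented_algebra_def
    by (rule algebra_ideal.induced_algebra_hom[OF algebra_ideal_presented A A.free_lift_hom])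
      (use g kernel in auto)
  show "presented_lift A g (presented_generator R x) = g x"
    unfolding presented_lift_conv presented_generator_def
    by (subst algebra_ideal.the_elem_proj[OF algebra_ideal_presented A])
      (use g kernel in \<open>auto intro: algebra_homsD A.free_lift_hom simp: free_algebra_simps A.free_lift_generator\<close>)
qed

lemma proj_presented_hom:
  "(\<lambda>p. (Idl\<^bsub>free_algebra\<^esub> R) +>\<^bsub>free_algebra\<^esub> p) \<in> algebra_homs free_algebra (presented_algebra R)"
  unfolding presented_algebra_def
  by (rule algebra_ideal.proj_hom[OF algebra_ideal_presented])

lemma free_algebra_induct [case_names one generator add mult smult]:
  assumes "P (Poly_Mapping.single [] 1)"
    and "\<And>x. P (free_generator x)"
    and "\<And>p q. P p \<Longrightarrow> P q \<Longrightarrow> P (p + q)"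
    and "\<And>p q. P p \<Longrightarrow> P q \<Longrightarrow> P (p \<otimes>\<^bsub>free_algebra\<^esub> q)"
    and "\<And>c p. P p \<Longrightarrow> P (Poly_Mapping.map ((*) c) p)"
  shows "P (p :: 'x list \<Rightarrow>\<^sub>0 'k::field)"
  using subset_UNIV[of "Poly_Mapping.keys p"]
proof (induction rule: poly_mapping_supported_induct)
  case zero
  then show ?case using assms(5)[OF assms(1), of 0] by simp
next
  case (single w c)
  have "P (Poly_Mapping.single w 1)"
  proof (induction w)
    case (Cons x w)
    then show ?case
      using assms(4)[OF assms(2)[of x] Cons]
      by (simp add: free_generator_def free_algebra_def monoid_algebra_mult_single)
  qed (rule assms(1))
  then show ?case using assms(5)[of "Poly_Mapping.single w 1" c] by simp
qed (rule assms(3))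

lemma presented_algebra_induct [consumes 1, case_names one generator add mult smult]:
  fixes R :: "('x list \<Rightarrow>\<^sub>0 'k::field) set"
  defines "A \<equiv> presented_algebra R"
  assumes "t \<in> carrier A"
    and "P \<one>\<^bsub>A\<^esub>"
    and "\<And>x. P (presented_generator R x)"
    and "\<And>s t. s \<in> carrier A \<Longrightarrow> t \<in> carrier A \<Longrightarrow> P s \<Longrightarrow> P t \<Longrightarrow> P (s \<oplus>\<^bsub>A\<^esub> t)"
    and "\<And>s t. s \<in> carrier A \<Longrightarrow> t \<in> carrier A \<Longrightarrow> P s \<Longrightarrow> P t \<Longrightarrow> P (s \<otimes>\<^bsub>A\<^esub> t)"
    and "\<And>c t. t \<in> carrier A \<Longrightarrow> P t \<Longrightarrow> P (c \<odot>\<^bsub>A\<^esub> t)"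
  shows "P t"
proof -
  note hom = algebra_homsD[OF proj_presented_hom[of R], folded A_def, unfolded free_algebra_simps]
  note lin = linear_mapsD[OF hom(1), unfolded free_algebra_simps]
  have "P ((Idl\<^bsub>free_algebra\<^esub> R) +>\<^bsub>free_algebra\<^esub> p)" for p
  proof (induction p rule: free_algebra_induct)
    case (generator x)
    show ?case using assms(4)[of x] by (simp add: presented_generator_def)
  qed (use assms(3,5-7) hom lin in auto)
  with assms(2) show ?thesis
    by (auto simp: A_def presented_algebra_def
        algebra_ideal.quotient_simps[OF algebra_ideal_presented])
qed

lemma presented_hom_ext:
  assumes "f \<in> algebra_homs (presented_algebra R) B" "g \<in> algebra_homs (presented_algebra R) B"
    and "\<And>x. f (presented_generator R x) = g (presented_generator R x)"
    and "t \<in> carrier (presented_algebra R)"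
  shows "f t = g t"
  using assms(4)
  by (induction rule: presented_algebra_induct)
    (auto simp: algebra_homsD[OF assms(1)] algebra_homsD[OF assms(2)] assms(3)
      linear_mapsD[OF algebra_homsD(1)[OF assms(1)]] linear_mapsD[OF algebra_homsD(1)[OF assms(2)]])


section \<open>Tensor products of algebras\<close>

lemma monoid_algebra_mult_diff:
  "(p - p') \<otimes>\<^bsub>monoid_algebra M\<^esub> q = p \<otimes>\<^bsub>monoid_algebra M\<^esub> q - p' \<otimes>\<^bsub>monoid_algebra M\<^esub> q"
  "q \<otimes>\<^bsub>monoid_algebra M\<^esub> (p - p') = q \<otimes>\<^bsub>monoid_algebra M\<^esub> p - q \<otimes>\<^bsub>monoid_algebra M\<^esub> p'"
  using monoid_algebra_mult_add_left[of M "p - p'" p' q]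
    monoid_algebra_mult_add_right[of M q "p - p'" p'] by (simp_all add: algebra_simps)

lemma scale_diff:
  "Poly_Mapping.map ((*) c) (p - q) = Poly_Mapping.map ((*) c) p - Poly_Mapping.map ((*) c) q" for c :: "'k::field"
  by (rule poly_mapping_eqI) (simp add: lookup_minus algebra_simps)

definition bilinear_map ::
  "('k::field, 'a, 's) module_scheme \<Rightarrow> ('k, 'b, 't) module_scheme \<Rightarrow>
   ('k, 'c, 'u) module_scheme \<Rightarrow> ('a \<times> 'b \<Rightarrow> 'c) \<Rightarrow> bool" where
  "bilinear_map A B V f \<longleftrightarrow>
     (\<forall>x\<in>carrier A. (\<lambda>y. f (x, y)) \<in> linear_maps B V) \<and>
     (\<forall>y\<in>carrier B. (\<lambda>x. f (x, y)) \<in> linear_maps A V)"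

lemma bilinear_mapI:
  assumes "\<And>x. x \<in> carrier A \<Longrightarrow> (\<lambda>y. f (x, y)) \<in> linear_maps B V"
    and "\<And>y. y \<in> carrier B \<Longrightarrow> (\<lambda>x. f (x, y)) \<in> linear_maps A V"
  shows "bilinear_map A B V f"
  using assms by (auto simp: bilinear_map_def)

lemma bilinear_mapD:
  assumes "bilinear_map A B V f"
  shows "x \<in> carrier A \<Longrightarrow> y \<in> carrier B \<Longrightarrow> f (x, y) \<in> carrier V"
    and "x \<in> carrier A \<Longrightarrow> x' \<in> carrier A \<Longrightarrow> y \<in> carrier B \<Longrightarrow>
      f (x \<oplus>\<^bsub>A\<^esub> x', y) = f (x, y) \<oplus>\<^bsub>V\<^esub> f (x', y)"
    and "x \<in> carrier A \<Longrightarrow> y \<in> carrier B \<Longrightarrow> y' \<in> carrier B \<Longrightarrow>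
      f (x, y \<oplus>\<^bsub>B\<^esub> y') = f (x, y) \<oplus>\<^bsub>V\<^esub> f (x, y')"
    and "x \<in> carrier A \<Longrightarrow> y \<in> carrier B \<Longrightarrow> f (c \<odot>\<^bsub>A\<^esub> x, y) = c \<odot>\<^bsub>V\<^esub> f (x, y)"
    and "x \<in> carrier A \<Longrightarrow> y \<in> carrier B \<Longrightarrow> f (x, c \<odot>\<^bsub>B\<^esub> y) = c \<odot>\<^bsub>V\<^esub> f (x, y)"
  using assms unfolding bilinear_map_def linear_maps_def by auto

locale tensor_product = A: assoc_algebra A + B: assoc_algebra B
  for A :: "('k::field, 'a, 's) module_scheme" and B :: "('k, 'b, 't) module_scheme"
begin

abbreviation M where "M \<equiv> A \<times>\<times> B"
abbreviation K :: "('k, 'a \<times> 'b \<Rightarrow>\<^sub>0 'k) module" where "K \<equiv> monoid_algebra (A \<times>\<times> B)"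
abbreviation T where "T \<equiv> tensor A B"
abbreviation pure where "pure \<equiv> pure_tensor A B"

lemma M_simps: "carrier M = carrier A \<times> carrier B" "\<one>\<^bsub>M\<^esub> = (\<one>\<^bsub>A\<^esub>, \<one>\<^bsub>B\<^esub>)"
  "(x, y) \<otimes>\<^bsub>M\<^esub> (x', y') = (x \<otimes>\<^bsub>A\<^esub> x', y \<otimes>\<^bsub>B\<^esub> y')"
  by (auto simp: DirProd_def)

interpretation S: Modules.module "\<lambda>c. Poly_Mapping.map ((*) (c::'k)) :: ('a \<times> 'b \<Rightarrow>\<^sub>0 'k) \<Rightarrow> _"
  by (rule module_scale)

lemma assoc_algebra_K: "assoc_algebra K"
  by (intro assoc_algebra_monoid_algebra DirProd_monoid A.A.is_monoid B.A.is_monoid)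

lemma relationsI:
  "x \<in> carrier A \<Longrightarrow> x' \<in> carrier A \<Longrightarrow> y \<in> carrier B \<Longrightarrow>
    Poly_Mapping.single (x \<oplus>\<^bsub>A\<^esub> x', y) 1 - Poly_Mapping.single (x, y) 1
      - Poly_Mapping.single (x', y) 1 \<in> bilinearity_relations A B"
  "x \<in> carrier A \<Longrightarrow> y \<in> carrier B \<Longrightarrow> y' \<in> carrier B \<Longrightarrow>
    Poly_Mapping.single (x, y \<oplus>\<^bsub>B\<^esub> y') 1 - Poly_Mapping.single (x, y) 1
      - Poly_Mapping.single (x, y') 1 \<in> bilinearity_relations A B"
  "x \<in> carrier A \<Longrightarrow> y \<in> carrier B \<Longrightarrow>
    Poly_Mapping.single (c \<odot>\<^bsub>A\<^esub> x, y) 1 - Poly_Mapping.single (x, y) c \<in> bilinearity_relations A B"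
  "x \<in> carrier A \<Longrightarrow> y \<in> carrier B \<Longrightarrow>
    Poly_Mapping.single (x, c \<odot>\<^bsub>B\<^esub> y) 1 - Poly_Mapping.single (x, y) c \<in> bilinearity_relations A B"
  unfolding bilinearity_relations_def Un_iff mem_Collect_eq by metis+

text \<open>Multiplication by a point mass turns a bilinearity relation into a multiple of a relation of the
  same kind, with the factors multiplied into its arguments. Therefore the span of the relations
  is an ideal, and the product of the monoid algebra descends to the tensor product.\<close>

lemma relation_mult:
  assumes "r \<in> bilinearity_relations A B" "u \<in> carrier A" "v \<in> carrier B"
  shows "(\<exists>r'\<in>bilinearity_relations A B. Poly_Mapping.single (u, v) c \<otimes>\<^bsub>K\<^esub> r = Poly_Mapping.map ((*) c) r') \<and>
    (\<exists>r'\<in>bilinearity_relations A B. r \<otimes>\<^bsub>K\<^esub> Poly_Mapping.single (u, v) c = Poly_Mapping.map ((*) c) r')"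
proof -
  note simps = monoid_algebra_mult_diff monoid_algebra_mult_single M_simps scale_diff mult.commute
    A.A.r_distr B.A.r_distr A.A.l_distr B.A.l_distr
    A.smult_mult_left A.smult_mult_right B.smult_mult_left B.smult_mult_right
  note uv = assms(2,3)
  show ?thesis
    using assms(1)[unfolded bilinearity_relations_def]
  proof (elim UnE CollectE exE conjE)
    fix x x' y assume r: "r = Poly_Mapping.single (x \<oplus>\<^bsub>A\<^esub> x', y) 1 - Poly_Mapping.single (x, y) 1
      - Poly_Mapping.single (x', y) 1" and xy: "x \<in> carrier A" "x' \<in> carrier A" "y \<in> carrier B"
    show ?thesis
      by (rule conjI, rule bexI[OF _ relationsI(1)[of "u \<otimes>\<^bsub>A\<^esub> x" "u \<otimes>\<^bsub>A\<^esub> x'" "v \<otimes>\<^bsub>B\<^esub> y"]],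
        simp_all add: r uv xy simps)
       (rule bexI[OF _ relationsI(1)[of "x \<otimes>\<^bsub>A\<^esub> u" "x' \<otimes>\<^bsub>A\<^esub> u" "y \<otimes>\<^bsub>B\<^esub> v"]], simp_all add: r uv xy simps)
  next
    fix x y y' assume r: "r = Poly_Mapping.single (x, y \<oplus>\<^bsub>B\<^esub> y') 1 - Poly_Mapping.single (x, y) 1
      - Poly_Mapping.single (x, y') 1" and xy: "x \<in> carrier A" "y \<in> carrier B" "y' \<in> carrier B"
    show ?thesis
      by (rule conjI, rule bexI[OF _ relationsI(2)[of "u \<otimes>\<^bsub>A\<^esub> x" "v \<otimes>\<^bsub>B\<^esub> y" "v \<otimes>\<^bsub>B\<^esub> y'"]],
        simp_all add: r uv xy simps)
       (rule bexI[OF _ relationsI(2)[of "x \<otimes>\<^bsub>A\<^esub> u" "y \<otimes>\<^bsub>B\<^esub> v" "y' \<otimes>\<^bsub>B\<^esub> v"]], simp_all add: r uv xy simps)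
  next
    fix d x y assume r: "r = Poly_Mapping.single (d \<odot>\<^bsub>A\<^esub> x, y) 1 - Poly_Mapping.single (x, y) d"
      and xy: "x \<in> carrier A" "y \<in> carrier B"
    show ?thesis
      by (rule conjI, rule bexI[OF _ relationsI(3)[of "u \<otimes>\<^bsub>A\<^esub> x" "v \<otimes>\<^bsub>B\<^esub> y" d]],
        simp_all add: r uv xy simps)
       (rule bexI[OF _ relationsI(3)[of "x \<otimes>\<^bsub>A\<^esub> u" "y \<otimes>\<^bsub>B\<^esub> v" d]], simp_all add: r uv xy simps)
  next
    fix d x y assume r: "r = Poly_Mapping.single (x, d \<odot>\<^bsub>B\<^esub> y) 1 - Poly_Mapping.single (x, y) d"
      and xy: "x \<in> carrier A" "y \<in> carrier B"
    show ?thesis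
      by (rule conjI, rule bexI[OF _ relationsI(4)[of "u \<otimes>\<^bsub>A\<^esub> x" "v \<otimes>\<^bsub>B\<^esub> y" d]],
        simp_all add: r uv xy simps)
       (rule bexI[OF _ relationsI(4)[of "x \<otimes>\<^bsub>A\<^esub> u" "y \<otimes>\<^bsub>B\<^esub> v" d]], simp_all add: r uv xy simps)
  qed
qed

lemma relation_supported:
  "r \<in> bilinearity_relations A B \<Longrightarrow> Poly_Mapping.keys r \<subseteq> carrier A \<times> carrier B"
  unfolding bilinearity_relations_def
  by (auto simp: in_keys_iff lookup_minus lookup_single when_def split: if_splits)

lemma span_supported:
  "r \<in> bilinearity_span A B \<Longrightarrow> Poly_Mapping.keys r \<subseteq> carrier A \<times> carrier B"
  unfolding bilinearity_span_def
proof (induction rule: S.span_induct_alt)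
  case (step c x y)
  then show ?case
    using relation_supported[of x] keys_scale[of c x] keys_add[of "Poly_Mapping.map ((*) c) x" y] by blast
qed simp

lemma span_mult_single:
  assumes "r \<in> bilinearity_span A B" "u \<in> carrier A" "v \<in> carrier B"
  shows "Poly_Mapping.single (u, v) c \<otimes>\<^bsub>K\<^esub> r \<in> bilinearity_span A B"
    and "r \<otimes>\<^bsub>K\<^esub> Poly_Mapping.single (u, v) c \<in> bilinearity_span A B"
proof -
  from assms(1) have "Poly_Mapping.single (u, v) c \<otimes>\<^bsub>K\<^esub> r \<in> bilinearity_span A B \<and>
    r \<otimes>\<^bsub>K\<^esub> Poly_Mapping.single (u, v) c \<in> bilinearity_span A B"
    unfolding bilinearity_span_def
  proof (induction rule: S.span_induct_alt)
    case base
    then show ?case by (simp add: monoid_algebra_mult_zero S.span_zero)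
  next
    case (step d r s)
    from relation_mult[OF step(1) assms(2,3), of c] show ?case
      using step(2)
      by (auto simp: monoid_algebra_mult_simps intro!: S.span_add S.span_scale intro: S.span_base)
  qed
  then show "Poly_Mapping.single (u, v) c \<otimes>\<^bsub>K\<^esub> r \<in> bilinearity_span A B"
    "r \<otimes>\<^bsub>K\<^esub> Poly_Mapping.single (u, v) c \<in> bilinearity_span A B" by auto
qed

lemma span_mult:
  assumes r: "r \<in> bilinearity_span A B" and p: "Poly_Mapping.keys p \<subseteq> carrier A \<times> carrier B"
  shows "p \<otimes>\<^bsub>K\<^esub> r \<in> bilinearity_span A B" "r \<otimes>\<^bsub>K\<^esub> p \<in> bilinearity_span A B"
proof -
  from p have "p \<otimes>\<^bsub>K\<^esub> r \<in> bilinearity_span A B \<and> r \<otimes>\<^bsub>K\<^esub> p \<in> bilinearity_span A B"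
  proof (induction rule: poly_mapping_supported_induct)
    case (single x c)
    then show ?case using span_mult_single[OF r, of "fst x" "snd x" c] by auto
  qed (auto simp: monoid_algebra_mult_simps bilinearity_span_def S.span_zero S.span_add)
  then show "p \<otimes>\<^bsub>K\<^esub> r \<in> bilinearity_span A B" "r \<otimes>\<^bsub>K\<^esub> p \<in> bilinearity_span A B" by auto
qed

sublocale I: algebra_ideal K "bilinearity_span A B"
proof (intro algebra_ideal.intro assoc_algebra_K)
  interpret K: assoc_algebra K by (rule assoc_algebra_K)
  have neg: "\<ominus>\<^bsub>K\<^esub> r \<in> bilinearity_span A B" if "r \<in> bilinearity_span A B" for r
    using that span_supported[OF that]
    by (simp add: K.uminus_smult monoid_algebra_simps M_simps bilinearity_span_def S.span_scale S.span_neg)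
  show "ideal (bilinearity_span A B) K"
  proof (rule idealI)
    show "subgroup (bilinearity_span A B) (add_monoid K)"
      using neg
      by (intro subgroup.intro)
        (auto simp: monoid_algebra_simps M_simps bilinearity_span_def S.span_zero S.span_add
          a_inv_def dest: span_supported[unfolded bilinearity_span_def, THEN subsetD])
  qed (auto simp: K.A.ring_axioms span_mult monoid_algebra_simps M_simps)
qed

lemma tensor_assoc_algebra: "assoc_algebra T"
  unfolding tensor_def by (rule I.quotient_assoc_algebra)

lemma pure_closed: "x \<in> carrier A \<Longrightarrow> y \<in> carrier B \<Longrightarrow> pure x y \<in> carrier T"
  unfolding tensor_def pure_tensor_def by (auto simp: I.quotient_simps monoid_algebra_simps M_simps)

lemma pure_mult:
  "x \<in> carrier A \<Longrightarrow> y \<in> carrier B \<Longrightarrow> x' \<in> carrier A \<Longrightarrow> y' \<in> carrier B \<Longrightarrow>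
    pure x y \<otimes>\<^bsub>T\<^esub> pure x' y' = pure (x \<otimes>\<^bsub>A\<^esub> x') (y \<otimes>\<^bsub>B\<^esub> y')"
  unfolding tensor_def pure_tensor_def
  by (subst I.quotient_simps) (auto simp: monoid_algebra_simps M_simps monoid_algebra_mult_simps)

lemma pure_one: "\<one>\<^bsub>T\<^esub> = pure \<one>\<^bsub>A\<^esub> \<one>\<^bsub>B\<^esub>"
  unfolding tensor_def pure_tensor_def by (simp add: I.quotient_simps monoid_algebra_simps M_simps)

lemma proj_eqI:
  assumes "p \<in> carrier K" "q \<in> carrier K" "p - q \<in> bilinearity_span A B"
  shows "bilinearity_span A B +>\<^bsub>K\<^esub> p = bilinearity_span A B +>\<^bsub>K\<^esub> q"
proof -
  have "p \<ominus>\<^bsub>K\<^esub> q = p - q"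
    using assms(2) by (simp add: scale_minus_one a_minus_def I.uminus_smult monoid_algebra_simps)
  with assms show ?thesis by (simp add: I.proj_eq_iff)
qed

lemma pure_bilinear: "bilinear_map A B T (\<lambda>(x, y). pure x y)"
proof -
  have base: "r \<in> bilinearity_relations A B \<Longrightarrow> r \<in> bilinearity_span A B" for r
    unfolding bilinearity_span_def by (rule S.span_base)
  have keys: "Poly_Mapping.keys (Poly_Mapping.single (x, y) c + Poly_Mapping.single (x', y') d)
      \<subseteq> carrier A \<times> carrier B"
    if "x \<in> carrier A" "x' \<in> carrier A" "y \<in> carrier B" "y' \<in> carrier B" for x x' y y' and c d :: 'k
    using that keys_add[of "Poly_Mapping.single (x, y) c" "Poly_Mapping.single (x', y') d"]
    by (auto split: if_splits)
  note simps = tensor_def pure_tensor_def I.quotient_simps monoid_algebra_simps M_simps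
  have add1: "pure (x \<oplus>\<^bsub>A\<^esub> x') y = pure x y \<oplus>\<^bsub>T\<^esub> pure x' y"
    if "x \<in> carrier A" "x' \<in> carrier A" "y \<in> carrier B" for x x' y
    using that keys[of x x' y y 1 1]
    by (simp add: simps, intro proj_eqI base)
      (auto simp: monoid_algebra_simps M_simps diff_diff_eq[symmetric] relationsI)
  have add2: "pure x (y \<oplus>\<^bsub>B\<^esub> y') = pure x y \<oplus>\<^bsub>T\<^esub> pure x y'"
    if "x \<in> carrier A" "y \<in> carrier B" "y' \<in> carrier B" for x y y'
    using that keys[of x x y y' 1 1]
    by (simp add: simps, intro proj_eqI base)
      (auto simp: monoid_algebra_simps M_simps diff_diff_eq[symmetric] relationsI)
  have smult1: "pure (c \<odot>\<^bsub>A\<^esub> x) y = c \<odot>\<^bsub>T\<^esub> pure x y" if "x \<in> carrier A" "y \<in> carrier B" for c x y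
    using that
    by (simp add: simps, intro proj_eqI base)
      (auto simp: monoid_algebra_simps M_simps relationsI)
  have smult2: "pure x (c \<odot>\<^bsub>B\<^esub> y) = c \<odot>\<^bsub>T\<^esub> pure x y" if "x \<in> carrier A" "y \<in> carrier B" for c x y
    using that
    by (simp add: simps, intro proj_eqI base)
      (auto simp: monoid_algebra_simps M_simps relationsI)
  show ?thesis
    by (intro bilinear_mapI linear_mapsI) (auto simp: add1 add2 smult1 smult2 pure_closed)
qed

lemmas pure_add_left = bilinear_mapD(2)[OF pure_bilinear, simplified]
  and pure_add_right = bilinear_mapD(3)[OF pure_bilinear, simplified]
  and pure_smult_left = bilinear_mapD(4)[OF pure_bilinear, simplified]
  and pure_smult_right = bilinear_mapD(5)[OF pure_bilinear, simplified]

lemma pure_linear_left: "y \<in> carrier B \<Longrightarrow> (\<lambda>x. pure x y) \<in> linear_maps A T"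
  by (intro linear_mapsI) (auto simp: pure_closed pure_add_left pure_smult_left)

lemma pure_linear_right: "x \<in> carrier A \<Longrightarrow> (\<lambda>y. pure x y) \<in> linear_maps B T"
  by (intro linear_mapsI) (auto simp: pure_closed pure_add_right pure_smult_right)

text \<open>There is no case for scalar multiples, nor for zero: a scalar can be moved into the left factor of
  a pure tensor.\<close>

lemma tensor_induct [consumes 1, case_names pure add]:
  assumes "t \<in> carrier T"
    and "\<And>x y. x \<in> carrier A \<Longrightarrow> y \<in> carrier B \<Longrightarrow> P (pure x y)"
    and "\<And>s t. s \<in> carrier T \<Longrightarrow> t \<in> carrier T \<Longrightarrow> P s \<Longrightarrow> P t \<Longrightarrow> P (s \<oplus>\<^bsub>T\<^esub> t)"
  shows "P t"
proof -
  interpret T: assoc_algebra T by (rule tensor_assoc_algebra)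
  have T: "T = I.Q" by (simp add: tensor_def)
  from assms(1) obtain p where p: "p \<in> carrier K" and t: "t = I.proj p"
    unfolding T I.quotient_simps by auto
  have proj_single: "I.proj (Poly_Mapping.single (x, y) c) = pure (c \<odot>\<^bsub>A\<^esub> x) y"
    if "x \<in> carrier A" "y \<in> carrier B" for x y c
    using that by (simp add: pure_smult_left)
      (simp add: T pure_tensor_def I.quotient_simps monoid_algebra_simps M_simps)
  from p have "Poly_Mapping.keys p \<subseteq> carrier A \<times> carrier B"
    by (simp add: monoid_algebra_simps M_simps)
  then have "P (I.proj p)"
  proof (induction rule: poly_mapping_supported_induct)
    case zero
    have "I.proj 0 = pure (0 \<odot>\<^bsub>A\<^esub> \<one>\<^bsub>A\<^esub>) \<one>\<^bsub>B\<^esub>"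
      using proj_single[of "\<one>\<^bsub>A\<^esub>" "\<one>\<^bsub>B\<^esub>" 0] by simp
    then show ?case using assms(2) by auto
  next
    case (single z c)
    then show ?case using proj_single[of "fst z" "snd z" c] assms(2) by auto
  next
    case (add p q)
    then have "p \<in> carrier K" "q \<in> carrier K"
      by (simp_all add: monoid_algebra_simps M_simps)
    then show ?case
      using add assms(3)[of "I.proj p" "I.proj q"] by (simp add: T I.quotient_simps monoid_algebra_simps)
  qed
  with t show ?thesis by simp
qed

lemma tensor_linear_ext:
  assumes "f \<in> linear_maps T V" "g \<in> linear_maps T V"
    and "\<And>x y. x \<in> carrier A \<Longrightarrow> y \<in> carrier B \<Longrightarrow> f (pure x y) = g (pure x y)"
    and "t \<in> carrier T"
  shows "f t = g t"
  using assms(4)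
  by (induction rule: tensor_induct)
    (auto simp: assms(3) linear_mapsD[OF assms(1)] linear_mapsD[OF assms(2)])

lemma
  assumes V: "assoc_algebra V" and f: "bilinear_map A B V f"
  shows tensor_lift_linear: "tensor_lift V f \<in> linear_maps T V"
    and tensor_lift_pure: "x \<in> carrier A \<Longrightarrow> y \<in> carrier B \<Longrightarrow> tensor_lift V f (pure x y) = f (x, y)"
proof -
  interpret V: assoc_algebra V by fact
  note bil = bilinear_mapD[OF f]
  have f_carrier: "f z \<in> carrier V" if "z \<in> carrier A \<times> carrier B" for z
    using bil(1)[of "fst z" "snd z"] that by auto
  let ?h = "linear_extension V f"
  have h: "?h \<in> linear_maps K V"
    by (intro linear_mapsI)
      (auto simp: monoid_algebra_simps M_simps intro!: V.linear_extension_closed V.linear_extension_add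
        V.linear_extension_scale f_carrier)
  have single: "?h (Poly_Mapping.single (x, y) c) = c \<odot>\<^bsub>V\<^esub> f (x, y)"
    if "x \<in> carrier A" "y \<in> carrier B" for x y c
    using that by (intro V.linear_extension_single bil(1))
  have diff: "?h (p - q) = ?h p \<ominus>\<^bsub>V\<^esub> ?h q"
    if "Poly_Mapping.keys p \<subseteq> carrier A \<times> carrier B" "Poly_Mapping.keys q \<subseteq> carrier A \<times> carrier B" for p q
  proof -
    have "p - q = p \<ominus>\<^bsub>K\<^esub> q"
      using that by (simp add: scale_minus_one a_minus_def I.uminus_smult monoid_algebra_simps M_simps)
    with that show ?thesis
      using linear_map_minus[OF assoc_algebra_K V h, of p q] by (simp add: monoid_algebra_simps M_simps)
  qed
  have cancel: "(a \<oplus>\<^bsub>V\<^esub> b) \<ominus>\<^bsub>V\<^esub> a \<ominus>\<^bsub>V\<^esub> b = \<zero>\<^bsub>V\<^esub>" if "a \<in> carrier V" "b \<in> carrier V" for a b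
    using that by (simp add: a_minus_def V.A.a_comm[of a b] V.A.a_assoc V.A.r_neg)
  have rel: "?h r = \<zero>\<^bsub>V\<^esub>" if "r \<in> bilinearity_relations A B" for r
  proof -
    have keys: "Poly_Mapping.keys (Poly_Mapping.single (x, y) c - Poly_Mapping.single (x', y') d)
        \<subseteq> carrier A \<times> carrier B"
      if "x \<in> carrier A" "x' \<in> carrier A" "y \<in> carrier B" "y' \<in> carrier B" for x x' y y' and c d :: 'k
      using that by (auto simp: in_keys_iff lookup_minus lookup_single when_def split: if_splits)
    show ?thesis
      using that bil unfolding bilinearity_relations_def
      by (auto simp: diff single keys cancel)
  qed
  have kernel: "?h r = \<zero>\<^bsub>V\<^esub>" if "r \<in> bilinearity_span A B" for r
  proof -
    from that have "?h r = \<zero>\<^bsub>V\<^esub> \<and> Poly_Mapping.keys r \<subseteq> carrier A \<times> carrier B"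
      unfolding bilinearity_span_def
    proof (induction rule: S.span_induct_alt)
      case (step c r s)
      have "Poly_Mapping.keys r \<subseteq> carrier A \<times> carrier B"
        using step(1) by (rule relation_supported)
      moreover from this have "Poly_Mapping.keys (Poly_Mapping.map ((*) c) r) \<subseteq> carrier A \<times> carrier B"
        using keys_scale[of c r] by blast
      ultimately show ?case
        using step rel[OF step(1)] linear_mapsD[OF h]
          keys_add[of "Poly_Mapping.map ((*) c) r" s]
        by (auto simp: monoid_algebra_simps M_simps)
    qed simp
    then show ?thesis by simp
  qed
  have lift: "tensor_lift V f = (\<lambda>K. the_elem (linear_extension V f ` K))"
    by (simp add: tensor_lift_def fun_eq_iff)
  show "tensor_lift V f \<in> linear_maps T V"
    unfolding lift tensor_def by (rule I.induced_linear_map[OF V h kernel])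
  show "tensor_lift V f (pure x y) = f (x, y)" if "x \<in> carrier A" "y \<in> carrier B"
    unfolding lift pure_tensor_def
    using that single[of x y 1] bil(1)
    by (subst I.the_elem_proj[OF V h kernel]) (auto simp: monoid_algebra_simps M_simps)
qed

text \<open>Multiplicativity on a tensor product is inherited from pure tensors, as both sides are
  bilinear.\<close>

lemma tensor_homI:
  assumes V: "assoc_algebra V" and h: "h \<in> linear_maps T V"
    and one: "h (pure \<one>\<^bsub>A\<^esub> \<one>\<^bsub>B\<^esub>) = \<one>\<^bsub>V\<^esub>"
    and mult: "\<And>x y x' y'. x \<in> carrier A \<Longrightarrow> x' \<in> carrier A \<Longrightarrow> y \<in> carrier B \<Longrightarrow> y' \<in> carrier B \<Longrightarrow>
      h (pure (x \<otimes>\<^bsub>A\<^esub> x') (y \<otimes>\<^bsub>B\<^esub> y')) = h (pure x y) \<otimes>\<^bsub>V\<^esub> h (pure x' y')"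
  shows "h \<in> algebra_homs T V"
proof (rule algebra_homsI[OF h])
  interpret T: assoc_algebra T by (rule tensor_assoc_algebra)
  interpret V: assoc_algebra V by fact
  note lin = linear_mapsD[OF h]
  fix s t assume "s \<in> carrier T" "t \<in> carrier T"
  from this(1) show "h (s \<otimes>\<^bsub>T\<^esub> t) = h s \<otimes>\<^bsub>V\<^esub> h t"
  proof (induction rule: tensor_induct)
    case s: (pure x y)
    from \<open>t \<in> carrier T\<close> show ?case
    proof (induction rule: tensor_induct)
      case (pure x' y')
      with s show ?case by (simp add: pure_mult mult)
    next
      case (add t t')
      with s show ?case by (simp add: lin T.A.r_distr V.A.r_distr pure_closed)
    qed
  next
    case (add s s')
    with \<open>t \<in> carrier T\<close> show ?case by (simp add: lin T.A.l_distr V.A.l_distr)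
  qed
qed (simp add: one pure_one)

end

lemma tensor_productI: "assoc_algebra A \<Longrightarrow> assoc_algebra B \<Longrightarrow> tensor_product A B"
  by (intro tensor_product.intro)


text \<open>The associativity maps are given by a lift inside a lift; this is the linearity of the inner
  one in the parameter that it inherits from the outer one.\<close>

lemma (in tensor_product) tensor_lift_linear_parameter:
  assumes "assoc_algebra V" "assoc_algebra C"
    and "\<And>z. z \<in> carrier C \<Longrightarrow> bilinear_map A B V (f z)"
    and "\<And>x y. x \<in> carrier A \<Longrightarrow> y \<in> carrier B \<Longrightarrow> (\<lambda>z. f z (x, y)) \<in> linear_maps C V"
    and "t \<in> carrier T"
  shows "(\<lambda>z. tensor_lift V (f z) t) \<in> linear_maps C V"
  using assms(5)
proof (induction rule: tensor_induct)
  case (pure x y)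
  with assms(4) show ?case
    by (subst linear_maps_cong[OF assms(2), of _ "\<lambda>z. f z (x, y)"])
      (auto simp: tensor_lift_pure[OF assms(1,3)])
next
  case (add s t)
  then show ?case
    by (subst linear_maps_cong[OF assms(2), of _ "\<lambda>z. tensor_lift V (f z) s \<oplus>\<^bsub>V\<^esub> tensor_lift V (f z) t"])
      (auto simp: linear_mapsD[OF tensor_lift_linear[OF assms(1,3)]] intro: linear_maps_add[OF assms(1)])
qed

context
  fixes A :: "('k::field, 'a, 's) module_scheme" and B :: "('k, 'b, 't) module_scheme"
    and C :: "('k, 'c, 'u) module_scheme" and D :: "('k, 'd, 'v) module_scheme"
  assumes A: "assoc_algebra A" and B: "assoc_algebra B"
begin

interpretation AB: tensor_product A B by (rule tensor_productI[OF A B])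

lemma tensor_is_algebra: "assoc_algebra (tensor A B)"
  by (rule AB.tensor_assoc_algebra)

context
  assumes C: "assoc_algebra C" and D: "assoc_algebra D"
begin

interpretation CD: tensor_product C D by (rule tensor_productI[OF C D])

lemma pure_tensor_map_bilinear:
  assumes "f \<in> linear_maps A C" "g \<in> linear_maps B D"
  shows "bilinear_map A B (tensor C D) (\<lambda>(x, y). pure_tensor C D (f x) (g y))"
  by (intro bilinear_mapI linear_mapsI)
    (auto simp: linear_mapsD[OF assms(1)] linear_mapsD[OF assms(2)] CD.pure_closed CD.pure_add_left
      CD.pure_add_right CD.pure_smult_left CD.pure_smult_right)

lemma tensor_map_linear:
  assumes "f \<in> linear_maps A C" "g \<in> linear_maps B D"
  shows "tensor_map C D f g \<in> linear_maps (tensor A B) (tensor C D)"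
  unfolding tensor_map_def
  by (rule AB.tensor_lift_linear[OF CD.tensor_assoc_algebra pure_tensor_map_bilinear[OF assms]])

lemma tensor_map_pure:
  assumes "f \<in> linear_maps A C" "g \<in> linear_maps B D" "x \<in> carrier A" "y \<in> carrier B"
  shows "tensor_map C D f g (pure_tensor A B x y) = pure_tensor C D (f x) (g y)"
  unfolding tensor_map_def
  using AB.tensor_lift_pure[OF CD.tensor_assoc_algebra pure_tensor_map_bilinear[OF assms(1,2)] assms(3,4)]
  by simp

lemma tensor_map_hom:
  assumes "f \<in> algebra_homs A C" "g \<in> algebra_homs B D"
  shows "tensor_map C D f g \<in> algebra_homs (tensor A B) (tensor C D)"
  using tensor_map_linear[OF algebra_homsD(1)[OF assms(1)] algebra_homsD(1)[OF assms(2)]]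
  by (intro AB.tensor_homI CD.tensor_assoc_algebra)
    (auto simp: tensor_map_pure algebra_homsD[OF assms(1)] algebra_homsD[OF assms(2)]
      CD.pure_mult CD.pure_one)

end

context
  assumes C: "assoc_algebra C"
begin

interpretation BC: tensor_product B C by (rule tensor_productI[OF B C])
interpretation AB_C: tensor_product "tensor A B" C
  by (rule tensor_productI[OF AB.tensor_assoc_algebra C])
interpretation A_BC: tensor_product A "tensor B C"
  by (rule tensor_productI[OF A BC.tensor_assoc_algebra])

lemma
  shows tensor_assoc_linear:
      "tensor_assoc A B C \<in> linear_maps (tensor (tensor A B) C) (tensor A (tensor B C))"
    and tensor_assoc_pure: "x \<in> carrier A \<Longrightarrow> y \<in> carrier B \<Longrightarrow> z \<in> carrier C \<Longrightarrow>
      tensor_assoc A B C (pure_tensor (tensor A B) C (pure_tensor A B x y) z)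
        = pure_tensor A (tensor B C) x (pure_tensor B C y z)"
proof -
  let ?f = "\<lambda>z (x, y). pure_tensor A (tensor B C) x (pure_tensor B C y z)"
  have bil: "bilinear_map A B (tensor A (tensor B C)) (?f z)" if "z \<in> carrier C" for z
    using that by (intro bilinear_mapI linear_mapsI)
      (auto simp: A_BC.pure_closed BC.pure_closed A_BC.pure_add_left A_BC.pure_add_right
        BC.pure_add_left A_BC.pure_smult_left A_BC.pure_smult_right BC.pure_smult_left)
  have "bilinear_map (tensor A B) C (tensor A (tensor B C))
      (\<lambda>(t, z). tensor_lift (tensor A (tensor B C)) (?f z) t)"
  proof (rule bilinear_mapI)
    fix t assume t: "t \<in> carrier (tensor A B)"
    have "(\<lambda>z. ?f z (x, y)) \<in> linear_maps C (tensor A (tensor B C))"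
      if "x \<in> carrier A" "y \<in> carrier B" for x y
      using that by (intro linear_mapsI)
        (auto simp: A_BC.pure_closed BC.pure_closed A_BC.pure_add_right BC.pure_add_right
          A_BC.pure_smult_right BC.pure_smult_right)
    with AB.tensor_lift_linear_parameter[OF A_BC.tensor_assoc_algebra C bil _ t]
    show "(\<lambda>z. case (t, z) of (t, z) \<Rightarrow> tensor_lift (tensor A (tensor B C)) (?f z) t)
        \<in> linear_maps C (tensor A (tensor B C))" by simp
  next
    fix z assume "z \<in> carrier C"
    with AB.tensor_lift_linear[OF A_BC.tensor_assoc_algebra bil]
    show "(\<lambda>t. case (t, z) of (t, z) \<Rightarrow> tensor_lift (tensor A (tensor B C)) (?f z) t)
        \<in> linear_maps (tensor A B) (tensor A (tensor B C))" by simp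
  qed
  note * = this
  show "tensor_assoc A B C \<in> linear_maps (tensor (tensor A B) C) (tensor A (tensor B C))"
    unfolding tensor_assoc_def by (rule AB_C.tensor_lift_linear[OF A_BC.tensor_assoc_algebra *])
  show "tensor_assoc A B C (pure_tensor (tensor A B) C (pure_tensor A B x y) z)
        = pure_tensor A (tensor B C) x (pure_tensor B C y z)"
    if "x \<in> carrier A" "y \<in> carrier B" "z \<in> carrier C"
    unfolding tensor_assoc_def using that
    by (simp add: AB_C.tensor_lift_pure[OF A_BC.tensor_assoc_algebra *] AB.pure_closed
        AB.tensor_lift_pure[OF A_BC.tensor_assoc_algebra bil])
qed

lemma
  shows tensor_assoc_inv_linear:
      "tensor_assoc_inv A B C \<in> linear_maps (tensor A (tensor B C)) (tensor (tensor A B) C)"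
    and tensor_assoc_inv_pure: "x \<in> carrier A \<Longrightarrow> y \<in> carrier B \<Longrightarrow> z \<in> carrier C \<Longrightarrow>
      tensor_assoc_inv A B C (pure_tensor A (tensor B C) x (pure_tensor B C y z))
        = pure_tensor (tensor A B) C (pure_tensor A B x y) z"
proof -
  let ?f = "\<lambda>x (y, z). pure_tensor (tensor A B) C (pure_tensor A B x y) z"
  have bil: "bilinear_map B C (tensor (tensor A B) C) (?f x)" if "x \<in> carrier A" for x
    using that by (intro bilinear_mapI linear_mapsI)
      (auto simp: AB_C.pure_closed AB.pure_closed AB_C.pure_add_left AB_C.pure_add_right
        AB.pure_add_right AB_C.pure_smult_left AB_C.pure_smult_right AB.pure_smult_right)
  have "bilinear_map A (tensor B C) (tensor (tensor A B) C)
      (\<lambda>(x, t). tensor_lift (tensor (tensor A B) C) (?f x) t)"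
  proof (rule bilinear_mapI)
    fix t assume t: "t \<in> carrier (tensor B C)"
    have "(\<lambda>x. ?f x (y, z)) \<in> linear_maps A (tensor (tensor A B) C)"
      if "y \<in> carrier B" "z \<in> carrier C" for y z
      using that by (intro linear_mapsI)
        (auto simp: AB_C.pure_closed AB.pure_closed AB_C.pure_add_left AB.pure_add_left
          AB_C.pure_smult_left AB.pure_smult_left)
    with BC.tensor_lift_linear_parameter[OF AB_C.tensor_assoc_algebra A bil _ t]
    show "(\<lambda>x. case (x, t) of (x, t) \<Rightarrow> tensor_lift (tensor (tensor A B) C) (?f x) t)
        \<in> linear_maps A (tensor (tensor A B) C)" by simp
  next
    fix x assume "x \<in> carrier A"
    with BC.tensor_lift_linear[OF AB_C.tensor_assoc_algebra bil]
    show "(\<lambda>t. case (x, t) of (x, t) \<Rightarrow> tensor_lift (tensor (tensor A B) C) (?f x) t)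
        \<in> linear_maps (tensor B C) (tensor (tensor A B) C)" by simp
  qed
  note * = this
  show "tensor_assoc_inv A B C \<in> linear_maps (tensor A (tensor B C)) (tensor (tensor A B) C)"
    unfolding tensor_assoc_inv_def by (rule A_BC.tensor_lift_linear[OF AB_C.tensor_assoc_algebra *])
  show "tensor_assoc_inv A B C (pure_tensor A (tensor B C) x (pure_tensor B C y z))
        = pure_tensor (tensor A B) C (pure_tensor A B x y) z"
    if "x \<in> carrier A" "y \<in> carrier B" "z \<in> carrier C"
    unfolding tensor_assoc_inv_def using that
    by (simp add: A_BC.tensor_lift_pure[OF AB_C.tensor_assoc_algebra *] BC.pure_closed
        BC.tensor_lift_pure[OF AB_C.tensor_assoc_algebra bil])
qed

text \<open>Multiplicativity has to be checked on tensors \<open>s \<otimes> z\<close> with \<open>s\<close> in \<open>A \<otimes> B\<close>, which are not yet triple pure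
  tensors; two more inductions, over both left factors, reduce to these.\<close>

lemma tensor_assoc_hom:
  "tensor_assoc A B C \<in> algebra_homs (tensor (tensor A B) C) (tensor A (tensor B C))"
proof (rule algebra_homsI[OF tensor_assoc_linear])
  interpret T1: assoc_algebra "tensor (tensor A B) C" by (rule AB_C.tensor_assoc_algebra)
  interpret T2: assoc_algebra "tensor A (tensor B C)" by (rule A_BC.tensor_assoc_algebra)
  interpret T3: assoc_algebra "tensor A B" by (rule AB.tensor_assoc_algebra)
  note lin = linear_mapsD[OF tensor_assoc_linear]
  let ?h = "tensor_assoc A B C"
  have mult: "?h (pure_tensor (tensor A B) C s z \<otimes>\<^bsub>tensor (tensor A B) C\<^esub> pure_tensor (tensor A B) C t z')
      = ?h (pure_tensor (tensor A B) C s z) \<otimes>\<^bsub>tensor A (tensor B C)\<^esub> ?h (pure_tensor (tensor A B) C t z')"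
    if "s \<in> carrier (tensor A B)" "t \<in> carrier (tensor A B)" "z \<in> carrier C" "z' \<in> carrier C" for s t z z'
    using that(1)
  proof (induction rule: AB.tensor_induct)
    case xy: (pure x y)
    from that(2) show ?case
    proof (induction rule: AB.tensor_induct)
      case (pure x' y')
      with xy that(3,4) show ?case
        by (simp add: AB_C.pure_mult AB.pure_mult tensor_assoc_pure A_BC.pure_mult BC.pure_mult
            AB.pure_closed BC.pure_closed)
    next
      case (add t t')
      with xy that(3,4) show ?case
        by (simp add: AB_C.pure_add_left AB_C.pure_closed AB.pure_closed lin T1.A.r_distr T2.A.r_distr)
    qed
  next
    case (add s s')
    with that show ?case
      by (simp add: AB_C.pure_add_left AB_C.pure_closed lin T1.A.l_distr T2.A.l_distr)
  qed
  have one: "?h (pure_tensor (tensor A B) C \<one>\<^bsub>tensor A B\<^esub> \<one>\<^bsub>C\<^esub>) = \<one>\<^bsub>tensor A (tensor B C)\<^esub>"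
    by (simp add: AB.pure_one A_BC.pure_one BC.pure_one tensor_assoc_pure)
  have "?h \<in> algebra_homs (tensor (tensor A B) C) (tensor A (tensor B C))"
    by (rule AB_C.tensor_homI[OF A_BC.tensor_assoc_algebra tensor_assoc_linear one])
      (simp add: mult[symmetric] AB_C.pure_mult)
  then show "?h (s \<otimes>\<^bsub>tensor (tensor A B) C\<^esub> t) = ?h s \<otimes>\<^bsub>tensor A (tensor B C)\<^esub> ?h t"
    if "s \<in> carrier (tensor (tensor A B) C)" "t \<in> carrier (tensor (tensor A B) C)" for s t
    using that by (simp add: algebra_homsD)
  show "?h \<one>\<^bsub>tensor (tensor A B) C\<^esub> = \<one>\<^bsub>tensor A (tensor B C)\<^esub>"
    by (simp add: AB_C.pure_one one)
qed

end

lemma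
  assumes "\<epsilon> \<in> algebra_homs A field_algebra"
  shows counit_lift_left_hom: "tensor_lift B (\<lambda>(x, y). \<epsilon> x \<odot>\<^bsub>B\<^esub> y) \<in> algebra_homs (tensor A B) B"
    and counit_lift_left_pure: "x \<in> carrier A \<Longrightarrow> y \<in> carrier B \<Longrightarrow>
      tensor_lift B (\<lambda>(x, y). \<epsilon> x \<odot>\<^bsub>B\<^esub> y) (pure_tensor A B x y) = \<epsilon> x \<odot>\<^bsub>B\<^esub> y"
proof -
  note \<epsilon> = algebra_homsD[OF assms, simplified] linear_mapsD[OF algebra_homsD(1)[OF assms], simplified]
  have bil: "bilinear_map A B B (\<lambda>(x, y). \<epsilon> x \<odot>\<^bsub>B\<^esub> y)"
    by (intro bilinear_mapI linear_mapsI)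
      (auto simp: \<epsilon> AB.B.smult_add_right AB.B.smult_add_left AB.B.smult_smult mult.commute)
  show pure: "tensor_lift B (\<lambda>(x, y). \<epsilon> x \<odot>\<^bsub>B\<^esub> y) (pure_tensor A B x y) = \<epsilon> x \<odot>\<^bsub>B\<^esub> y"
    if "x \<in> carrier A" "y \<in> carrier B" for x y
    using AB.tensor_lift_pure[OF B bil that] by simp
  show "tensor_lift B (\<lambda>(x, y). \<epsilon> x \<odot>\<^bsub>B\<^esub> y) \<in> algebra_homs (tensor A B) B"
    by (rule AB.tensor_homI[OF B AB.tensor_lift_linear[OF B bil]])
      (auto simp: pure \<epsilon> AB.B.smult_mult_left AB.B.smult_mult_right AB.B.smult_smult mult.commute)
qed

lemma
  assumes "\<epsilon> \<in> algebra_homs B field_algebra"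
  shows counit_lift_right_hom: "tensor_lift A (\<lambda>(x, y). \<epsilon> y \<odot>\<^bsub>A\<^esub> x) \<in> algebra_homs (tensor A B) A"
    and counit_lift_right_pure: "x \<in> carrier A \<Longrightarrow> y \<in> carrier B \<Longrightarrow>
      tensor_lift A (\<lambda>(x, y). \<epsilon> y \<odot>\<^bsub>A\<^esub> x) (pure_tensor A B x y) = \<epsilon> y \<odot>\<^bsub>A\<^esub> x"
proof -
  note \<epsilon> = algebra_homsD[OF assms, simplified] linear_mapsD[OF algebra_homsD(1)[OF assms], simplified]
  have bil: "bilinear_map A B A (\<lambda>(x, y). \<epsilon> y \<odot>\<^bsub>A\<^esub> x)"
    by (intro bilinear_mapI linear_mapsI)
      (auto simp: \<epsilon> AB.A.smult_add_right AB.A.smult_add_left AB.A.smult_smult mult.commute)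
  show pure: "tensor_lift A (\<lambda>(x, y). \<epsilon> y \<odot>\<^bsub>A\<^esub> x) (pure_tensor A B x y) = \<epsilon> y \<odot>\<^bsub>A\<^esub> x"
    if "x \<in> carrier A" "y \<in> carrier B" for x y
    using AB.tensor_lift_pure[OF A bil that] by simp
  show "tensor_lift A (\<lambda>(x, y). \<epsilon> y \<odot>\<^bsub>A\<^esub> x) \<in> algebra_homs (tensor A B) A"
    by (rule AB.tensor_homI[OF A AB.tensor_lift_linear[OF A bil]])
      (auto simp: pure \<epsilon> AB.A.smult_mult_left AB.A.smult_mult_right AB.A.smult_smult mult.commute)
qed

end

lemma
  assumes A: "assoc_algebra A"
  shows multiplication_linear: "multiplication A \<in> linear_maps (tensor A A) A"
    and multiplication_pure: "x \<in> carrier A \<Longrightarrow> y \<in> carrier A \<Longrightarrow>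
      multiplication A (pure_tensor A A x y) = x \<otimes>\<^bsub>A\<^esub> y"
proof -
  interpret AA: tensor_product A A by (rule tensor_productI[OF A A])
  have bil: "bilinear_map A A A (\<lambda>(x, y). x \<otimes>\<^bsub>A\<^esub> y)"
    by (intro bilinear_mapI linear_mapsI)
      (auto simp: AA.A.A.r_distr AA.A.A.l_distr AA.A.smult_mult_left AA.A.smult_mult_right)
  show "multiplication A \<in> linear_maps (tensor A A) A"
    unfolding multiplication_def by (rule AA.tensor_lift_linear[OF A bil])
  show "multiplication A (pure_tensor A A x y) = x \<otimes>\<^bsub>A\<^esub> y" if "x \<in> carrier A" "y \<in> carrier A"
    unfolding multiplication_def using AA.tensor_lift_pure[OF A bil that] by simp
qed


lemma tensor_assoc_inv_assoc:
  assumes A: "assoc_algebra A" and B: "assoc_algebra B" and C: "assoc_algebra C"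
    and t: "t \<in> carrier (tensor (tensor A B) C)"
  shows "tensor_assoc_inv A B C (tensor_assoc A B C t) = t"
proof -
  interpret AB: tensor_product A B by (rule tensor_productI[OF A B])
  interpret BC: tensor_product B C by (rule tensor_productI[OF B C])
  interpret AB_C: tensor_product "tensor A B" C by (rule tensor_productI[OF AB.tensor_assoc_algebra C])
  let ?h = "\<lambda>t. tensor_assoc_inv A B C (tensor_assoc A B C t)"
  have lin: "?h \<in> linear_maps (tensor (tensor A B) C) (tensor (tensor A B) C)"
    by (rule linear_maps_comp[OF tensor_assoc_inv_linear[OF A B C] tensor_assoc_linear[OF A B C]])
  show ?thesis
    using t
  proof (induction rule: AB_C.tensor_induct)
    case (pure s z)
    from this(1) show ?case
      by (induction rule: AB.tensor_induct)
        (use pure(2) in \<open>auto simp: tensor_assoc_pure[OF A B C] tensor_assoc_inv_pure[OF A B C]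
          AB_C.pure_add_left AB_C.pure_closed linear_mapsD[OF lin]\<close>)
  qed (simp add: linear_mapsD[OF lin])
qed


section \<open>Matrices over an algebra\<close>

lemma mat_transpose_transpose [simp]: "mat_transpose (mat_transpose W) = W"
  by (simp add: mat_transpose_def)

lemma mat_transpose_one [simp]: "mat_transpose (mat_one R) = mat_one R"
  by (intro ext) (auto simp: mat_transpose_def mat_one_def)

context assoc_algebra
begin

definition mats :: "('i \<Rightarrow> 'j \<Rightarrow> 'a) set" where
  "mats = {W. \<forall>i j. W i j \<in> carrier A}"

lemma matsD: "W \<in> mats \<Longrightarrow> W i j \<in> carrier A"
  by (simp add: mats_def)

lemma mat_mult_closed [simp]: "W \<in> mats \<Longrightarrow> Y \<in> mats \<Longrightarrow> mat_mult A W Y \<in> mats"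
  by (simp add: mats_def mat_mult_def)

lemma mat_transpose_closed [simp]: "mat_transpose W \<in> mats \<longleftrightarrow> W \<in> mats"
  by (auto simp: mats_def mat_transpose_def)

lemma scalar_mat_closed [simp]: "scalar_mat A M \<in> mats"
  by (simp add: mats_def scalar_mat_def)

lemma mat_one_closed [simp]: "mat_one A \<in> mats"
  by (simp add: mats_def mat_one_def)

lemma finsum_swap:
  assumes "finite I" "finite J" "\<And>i j. i \<in> I \<Longrightarrow> j \<in> J \<Longrightarrow> f i j \<in> carrier A"
  shows "(\<Oplus>\<^bsub>A\<^esub>i\<in>I. \<Oplus>\<^bsub>A\<^esub>j\<in>J. f i j) = (\<Oplus>\<^bsub>A\<^esub>j\<in>J. \<Oplus>\<^bsub>A\<^esub>i\<in>I. f i j)"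
  using assms
proof (induction I rule: finite_induct)
  case empty
  then show ?case by (simp add: A.finsum_zero)
next
  case (insert i I)
  then have "(\<Oplus>\<^bsub>A\<^esub>i\<in>insert i I. \<Oplus>\<^bsub>A\<^esub>j\<in>J. f i j) = (\<Oplus>\<^bsub>A\<^esub>j\<in>J. f i j) \<oplus>\<^bsub>A\<^esub> (\<Oplus>\<^bsub>A\<^esub>j\<in>J. \<Oplus>\<^bsub>A\<^esub>i\<in>I. f i j)"
    by (subst A.finsum_insert) auto
  also have "\<dots> = (\<Oplus>\<^bsub>A\<^esub>j\<in>J. f i j \<oplus>\<^bsub>A\<^esub> (\<Oplus>\<^bsub>A\<^esub>i\<in>I. f i j))"
    using insert by (subst A.finsum_addf) auto
  also have "\<dots> = (\<Oplus>\<^bsub>A\<^esub>j\<in>J. \<Oplus>\<^bsub>A\<^esub>i\<in>insert i I. f i j)"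
    using insert by (intro A.finsum_cong') (auto simp: A.finsum_insert Pi_iff)
  finally show ?case .
qed

lemma mat_mult_assoc:
  assumes "W \<in> mats" "Y \<in> mats" "Z \<in> mats"
  shows "mat_mult A (mat_mult A W Y) Z = mat_mult A W (mat_mult A Y Z)"
proof (intro ext)
  fix i j
  note [simp] = matsD[OF assms(1)] matsD[OF assms(2)] matsD[OF assms(3)]
  have "(\<Oplus>\<^bsub>A\<^esub>l\<in>UNIV. (\<Oplus>\<^bsub>A\<^esub>p\<in>UNIV. W i p \<otimes>\<^bsub>A\<^esub> Y p l) \<otimes>\<^bsub>A\<^esub> Z l j)
      = (\<Oplus>\<^bsub>A\<^esub>l\<in>UNIV. \<Oplus>\<^bsub>A\<^esub>p\<in>UNIV. W i p \<otimes>\<^bsub>A\<^esub> (Y p l \<otimes>\<^bsub>A\<^esub> Z l j))"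
    by (intro A.finsum_cong') (auto simp: A.finsum_ldistr A.m_assoc)
  also have "\<dots> = (\<Oplus>\<^bsub>A\<^esub>p\<in>UNIV. \<Oplus>\<^bsub>A\<^esub>l\<in>UNIV. W i p \<otimes>\<^bsub>A\<^esub> (Y p l \<otimes>\<^bsub>A\<^esub> Z l j))"
    by (rule finsum_swap) auto
  also have "\<dots> = (\<Oplus>\<^bsub>A\<^esub>p\<in>UNIV. W i p \<otimes>\<^bsub>A\<^esub> (\<Oplus>\<^bsub>A\<^esub>l\<in>UNIV. Y p l \<otimes>\<^bsub>A\<^esub> Z l j))"
    by (intro A.finsum_cong') (auto simp: A.finsum_rdistr)
  finally show "mat_mult A (mat_mult A W Y) Z i j = mat_mult A W (mat_mult A Y Z) i j"
    by (simp add: mat_mult_def)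
qed

lemma mat_mult_one_left [simp]: "W \<in> mats \<Longrightarrow> mat_mult A (mat_one A) W = W"
proof (intro ext)
  fix i j assume W: "W \<in> mats"
  have "(\<Oplus>\<^bsub>A\<^esub>l\<in>UNIV. mat_one A i l \<otimes>\<^bsub>A\<^esub> W l j) = (\<Oplus>\<^bsub>A\<^esub>l\<in>UNIV. if i = l then W l j else \<zero>\<^bsub>A\<^esub>)"
    by (intro A.finsum_cong') (auto simp: mat_one_def matsD[OF W])
  also have "\<dots> = W i j"
    by (rule A.finsum_singleton) (auto simp: matsD[OF W])
  finally show "mat_mult A (mat_one A) W i j = W i j"
    by (simp add: mat_mult_def)
qed

lemma mat_mult_one_right [simp]: "W \<in> mats \<Longrightarrow> mat_mult A W (mat_one A) = W"
proof (intro ext)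
  fix i j assume W: "W \<in> mats"
  have "(\<Oplus>\<^bsub>A\<^esub>l\<in>UNIV. W i l \<otimes>\<^bsub>A\<^esub> mat_one A l j) = (\<Oplus>\<^bsub>A\<^esub>l\<in>UNIV. if j = l then W i l else \<zero>\<^bsub>A\<^esub>)"
    by (intro A.finsum_cong') (auto simp: mat_one_def matsD[OF W])
  also have "\<dots> = W i j"
    by (rule A.finsum_singleton) (auto simp: matsD[OF W])
  finally show "mat_mult A W (mat_one A) i j = W i j"
    by (simp add: mat_mult_def)
qed

lemma scalar_sum: "finite I \<Longrightarrow> (\<Oplus>\<^bsub>A\<^esub>i\<in>I. f i \<odot>\<^bsub>A\<^esub> \<one>\<^bsub>A\<^esub>) = (\<Sum>i\<in>I. f i) \<odot>\<^bsub>A\<^esub> \<one>\<^bsub>A\<^esub>"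
  by (induction I rule: finite_induct) (auto simp: A.finsum_insert smult_add_left)

lemma scalar_mat_mult: "mat_mult A (scalar_mat A M) (scalar_mat A N) = scalar_mat A (M ** N)"
  by (intro ext)
    (simp add: mat_mult_def scalar_mat_def matrix_matrix_mult_def smult_mult_left smult_smult scalar_sum)

lemma scalar_mat_one: "scalar_mat A (mat 1) = mat_one A"
  by (intro ext) (simp add: scalar_mat_def mat_one_def mat_def)

lemma scalar_mat_inverse:
  assumes "invertible M"
  shows "mat_mult A (scalar_mat A M) (scalar_mat A (matrix_inv M)) = mat_one A"
    and "mat_mult A (scalar_mat A (matrix_inv M)) (scalar_mat A M) = mat_one A"
proof -
  have "M ** matrix_inv M = mat 1 \<and> matrix_inv M ** M = mat 1"
    using assms unfolding matrix_inv_def invertible_def by (rule someI_ex)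
  then show "mat_mult A (scalar_mat A M) (scalar_mat A (matrix_inv M)) = mat_one A"
    "mat_mult A (scalar_mat A (matrix_inv M)) (scalar_mat A M) = mat_one A"
    by (simp_all add: scalar_mat_mult scalar_mat_one)
qed

lemma scalar_mat_central: "x \<in> carrier A \<Longrightarrow> scalar_mat A M i j \<otimes>\<^bsub>A\<^esub> x = x \<otimes>\<^bsub>A\<^esub> scalar_mat A M i j"
  by (simp add: scalar_mat_def smult_mult_left smult_mult_right)

text \<open>Over a noncommutative algebra, transposition reverses products only of matrices whose entries
  commute with each other.\<close>

lemma mat_transpose_mult:
  assumes "W \<in> mats" "Y \<in> mats" "\<And>i l l' j. W i l \<otimes>\<^bsub>A\<^esub> Y l' j = Y l' j \<otimes>\<^bsub>A\<^esub> W i l"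
  shows "mat_transpose (mat_mult A W Y) = mat_mult A (mat_transpose Y) (mat_transpose W)"
  by (intro ext) (simp add: mat_transpose_def mat_mult_def assms(3))

lemma mat_transpose_mult_scalar:
  assumes "W \<in> mats"
  shows "mat_transpose (mat_mult A (scalar_mat A M) W)
      = mat_mult A (mat_transpose W) (mat_transpose (scalar_mat A M))"
    and "mat_transpose (mat_mult A W (scalar_mat A N))
      = mat_mult A (mat_transpose (scalar_mat A N)) (mat_transpose W)"
  using assms by (auto intro!: mat_transpose_mult simp: scalar_mat_central matsD)

end

lemma mat_mult_opposite:
  assumes "assoc_algebra A"
  shows "mat_mult (opposite_algebra A) W Y = mat_transpose (mat_mult A (mat_transpose Y) (mat_transpose W))"
  by (simp add: mat_mult_def mat_transpose_def opposite_algebra_def finsum_def finprod_def)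

lemma scalar_mat_opposite: "scalar_mat (opposite_algebra A) M = scalar_mat A M"
  by (simp add: scalar_mat_def opposite_algebra_def)

lemma mat_one_opposite: "mat_one (opposite_algebra A) = mat_one A"
  by (intro ext) (auto simp: mat_one_def opposite_algebra_def)

lemma algebra_hom_mat_mult:
  assumes "assoc_algebra A" "assoc_algebra B" "h \<in> algebra_homs A B"
    and "\<And>i j. W i j \<in> carrier A" "\<And>i j. Y i j \<in> carrier A"
  shows "h (mat_mult A W Y i j) = mat_mult B (\<lambda>i j. h (W i j)) (\<lambda>i j. h (Y i j)) i j"
proof -
  interpret A: assoc_algebra A by fact
  show ?thesis
    unfolding mat_mult_def using assms(4,5)
    by (subst linear_map_finsum[OF assms(1,2) algebra_homsD(1)[OF assms(3)]])
      (auto simp: algebra_homsD[OF assms(3)])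
qed

lemma algebra_hom_mat_one:
  assumes "assoc_algebra A" "assoc_algebra B" "h \<in> algebra_homs A B"
  shows "h (mat_one A i j) = mat_one B i j"
  using linear_map_zero[OF assms(1,2) algebra_homsD(1)[OF assms(3)]] algebra_homsD(4)[OF assms(3)]
  by (simp add: mat_one_def)

lemma algebra_hom_scalar_mat:
  assumes "assoc_algebra A" "h \<in> algebra_homs A B"
  shows "h (scalar_mat A M i j) = scalar_mat B M i j"
proof -
  interpret A: assoc_algebra A by fact
  show ?thesis
    using linear_mapsD(3)[OF algebra_homsD(1)[OF assms(2)], of "\<one>\<^bsub>A\<^esub>"] algebra_homsD(4)[OF assms(2)]
    by (simp add: scalar_mat_def)
qed


section \<open>Points of \<open>\<B>(E,F)\<close>\<close>

text \<open>The matrix \<open>F\<^sup>-\<^sup>1 \<^sup>tx E\<close>, which the defining relations of \<open>\<B>(E,F)\<close> make the inverse of \<open>x\<close>. For \<open>E = F\<close>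
  and the generic matrix it is the antipode of \<open>\<B>(E)\<close>.\<close>

definition twisted_transpose ::
  "('k::field, 'a, 's) module_scheme \<Rightarrow> 'k^'m^'m \<Rightarrow> 'k^'n^'n \<Rightarrow> ('m \<Rightarrow> 'n \<Rightarrow> 'a) \<Rightarrow> 'n \<Rightarrow> 'm \<Rightarrow> 'a" where
  "twisted_transpose A E F W =
     mat_mult A (mat_mult A (scalar_mat A (matrix_inv F)) (mat_transpose W)) (scalar_mat A E)"

text \<open>The matrices over \<open>A\<close> that satisfy the relations of \<open>\<B>(E,F)\<close>, grouped so that both of them speak of
  one inverse.\<close>

definition BB_point ::
  "('k::field, 'a, 's) module_scheme \<Rightarrow> 'k^'m^'m \<Rightarrow> 'k^'n^'n \<Rightarrow> ('m \<Rightarrow> 'n \<Rightarrow> 'a) \<Rightarrow> bool" where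
  "BB_point A E F W \<longleftrightarrow> (\<forall>i j. W i j \<in> carrier A) \<and>
     mat_mult A (twisted_transpose A E F W) W = mat_one A \<and>
     mat_mult A W (twisted_transpose A E F W) = mat_one A"

lemma twisted_transpose_closed:
  assumes "assoc_algebra A" "\<And>i j. W i j \<in> carrier A"
  shows "twisted_transpose A E F W i j \<in> carrier A"
proof -
  interpret assoc_algebra A by fact
  have "W \<in> mats" using assms(2) by (simp add: mats_def)
  then have "twisted_transpose A E F W \<in> mats" by (simp add: twisted_transpose_def)
  then show ?thesis by (simp add: mats_def)
qed

lemma algebra_hom_twisted_transpose:
  assumes A: "assoc_algebra A" and B: "assoc_algebra B" and h: "h \<in> algebra_homs A B"
    and W: "\<And>i j. W i j \<in> carrier A"
  shows "h (twisted_transpose A E F W i j) = twisted_transpose B E F (\<lambda>i j. h (W i j)) i j"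
proof -
  interpret A: assoc_algebra A by fact
  have T: "mat_transpose W i j \<in> carrier A" for i j
    using W by (simp add: mat_transpose_def)
  then have T': "mat_mult A (scalar_mat A (matrix_inv F)) (mat_transpose W) i j \<in> carrier A" for i j
    by (intro A.matsD A.mat_mult_closed) (auto simp: A.mats_def scalar_mat_def)
  have S: "scalar_mat A M i j \<in> carrier A" for M i j
    by (simp add: scalar_mat_def)
  show ?thesis
    unfolding twisted_transpose_def
    by (simp add: algebra_hom_mat_mult[OF A B h] T T' S algebra_hom_scalar_mat[OF A h])
      (simp add: mat_transpose_def)
qed

lemma BB_point_hom:
  assumes A: "assoc_algebra A" and B: "assoc_algebra B" and h: "h \<in> algebra_homs A B"
    and W: "BB_point A E F W"
  shows "BB_point B E F (\<lambda>i j. h (W i j))"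
proof -
  have W': "W i j \<in> carrier A" for i j
    using W by (simp add: BB_point_def)
  note tt = twisted_transpose_closed[OF A, of W E F, OF W']
  have tt': "twisted_transpose B E F (\<lambda>i j. h (W i j)) = (\<lambda>i j. h (twisted_transpose A E F W i j))"
    by (intro ext) (simp add: algebra_hom_twisted_transpose[OF A B h W'])
  show ?thesis
    unfolding BB_point_def tt'
    using W algebra_homsD(2)[OF h]
    by (auto simp: BB_point_def fun_eq_iff algebra_hom_mat_one[OF A B h, symmetric]
        algebra_hom_mat_mult[OF A B h, symmetric] W' tt)
qed

text \<open>Transposition reverses the product because the entries commute, and the factors \<open>F\<close> and \<open>F\<^sup>-\<^sup>1\<close> meet in
  the middle: \<open>G\<^sup>-\<^sup>1 \<^sup>t(xy) E = (G\<^sup>-\<^sup>1 \<^sup>ty F) (F\<^sup>-\<^sup>1 \<^sup>tx E)\<close>.\<close>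

lemma BB_point_mult:
  fixes A :: "('k::field, 'a, 's) module_scheme" and F :: "'k^'n^'n"
    and W :: "'m::finite \<Rightarrow> 'n \<Rightarrow> 'a" and Y :: "'n \<Rightarrow> 'p::finite \<Rightarrow> 'a"
  assumes A: "assoc_algebra A" and F: "invertible F"
    and W: "BB_point A E F W" and Y: "BB_point A F G Y"
    and comm: "\<And>i l l' j. W i l \<otimes>\<^bsub>A\<^esub> Y l' j = Y l' j \<otimes>\<^bsub>A\<^esub> W i l"
  shows "BB_point A E G (mat_mult A W Y)"
proof -
  interpret assoc_algebra A by fact
  have mats [simp]: "W \<in> mats" "Y \<in> mats"
    using W Y by (auto simp: BB_point_def mats_def)
  then have tt [simp]: "twisted_transpose A E F W \<in> mats" "twisted_transpose A F G Y \<in> mats"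
    by (simp_all add: twisted_transpose_def)
  have cancel: "mat_mult A (scalar_mat A F) (mat_mult A (scalar_mat A (matrix_inv F)) Z) = Z"
    if "Z \<in> mats" for Z :: "'n \<Rightarrow> 'j \<Rightarrow> 'a"
    using that by (simp add: mat_mult_assoc[symmetric] scalar_mat_inverse[OF F])
  have eq: "twisted_transpose A E G (mat_mult A W Y)
      = mat_mult A (twisted_transpose A F G Y) (twisted_transpose A E F W)"
    by (simp add: twisted_transpose_def mat_transpose_mult comm mat_mult_assoc cancel)
  have "mat_mult A (twisted_transpose A E G (mat_mult A W Y)) (mat_mult A W Y)
      = mat_mult A (twisted_transpose A F G Y)
          (mat_mult A (mat_mult A (twisted_transpose A E F W) W) Y)"
    by (simp add: eq mat_mult_assoc)
  moreover have "mat_mult A (mat_mult A W Y) (twisted_transpose A E G (mat_mult A W Y))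
      = mat_mult A W
          (mat_mult A (mat_mult A Y (twisted_transpose A F G Y)) (twisted_transpose A E F W))"
    by (simp add: eq mat_mult_assoc)
  moreover have "mat_mult A W Y i j \<in> carrier A" for i j
    by (intro matsD) simp
  ultimately show ?thesis
    using W Y by (simp add: BB_point_def)
qed

lemma BB_point_one:
  assumes A: "assoc_algebra A" and E: "invertible E"
  shows "BB_point A E E (mat_one A)"
proof -
  interpret assoc_algebra A by fact
  have "twisted_transpose A E E (mat_one A) = mat_one A"
    by (simp add: twisted_transpose_def scalar_mat_inverse[OF E])
  then show ?thesis by (simp add: BB_point_def matsD)
qed

text \<open>Put \<open>s = E\<^sup>-\<^sup>1 \<^sup>ty F\<close>, the inverse of \<open>y\<close>. A product over the opposite algebra is the transpose of the
  reversed product of the transposes, so both relations become identities over \<open>A\<close>, in which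
  \<open>\<^sup>ts = \<^sup>tF y \<^sup>tE\<^sup>-\<^sup>1\<close> and everything cancels by \<open>y s = 1 = s y\<close>.\<close>

lemma BB_point_twisted_transpose:
  fixes A :: "('k::field, 'a, 's) module_scheme" and E :: "'k^'m^'m" and F :: "'k^'n^'n"
    and Y :: "'n \<Rightarrow> 'm \<Rightarrow> 'a"
  assumes A: "assoc_algebra A" and E: "invertible E" and F: "invertible F"
    and Y: "BB_point A F E Y"
  shows "BB_point (opposite_algebra A) E F (twisted_transpose A F E Y)"
proof -
  interpret assoc_algebra A by fact
  let ?S = "twisted_transpose A F E Y"
  let ?c = "scalar_mat A" and ?t = mat_transpose
  let ?m = "\<lambda>W Y. mat_mult A W Y"
  have mats [simp]: "Y \<in> mats" using Y by (simp add: BB_point_def mats_def)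
  have S [simp]: "?S \<in> mats" by (simp add: twisted_transpose_def)
  have YS: "mat_mult A Y ?S = mat_one A" and SY: "mat_mult A ?S Y = mat_one A"
    using Y by (simp_all add: BB_point_def)
  have S_eq: "?S = mat_mult A (mat_mult A (?c (matrix_inv E)) (?t Y)) (?c F)"
    by (simp add: twisted_transpose_def)
  have tS: "?t ?S = mat_mult A (?t (?c F)) (mat_mult A Y (?t (?c (matrix_inv E))))"
    unfolding S_eq by (simp add: mat_transpose_mult_scalar)
  have tc: "mat_mult A (?t (?c (matrix_inv M))) (?t (?c M)) = mat_one A"
    "mat_mult A (?t (?c M)) (?t (?c (matrix_inv M))) = mat_one A" if "invertible M" for M :: "'k^'i^'i"
    using scalar_mat_inverse[OF that]
    by (metis mat_transpose_mult_scalar(1) mat_transpose_one scalar_mat_closed)+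
  have cancel: "mat_mult A (?t (?c (matrix_inv M))) (mat_mult A (?t (?c M)) Z) = Z"
    "mat_mult A (?t (?c M)) (mat_mult A (?t (?c (matrix_inv M))) Z) = Z"
    if "invertible M" "Z \<in> mats" for M :: "'k^'i^'i" and Z :: "'i \<Rightarrow> 'j \<Rightarrow> 'a"
    using that by (simp_all add: mat_mult_assoc[symmetric] tc)
  have cancel_Y: "mat_mult A Y (mat_mult A ?S Z) = Z" if "Z \<in> mats" for Z :: "'n \<Rightarrow> 'j \<Rightarrow> 'a"
    using that by (simp add: mat_mult_assoc[symmetric] YS)
  have cancel_S: "mat_mult A ?S (mat_mult A Y Z) = Z" if "Z \<in> mats" for Z :: "'m \<Rightarrow> 'j \<Rightarrow> 'a"
    using that by (simp add: mat_mult_assoc[symmetric] SY)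
  have tt: "twisted_transpose (opposite_algebra A) E F ?S
      = ?t (mat_mult A (?t (?c E)) (mat_mult A ?S (?t (?c (matrix_inv F)))))"
    by (simp add: twisted_transpose_def[of "opposite_algebra A"] mat_mult_opposite[OF A] scalar_mat_opposite)
  have "mat_mult (opposite_algebra A) (twisted_transpose (opposite_algebra A) E F ?S) ?S = mat_one A"
    by (simp add: tt mat_mult_opposite[OF A] tS mat_mult_assoc cancel[OF E] cancel_Y cancel_S tc[OF F])
  moreover have "mat_mult (opposite_algebra A) ?S (twisted_transpose (opposite_algebra A) E F ?S) = mat_one A"
    by (simp add: tt mat_mult_opposite[OF A] tS mat_mult_assoc cancel[OF F] cancel_Y cancel_S tc[OF E])
  moreover have "?S i j \<in> carrier (opposite_algebra A)" for i j
    using matsD[OF S] by (simp add: opposite_algebra_def)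
  ultimately show ?thesis
    by (simp add: BB_point_def mat_one_opposite)
qed


section \<open>The universal property of \<open>\<B>(E,F)\<close>\<close>

lemma BB_algebra_assoc: "assoc_algebra (BB_algebra E F)"
  unfolding BB_algebra_def by (rule assoc_algebra_presented)

lemma BB_gen_closed: "BB_gen E F i j \<in> carrier (BB_algebra E F)"
  unfolding BB_algebra_def BB_gen_def by (rule presented_generator_closed)

text \<open>The equivalence is used in both directions: from right to left it is the universal property
  of \<open>\<B>(E,F)\<close>, and from left to right, for the quotient map, it says that the generic matrix is a
  point.\<close>

lemma algebra_hom_kills_BB_relations_iff:
  fixes E :: "'k::field^'m^'m" and F :: "'k^'n^'n"
  assumes A: "assoc_algebra A" and h: "h \<in> algebra_homs free_algebra A"
  shows "(\<forall>r\<in>BB_relations E F. h r = \<zero>\<^bsub>A\<^esub>) \<longleftrightarrow> BB_point A E F (\<lambda>i j. h (free_generator (i, j)))"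
proof -
  let ?R = "free_algebra :: ('k, ('m \<times> 'n) list \<Rightarrow>\<^sub>0 'k) module"
  let ?z = "\<lambda>i j. free_generator (i, j) :: ('m \<times> 'n) list \<Rightarrow>\<^sub>0 'k"
  let ?t = "twisted_transpose ?R E F ?z"
  have R: "assoc_algebra ?R" by (rule assoc_algebra_free_algebra)
  interpret R: assoc_algebra ?R by (rule R)
  interpret A: assoc_algebra A by (rule A)
  have mats [simp]: "W \<in> R.mats" for W :: "'i \<Rightarrow> 'j \<Rightarrow> _"
    by (simp add: R.mats_def free_algebra_simps)
  have [simp]: "x \<in> carrier ?R" for x
    by (simp add: free_algebra_simps)
  have rel: "BB_relations E F = mat_relations ?R (mat_mult ?R ?t ?z) (mat_one ?R)
      \<union> mat_relations ?R (mat_mult ?R ?z ?t) (mat_one ?R)"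
    by (simp add: BB_relations_def twisted_transpose_def R.mat_mult_assoc Let_def)
  have diff: "h (x \<ominus>\<^bsub>?R\<^esub> y) = \<zero>\<^bsub>A\<^esub> \<longleftrightarrow> h x = h y" for x y
    using algebra_homsD(2)[OF h]
    by (simp add: linear_map_minus[OF R A algebra_homsD(1)[OF h]])
  have kill: "(\<forall>r\<in>mat_relations ?R W (mat_one ?R). h r = \<zero>\<^bsub>A\<^esub>) \<longleftrightarrow>
      (\<lambda>i j. h (W i j)) = (mat_one A)" for W :: "'i \<Rightarrow> 'i \<Rightarrow> _"
    unfolding mat_relations_def Ball_def mem_Collect_eq fun_eq_iff
    using diff[of "W _ _" "mat_one ?R _ _"] algebra_hom_mat_one[OF R A h] by metis
  have t: "(\<lambda>i j. h (?t i j)) = twisted_transpose A E F (\<lambda>i j. h (?z i j))"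
    by (intro ext) (simp add: algebra_hom_twisted_transpose[OF R A h])
  show ?thesis
    unfolding rel ball_Un kill
    using algebra_homsD(2)[OF h]
    by (simp add: BB_point_def t algebra_hom_mat_mult[OF R A h])
qed

lemma BB_gen_point: "BB_point (BB_algebra E F) E F (BB_gen E F)"
proof -
  let ?h = "\<lambda>p. (Idl\<^bsub>free_algebra\<^esub> BB_relations E F) +>\<^bsub>free_algebra\<^esub> p"
  interpret I: algebra_ideal free_algebra "Idl\<^bsub>free_algebra\<^esub> BB_relations E F"
    by (rule algebra_ideal_presented)
  have "?h r = \<zero>\<^bsub>BB_algebra E F\<^esub>" if "r \<in> BB_relations E F" for r
  proof -
    have "r \<in> Idl\<^bsub>free_algebra\<^esub> BB_relations E F"
      using that I.A.genideal_self[of "BB_relations E F"] by (auto simp: free_algebra_simps)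
    then show ?thesis
      using I.A.a_rcos_zero[OF I.I.is_ideal] I.quotient_simps(3) I.I.zero_closed
      by (simp add: BB_algebra_def presented_algebra_def)
  qed
  moreover have "BB_gen E F = (\<lambda>i j. ?h (free_generator (i, j)))"
    by (intro ext) (simp add: BB_gen_def presented_generator_def)
  ultimately show ?thesis
    using algebra_hom_kills_BB_relations_iff[OF BB_algebra_assoc, of ?h E F E F]
      proj_presented_hom[of "BB_relations E F"]
    by (simp add: BB_algebra_def)
qed

lemma
  assumes A: "assoc_algebra A" and W: "BB_point A E F W"
    and g: "\<And>i j. g (i, j) = W i j"
  shows BB_lift_hom: "presented_lift A g \<in> algebra_homs (BB_algebra E F) A"
    and BB_lift_gen: "presented_lift A g (BB_gen E F i j) = W i j"
proof -
  interpret A: assoc_algebra A by (rule A)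
  have closed: "g x \<in> carrier A" for x
    using W g[of "fst x" "snd x"] by (simp add: BB_point_def)
  have "\<forall>r\<in>BB_relations E F. free_lift A g r = \<zero>\<^bsub>A\<^esub>"
    using W algebra_hom_kills_BB_relations_iff[OF A A.free_lift_hom[of g, OF closed], of E F]
    by (simp add: A.free_lift_generator[of g, OF closed] g)
  then show "presented_lift A g \<in> algebra_homs (BB_algebra E F) A"
    "presented_lift A g (BB_gen E F i j) = W i j"
    unfolding BB_algebra_def BB_gen_def
    using presented_lift_hom[OF A closed, of "BB_relations E F"]
      presented_lift_generator[OF A closed, where R = "BB_relations E F" and x = "(i, j)"] g by auto
qed

lemma BB_hom_ext:
  assumes "f \<in> algebra_homs (BB_algebra E F) B" "g \<in> algebra_homs (BB_algebra E F) B"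
    and "\<And>i j. f (BB_gen E F i j) = g (BB_gen E F i j)"
    and "t \<in> carrier (BB_algebra E F)"
  shows "f t = g t"
  using presented_hom_ext[of f "BB_relations E F" B g t] assms
  by (auto simp: BB_algebra_def BB_gen_def)


lemma BB_algebra_induct [consumes 1, case_names one generator add mult smult]:
  assumes "t \<in> carrier (BB_algebra E F)"
    and "P \<one>\<^bsub>BB_algebra E F\<^esub>"
    and "\<And>i j. P (BB_gen E F i j)"
    and "\<And>s t. s \<in> carrier (BB_algebra E F) \<Longrightarrow> t \<in> carrier (BB_algebra E F) \<Longrightarrow> P s \<Longrightarrow> P t \<Longrightarrow>
      P (s \<oplus>\<^bsub>BB_algebra E F\<^esub> t)"
    and "\<And>s t. s \<in> carrier (BB_algebra E F) \<Longrightarrow> t \<in> carrier (BB_algebra E F) \<Longrightarrow> P s \<Longrightarrow> P t \<Longrightarrow>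
      P (s \<otimes>\<^bsub>BB_algebra E F\<^esub> t)"
    and "\<And>c t. t \<in> carrier (BB_algebra E F) \<Longrightarrow> P t \<Longrightarrow> P (c \<odot>\<^bsub>BB_algebra E F\<^esub> t)"
  shows "P t"
  using assms(1)[unfolded BB_algebra_def]
proof (induction rule: presented_algebra_induct)
  case (generator x)
  with assms(3)[of "fst x" "snd x"] show ?case by (simp add: BB_gen_def)
qed (use assms(2,4-6) in \<open>auto simp: BB_algebra_def\<close>)


section \<open>The cogroupoid of the algebras \<open>\<B>(E,F)\<close>\<close>

text \<open>For \<open>E = F = G\<close> this is the comultiplication of \<open>\<B>(E)\<close>; for \<open>E = F\<close> and for \<open>F = G\<close> it is the left and
  the right coaction.\<close>

definition BB_comult ::
  "'k::field^'m^'m \<Rightarrow> 'k^'n^'n \<Rightarrow> 'k^'p^'p \<Rightarrow> (('m \<times> 'p) list \<Rightarrow>\<^sub>0 'k) set \<Rightarrow>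
   ((('m \<times> 'n) list \<Rightarrow>\<^sub>0 'k) set \<times> (('n \<times> 'p) list \<Rightarrow>\<^sub>0 'k) set \<Rightarrow>\<^sub>0 'k) set" where
  "BB_comult E F G = presented_lift (tensor (BB_algebra E F) (BB_algebra F G))
     (\<lambda>(i, j). \<Oplus>\<^bsub>tensor (BB_algebra E F) (BB_algebra F G)\<^esub>l\<in>UNIV.
        pure_tensor (BB_algebra E F) (BB_algebra F G) (BB_gen E F i l) (BB_gen F G l j))"

definition BB_counit :: "'k::field^'m^'m \<Rightarrow> (('m \<times> 'm) list \<Rightarrow>\<^sub>0 'k) set \<Rightarrow> 'k" where
  "BB_counit E = presented_lift field_algebra (\<lambda>(i, j). if i = j then 1 else 0)"

definition BB_antipode ::
  "'k::field^'m^'m \<Rightarrow> 'k^'n^'n \<Rightarrow> (('m \<times> 'n) list \<Rightarrow>\<^sub>0 'k) set \<Rightarrow> (('n \<times> 'm) list \<Rightarrow>\<^sub>0 'k) set" where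
  "BB_antipode E F = presented_lift (opposite_algebra (BB_algebra F E))
     (\<lambda>(i, j). twisted_transpose (BB_algebra F E) F E (BB_gen F E) i j)"

lemma
  assumes A: "assoc_algebra A" and B: "assoc_algebra B"
  shows pure_left_hom: "(\<lambda>x. pure_tensor A B x \<one>\<^bsub>B\<^esub>) \<in> algebra_homs A (tensor A B)"
    and pure_right_hom: "(\<lambda>y. pure_tensor A B \<one>\<^bsub>A\<^esub> y) \<in> algebra_homs B (tensor A B)"
proof -
  interpret tensor_product A B by (rule tensor_productI[OF A B])
  show "(\<lambda>x. pure_tensor A B x \<one>\<^bsub>B\<^esub>) \<in> algebra_homs A (tensor A B)"
    by (intro algebra_homsI pure_linear_left) (auto simp: pure_mult pure_one)
  show "(\<lambda>y. pure_tensor A B \<one>\<^bsub>A\<^esub> y) \<in> algebra_homs B (tensor A B)"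
    by (intro algebra_homsI pure_linear_right) (auto simp: pure_mult pure_one)
qed

lemma
  assumes F: "invertible F"
  shows BB_comult_hom: "BB_comult E F G \<in>
      algebra_homs (BB_algebra E G) (tensor (BB_algebra E F) (BB_algebra F G))"
    and BB_comult_gen: "BB_comult E F G (BB_gen E G i j) =
      (\<Oplus>\<^bsub>tensor (BB_algebra E F) (BB_algebra F G)\<^esub>l\<in>UNIV.
        pure_tensor (BB_algebra E F) (BB_algebra F G) (BB_gen E F i l) (BB_gen F G l j))"
proof -
  let ?A = "BB_algebra E F" and ?B = "BB_algebra F G"
  let ?T = "tensor ?A ?B" and ?x = "BB_gen E F" and ?y = "BB_gen F G"
  have A: "assoc_algebra ?A" and B: "assoc_algebra ?B"
    by (rule BB_algebra_assoc)+
  interpret tensor_product ?A ?B by (rule tensor_productI[OF A B])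
  let ?x' = "\<lambda>i j. pure_tensor ?A ?B (?x i j) \<one>\<^bsub>?B\<^esub>"
  let ?y' = "\<lambda>i j. pure_tensor ?A ?B \<one>\<^bsub>?A\<^esub> (?y i j)"
  have x: "?x i j \<in> carrier ?A" and y: "?y k l \<in> carrier ?B" for i j k l
    by (rule BB_gen_closed)+
  have "BB_point ?T E F ?x'"
    by (rule BB_point_hom[OF A tensor_assoc_algebra pure_left_hom[OF A B] BB_gen_point])
  moreover have "BB_point ?T F G ?y'"
    by (rule BB_point_hom[OF B tensor_assoc_algebra pure_right_hom[OF A B] BB_gen_point])
  ultimately have point: "BB_point ?T E G (mat_mult ?T ?x' ?y')"
    by (rule BB_point_mult[OF tensor_assoc_algebra F]) (simp add: pure_mult x y)
  have eq: "mat_mult ?T ?x' ?y' i j = (\<Oplus>\<^bsub>?T\<^esub>l\<in>UNIV. pure_tensor ?A ?B (?x i l) (?y l j))" for i j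
    by (simp add: mat_mult_def pure_mult x y)
  show "BB_comult E F G \<in> algebra_homs (BB_algebra E G) ?T"
    unfolding BB_comult_def by (rule BB_lift_hom[OF tensor_assoc_algebra point]) (simp add: eq)
  show "BB_comult E F G (BB_gen E G i j) = (\<Oplus>\<^bsub>?T\<^esub>l\<in>UNIV. pure_tensor ?A ?B (?x i l) (?y l j))"
    unfolding BB_comult_def by (subst BB_lift_gen[OF tensor_assoc_algebra point]) (simp_all add: eq)
qed

lemma
  assumes "invertible E"
  shows BB_counit_hom: "BB_counit E \<in> algebra_homs (BB_algebra E E) field_algebra"
    and BB_counit_gen: "BB_counit E (BB_gen E E i j) = (if i = j then 1 else 0)"
proof -
  note point = BB_point_one[OF assoc_algebra_field_algebra assms]
  show "BB_counit E \<in> algebra_homs (BB_algebra E E) field_algebra"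
    unfolding BB_counit_def
    by (rule BB_lift_hom[OF assoc_algebra_field_algebra point]) (simp add: mat_one_def)
  show "BB_counit E (BB_gen E E i j) = (if i = j then 1 else 0)"
    unfolding BB_counit_def
    by (subst BB_lift_gen[OF assoc_algebra_field_algebra point]) (simp_all add: mat_one_def)
qed

definition anti_homs ::
  "('k::field, 'a, 's) module_scheme \<Rightarrow> ('k, 'b, 't) module_scheme \<Rightarrow> ('a \<Rightarrow> 'b) set" where
  "anti_homs A B = algebra_homs A (opposite_algebra B)"

lemma anti_homsD:
  assumes "h \<in> anti_homs A B"
  shows "h \<in> linear_maps A B"
    and "x \<in> carrier A \<Longrightarrow> h x \<in> carrier B"
    and "x \<in> carrier A \<Longrightarrow> y \<in> carrier A \<Longrightarrow> h (x \<otimes>\<^bsub>A\<^esub> y) = h y \<otimes>\<^bsub>B\<^esub> h x"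
    and "h \<one>\<^bsub>A\<^esub> = \<one>\<^bsub>B\<^esub>"
  using assms by (auto simp: anti_homs_def algebra_homs_def ring_hom_def opposite_algebra_def linear_maps_def)

lemma
  assumes E: "invertible E" and F: "invertible F"
  shows BB_antipode_hom: "BB_antipode E F \<in> anti_homs (BB_algebra E F) (BB_algebra F E)"
    and BB_antipode_gen: "BB_antipode E F (BB_gen E F i j) =
      twisted_transpose (BB_algebra F E) F E (BB_gen F E) i j"
proof -
  note point = BB_point_twisted_transpose[OF BB_algebra_assoc E F BB_gen_point]
  note opp = assoc_algebra_opposite[OF BB_algebra_assoc]
  show "BB_antipode E F \<in> anti_homs (BB_algebra E F) (BB_algebra F E)"
    unfolding BB_antipode_def anti_homs_def by (rule BB_lift_hom[OF opp point]) simp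
  show "BB_antipode E F (BB_gen E F i j) = twisted_transpose (BB_algebra F E) F E (BB_gen F E) i j"
    unfolding BB_antipode_def by (subst BB_lift_gen[OF opp point]) simp_all
qed

text \<open>Both sides are algebra morphisms on \<open>\<B>(E,H)\<close> and send \<open>z\<^sub>i\<^sub>j\<close> to the sum of all
  \<open>z\<^sub>i\<^sub>q \<otimes> (z\<^sub>q\<^sub>l \<otimes> z\<^sub>l\<^sub>j)\<close>, summed in different orders.\<close>

lemma BB_coassoc:
  assumes F: "invertible F" and G: "invertible G" and x: "x \<in> carrier (BB_algebra E H)"
  shows "tensor_assoc (BB_algebra E F) (BB_algebra F G) (BB_algebra G H)
      (tensor_map (tensor (BB_algebra E F) (BB_algebra F G)) (BB_algebra G H)
        (BB_comult E F G) id (BB_comult E G H x))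
    = tensor_map (BB_algebra E F) (tensor (BB_algebra F G) (BB_algebra G H))
        id (BB_comult F G H) (BB_comult E F H x)"
proof -
  let ?A = "BB_algebra E F" and ?B = "BB_algebra F G" and ?C = "BB_algebra G H"
  have A: "assoc_algebra ?A" and B: "assoc_algebra ?B" and C: "assoc_algebra ?C"
    and EG: "assoc_algebra (BB_algebra E G)" and FH: "assoc_algebra (BB_algebra F H)"
    by (rule BB_algebra_assoc)+
  interpret AB: tensor_product ?A ?B by (rule tensor_productI[OF A B])
  interpret BC: tensor_product ?B ?C by (rule tensor_productI[OF B C])
  note ABa = AB.tensor_assoc_algebra and BCa = BC.tensor_assoc_algebra
  interpret AB_C: tensor_product "tensor ?A ?B" ?C by (rule tensor_productI[OF ABa C])
  interpret A_BC: tensor_product ?A "tensor ?B ?C" by (rule tensor_productI[OF A BCa])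
  interpret EG_C: tensor_product "BB_algebra E G" ?C by (rule tensor_productI[OF EG C])
  interpret A_FH: tensor_product ?A "BB_algebra F H" by (rule tensor_productI[OF A FH])
  interpret T: assoc_algebra "tensor ?A (tensor ?B ?C)" by (rule A_BC.tensor_assoc_algebra)
  let ?T = "tensor ?A (tensor ?B ?C)"
  note homs = BB_comult_hom[OF F, of E G] BB_comult_hom[OF G, of E H]
    BB_comult_hom[OF F, of E H] BB_comult_hom[OF G, of F H]
  note gens = BB_comult_gen[OF F, of E G] BB_comult_gen[OF G, of E H]
    BB_comult_gen[OF F, of E H] BB_comult_gen[OF G, of F H]
  note lin = homs[THEN algebra_homsD(1)]
  note closed [simp] = BB_gen_closed
  let ?l = "\<lambda>x. tensor_assoc ?A ?B ?C (tensor_map (tensor ?A ?B) ?C (BB_comult E F G) id x)"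
  let ?r = "tensor_map ?A (tensor ?B ?C) id (BB_comult F G H)"
  have l: "?l \<in> algebra_homs (tensor (BB_algebra E G) ?C) ?T"
    by (rule algebra_homs_comp[OF tensor_assoc_hom[OF A B C]
          tensor_map_hom[OF EG C ABa C homs(1) algebra_homs_id]])
  have r: "?r \<in> algebra_homs (tensor ?A (BB_algebra F H)) ?T"
    by (rule tensor_map_hom[OF A FH A BCa algebra_homs_id homs(4)])
  have "?l (BB_comult E G H (BB_gen E H i j)) = ?r (BB_comult E F H (BB_gen E H i j))" for i j
  proof -
    let ?p = "\<lambda>l q. pure_tensor ?A (tensor ?B ?C) (BB_gen E F i q)
        (pure_tensor ?B ?C (BB_gen F G q l) (BB_gen G H l j))"
    have 1: "(\<lambda>s. tensor_assoc ?A ?B ?C (pure_tensor (tensor ?A ?B) ?C s (BB_gen G H l j)))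
        \<in> linear_maps (tensor ?A ?B) ?T" for l
      by (rule linear_maps_comp[OF tensor_assoc_linear[OF A B C] AB_C.pure_linear_left]) simp
    have "?l (BB_comult E G H (BB_gen E H i j)) = (\<Oplus>\<^bsub>?T\<^esub>l\<in>UNIV. \<Oplus>\<^bsub>?T\<^esub>q\<in>UNIV. ?p l q)"
      by (simp add: gens linear_map_finsum[OF EG_C.tensor_assoc_algebra A_BC.tensor_assoc_algebra
            algebra_homsD(1)[OF l]] EG_C.pure_closed tensor_map_pure[OF EG C ABa C lin(1) linear_maps_id]
          linear_map_finsum[OF ABa A_BC.tensor_assoc_algebra 1] AB.pure_closed
          tensor_assoc_pure[OF A B C])
    also have "\<dots> = (\<Oplus>\<^bsub>?T\<^esub>q\<in>UNIV. \<Oplus>\<^bsub>?T\<^esub>l\<in>UNIV. ?p l q)"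
      by (rule T.finsum_swap) (simp_all add: A_BC.pure_closed BC.pure_closed)
    also have "\<dots> = ?r (BB_comult E F H (BB_gen E H i j))"
      by (simp add: gens linear_map_finsum[OF A_FH.tensor_assoc_algebra A_BC.tensor_assoc_algebra
            algebra_homsD(1)[OF r]] A_FH.pure_closed tensor_map_pure[OF A FH A BCa linear_maps_id lin(4)]
          linear_map_finsum[OF BCa A_BC.tensor_assoc_algebra A_BC.pure_linear_right] BC.pure_closed)
    finally show ?thesis .
  qed
  then show ?thesis
    by (rule BB_hom_ext[OF algebra_homs_comp[OF l homs(2)] algebra_homs_comp[OF r homs(3)] _ x])
qed

lemma (in assoc_algebra) sum_kronecker:
  assumes "\<And>l. f l \<in> carrier A"
  shows "(\<Oplus>\<^bsub>A\<^esub>l\<in>UNIV. (if i = l then 1 else 0) \<odot>\<^bsub>A\<^esub> f l) = f (i :: 'i::finite)"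
    and "(\<Oplus>\<^bsub>A\<^esub>l\<in>UNIV. (if l = i then 1 else 0) \<odot>\<^bsub>A\<^esub> f l) = f i"
proof -
  have "(\<Oplus>\<^bsub>A\<^esub>l\<in>UNIV. (if i = l then 1 else 0) \<odot>\<^bsub>A\<^esub> f l) = (\<Oplus>\<^bsub>A\<^esub>l\<in>UNIV. if i = l then f l else \<zero>\<^bsub>A\<^esub>)"
    using assms by (intro A.finsum_cong') auto
  also have "\<dots> = f i"
    using assms by (intro A.finsum_singleton) auto
  finally show *: "(\<Oplus>\<^bsub>A\<^esub>l\<in>UNIV. (if i = l then 1 else 0) \<odot>\<^bsub>A\<^esub> f l) = f i" .
  then show "(\<Oplus>\<^bsub>A\<^esub>l\<in>UNIV. (if l = i then 1 else 0) \<odot>\<^bsub>A\<^esub> f l) = f i"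
    by (simp add: eq_commute)
qed

lemma BB_counit_left:
  assumes E: "invertible E" and x: "x \<in> carrier (BB_algebra E F)"
  shows "tensor_lift (BB_algebra E F) (\<lambda>(y, z). BB_counit E y \<odot>\<^bsub>BB_algebra E F\<^esub> z) (BB_comult E E F x) = x"
proof -
  let ?A = "BB_algebra E E" and ?Z = "BB_algebra E F"
  have A: "assoc_algebra ?A" and Z: "assoc_algebra ?Z" by (rule BB_algebra_assoc)+
  interpret tensor_product ?A ?Z by (rule tensor_productI[OF A Z])
  note hom = counit_lift_left_hom[OF A Z BB_counit_hom[OF E]]
  have gen: "tensor_lift ?Z (\<lambda>(y, z). BB_counit E y \<odot>\<^bsub>?Z\<^esub> z) (BB_comult E E F (BB_gen E F i j)) = id (BB_gen E F i j)" for i j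
    by (simp add: BB_comult_gen[OF E] BB_gen_closed pure_closed BB_counit_gen[OF E]
        linear_map_finsum[OF tensor_assoc_algebra Z algebra_homsD(1)[OF hom]]
        counit_lift_left_pure[OF A Z BB_counit_hom[OF E]] B.sum_kronecker)
  show ?thesis
    using BB_hom_ext[OF algebra_homs_comp[OF hom BB_comult_hom[OF E]] algebra_homs_id gen x] by simp
qed

lemma BB_counit_right:
  assumes F: "invertible F" and x: "x \<in> carrier (BB_algebra E F)"
  shows "tensor_lift (BB_algebra E F) (\<lambda>(y, z). BB_counit F z \<odot>\<^bsub>BB_algebra E F\<^esub> y) (BB_comult E F F x) = x"
proof -
  let ?B = "BB_algebra F F" and ?Z = "BB_algebra E F"
  have B: "assoc_algebra ?B" and Z: "assoc_algebra ?Z" by (rule BB_algebra_assoc)+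
  interpret tensor_product ?Z ?B by (rule tensor_productI[OF Z B])
  note hom = counit_lift_right_hom[OF Z B BB_counit_hom[OF F]]
  have gen: "tensor_lift ?Z (\<lambda>(y, z). BB_counit F z \<odot>\<^bsub>?Z\<^esub> y) (BB_comult E F F (BB_gen E F i j)) = id (BB_gen E F i j)" for i j
    by (simp add: BB_comult_gen[OF F] BB_gen_closed pure_closed BB_counit_gen[OF F]
        linear_map_finsum[OF tensor_assoc_algebra Z algebra_homsD(1)[OF hom]]
        counit_lift_right_pure[OF Z B BB_counit_hom[OF F]] A.sum_kronecker)
  show ?thesis
    using BB_hom_ext[OF algebra_homs_comp[OF hom BB_comult_hom[OF F]] algebra_homs_id gen x] by simp
qed

text \<open>At \<open>t = \<Delta>(x)\<close>, with \<open>S\<close> an antipode, these are the left-hand sides of the antipode axioms.\<close>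

definition convolve_right ::
  "('k::field, 'a, 's) module_scheme \<Rightarrow> ('b \<Rightarrow> 'a) \<Rightarrow> ('a \<times> 'b \<Rightarrow>\<^sub>0 'k) set \<Rightarrow> 'a" where
  "convolve_right A S t = multiplication A (tensor_map A A id S t)"

definition convolve_left ::
  "('k::field, 'a, 's) module_scheme \<Rightarrow> ('b \<Rightarrow> 'a) \<Rightarrow> ('b \<times> 'a \<Rightarrow>\<^sub>0 'k) set \<Rightarrow> 'a" where
  "convolve_left A S t = multiplication A (tensor_map A A S id t)"

context
  fixes A :: "('k::field, 'a, 's) module_scheme" and B :: "('k, 'b, 't) module_scheme" and S
  assumes A: "assoc_algebra A" and B: "assoc_algebra B" and S: "S \<in> anti_homs B A"
begin

interpretation AB: tensor_product A B by (rule tensor_productI[OF A B])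
interpretation BA: tensor_product B A by (rule tensor_productI[OF B A])
interpretation TAB: assoc_algebra "tensor A B" by (rule AB.tensor_assoc_algebra)
interpretation TBA: assoc_algebra "tensor B A" by (rule BA.tensor_assoc_algebra)

lemma convolve_right_linear: "convolve_right A S \<in> linear_maps (tensor A B) A"
  unfolding convolve_right_def [abs_def]
  by (rule linear_maps_comp[OF multiplication_linear[OF A]
        tensor_map_linear[OF A B A A linear_maps_id anti_homsD(1)[OF S]]])

lemma convolve_left_linear: "convolve_left A S \<in> linear_maps (tensor B A) A"
  unfolding convolve_left_def [abs_def]
  by (rule linear_maps_comp[OF multiplication_linear[OF A]
        tensor_map_linear[OF B A A A anti_homsD(1)[OF S] linear_maps_id]])

lemma convolve_right_pure:
  "x \<in> carrier A \<Longrightarrow> y \<in> carrier B \<Longrightarrow> convolve_right A S (pure_tensor A B x y) = x \<otimes>\<^bsub>A\<^esub> S y"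
  by (simp add: convolve_right_def tensor_map_pure[OF A B A A linear_maps_id anti_homsD(1)[OF S]]
      multiplication_pure[OF A] anti_homsD[OF S])

lemma convolve_left_pure:
  "x \<in> carrier A \<Longrightarrow> y \<in> carrier B \<Longrightarrow> convolve_left A S (pure_tensor B A y x) = S y \<otimes>\<^bsub>A\<^esub> x"
  by (simp add: convolve_left_def tensor_map_pure[OF B A A A anti_homsD(1)[OF S] linear_maps_id]
      multiplication_pure[OF A] anti_homsD[OF S])

text \<open>Because \<open>S\<close> reverses products, \<open>(p \<otimes> q) u\<close> is sent to \<open>p c S(q)\<close> with \<open>c\<close> the value at \<open>u\<close>, which can be
  pulled out if it is a scalar. This is what makes the antipode axiom, whose left-hand side
  is not multiplicative, pass from two elements to their product.\<close>

lemma convolve_right_mult: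
  assumes t: "t \<in> carrier (tensor A B)" and u: "u \<in> carrier (tensor A B)"
    and scalar: "convolve_right A S u = c \<odot>\<^bsub>A\<^esub> \<one>\<^bsub>A\<^esub>"
  shows "convolve_right A S (t \<otimes>\<^bsub>tensor A B\<^esub> u) = c \<odot>\<^bsub>A\<^esub> convolve_right A S t"
  using t
proof (induction rule: AB.tensor_induct)
  case (pure x y)
  have "convolve_right A S (pure_tensor A B x y \<otimes>\<^bsub>tensor A B\<^esub> u) = x \<otimes>\<^bsub>A\<^esub> convolve_right A S u \<otimes>\<^bsub>A\<^esub> S y"
    using u
  proof (induction rule: AB.tensor_induct)
    case (pure x' y')
    with \<open>x \<in> carrier A\<close> \<open>y \<in> carrier B\<close> show ?case
      by (simp add: AB.pure_mult convolve_right_pure anti_homsD[OF S] AB.A.A.m_assoc)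
  next
    case (add s t)
    with pure show ?case
      by (simp add: AB.pure_closed TAB.A.r_distr linear_mapsD[OF convolve_right_linear]
          AB.A.A.r_distr AB.A.A.l_distr anti_homsD[OF S])
  qed
  with pure scalar show ?case
    by (simp add: convolve_right_pure anti_homsD[OF S] AB.A.smult_mult_left AB.A.smult_mult_right)
next
  case (add s t)
  with u show ?case
    by (simp add: TAB.A.l_distr linear_mapsD[OF convolve_right_linear] AB.A.smult_add_right)
qed

text \<open>Here the value at the left factor \<open>t\<close> ends up in the middle, so that one has to be a scalar.\<close>

lemma convolve_left_mult:
  assumes t: "t \<in> carrier (tensor B A)" and u: "u \<in> carrier (tensor B A)"
    and scalar: "convolve_left A S t = c \<odot>\<^bsub>A\<^esub> \<one>\<^bsub>A\<^esub>"
  shows "convolve_left A S (t \<otimes>\<^bsub>tensor B A\<^esub> u) = c \<odot>\<^bsub>A\<^esub> convolve_left A S u"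
  using u
proof (induction rule: BA.tensor_induct)
  case (pure y x)
  have "convolve_left A S (t \<otimes>\<^bsub>tensor B A\<^esub> pure_tensor B A y x) = S y \<otimes>\<^bsub>A\<^esub> convolve_left A S t \<otimes>\<^bsub>A\<^esub> x"
    using t
  proof (induction rule: BA.tensor_induct)
    case (pure y' x')
    with \<open>x \<in> carrier A\<close> \<open>y \<in> carrier B\<close> show ?case
      by (simp add: BA.pure_mult convolve_left_pure anti_homsD[OF S] AB.A.A.m_assoc)
  next
    case (add s t)
    with pure show ?case
      by (simp add: BA.pure_closed TBA.A.l_distr linear_mapsD[OF convolve_left_linear]
          AB.A.A.r_distr AB.A.A.l_distr anti_homsD[OF S])
  qed
  with pure scalar show ?case
    by (simp add: convolve_left_pure anti_homsD[OF S] AB.A.smult_mult_left AB.A.smult_mult_right)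
next
  case (add s u)
  with t show ?case
    by (simp add: TBA.A.r_distr linear_mapsD[OF convolve_left_linear] AB.A.smult_add_right)
qed

end

text \<open>On generators this is the relation \<open>z z\<^sup>* = 1\<close> of \<open>\<B>(E,F)\<close>, entry by entry.\<close>

lemma BB_antipode_right:
  assumes E: "invertible E" and F: "invertible F" and x: "x \<in> carrier (BB_algebra E E)"
  shows "convolve_right (BB_algebra E F) (BB_antipode F E) (BB_comult E F E x)
    = BB_counit E x \<odot>\<^bsub>BB_algebra E F\<^esub> \<one>\<^bsub>BB_algebra E F\<^esub>"
proof -
  let ?A = "BB_algebra E F" and ?B = "BB_algebra F E"
  have A: "assoc_algebra ?A" and B: "assoc_algebra ?B" by (rule BB_algebra_assoc)+
  note S = BB_antipode_hom[OF F E]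
  interpret tensor_product ?A ?B by (rule tensor_productI[OF A B])
  interpret T: assoc_algebra "tensor ?A ?B" by (rule tensor_assoc_algebra)
  note \<Delta> = algebra_homsD[OF BB_comult_hom[OF F, of E E]]
    linear_mapsD(2,3)[OF algebra_homsD(1)[OF BB_comult_hom[OF F, of E E]]]
  note \<epsilon> = algebra_homsD(2-)[OF BB_counit_hom[OF E], simplified]
    linear_mapsD(2,3)[OF algebra_homsD(1)[OF BB_counit_hom[OF E]], simplified]
  note lin = convolve_right_linear[OF A B S]
  show ?thesis
    using x
  proof (induction rule: BB_algebra_induct)
    case one
    show ?case
      by (simp add: \<Delta> \<epsilon> pure_one convolve_right_pure[OF A B S] anti_homsD[OF S])
  next
    case (generator i j)
    have "convolve_right ?A (BB_antipode F E) (BB_comult E F E (BB_gen E E i j))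
        = mat_mult ?A (BB_gen E F) (twisted_transpose ?A E F (BB_gen E F)) i j"
      by (simp add: BB_comult_gen[OF F] linear_map_finsum[OF tensor_assoc_algebra A lin]
          pure_closed BB_gen_closed convolve_right_pure[OF A B S] BB_antipode_gen[OF F E] mat_mult_def)
    also have "\<dots> = mat_one ?A i j"
      using BB_gen_point[of E F] by (simp add: BB_point_def)
    also have "\<dots> = BB_counit E (BB_gen E E i j) \<odot>\<^bsub>?A\<^esub> \<one>\<^bsub>?A\<^esub>"
      by (simp add: BB_counit_gen[OF E] mat_one_def)
    finally show ?case .
  next
    case (add s t)
    then show ?case by (simp add: \<Delta> \<epsilon> linear_mapsD[OF lin] A.smult_add_left)
  next
    case (mult s t)
    then show ?case
      by (simp add: \<Delta> \<epsilon> convolve_right_mult[OF A B S] A.smult_smult mult.commute)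
  next
    case (smult c t)
    then show ?case by (simp add: \<Delta> \<epsilon> linear_mapsD[OF lin] A.smult_smult)
  qed
qed

text \<open>On generators this is the relation \<open>z\<^sup>* z = 1\<close> of \<open>\<B>(F,E)\<close>.\<close>

lemma BB_antipode_left:
  assumes E: "invertible E" and F: "invertible F" and x: "x \<in> carrier (BB_algebra E E)"
  shows "convolve_left (BB_algebra F E) (BB_antipode E F) (BB_comult E F E x)
    = BB_counit E x \<odot>\<^bsub>BB_algebra F E\<^esub> \<one>\<^bsub>BB_algebra F E\<^esub>"
proof -
  let ?A = "BB_algebra F E" and ?B = "BB_algebra E F"
  have A: "assoc_algebra ?A" and B: "assoc_algebra ?B" by (rule BB_algebra_assoc)+
  note S = BB_antipode_hom[OF E F]
  interpret tensor_product ?B ?A by (rule tensor_productI[OF B A])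
  interpret T: assoc_algebra "tensor ?B ?A" by (rule tensor_assoc_algebra)
  note \<Delta> = algebra_homsD[OF BB_comult_hom[OF F, of E E]]
    linear_mapsD(2,3)[OF algebra_homsD(1)[OF BB_comult_hom[OF F, of E E]]]
  note \<epsilon> = algebra_homsD(2-)[OF BB_counit_hom[OF E], simplified]
    linear_mapsD(2,3)[OF algebra_homsD(1)[OF BB_counit_hom[OF E]], simplified]
  note lin = convolve_left_linear[OF A B S]
  show ?thesis
    using x
  proof (induction rule: BB_algebra_induct)
    case one
    show ?case
      by (simp add: \<Delta> \<epsilon> pure_one convolve_left_pure[OF A B S] anti_homsD[OF S])
  next
    case (generator i j)
    have "convolve_left ?A (BB_antipode E F) (BB_comult E F E (BB_gen E E i j))
        = mat_mult ?A (twisted_transpose ?A F E (BB_gen F E)) (BB_gen F E) i j"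
      by (simp add: BB_comult_gen[OF F] linear_map_finsum[OF tensor_assoc_algebra A lin]
          pure_closed BB_gen_closed convolve_left_pure[OF A B S] BB_antipode_gen[OF E F] mat_mult_def)
    also have "\<dots> = mat_one ?A i j"
      using BB_gen_point[of F E] by (simp add: BB_point_def)
    also have "\<dots> = BB_counit E (BB_gen E E i j) \<odot>\<^bsub>?A\<^esub> \<one>\<^bsub>?A\<^esub>"
      by (simp add: BB_counit_gen[OF E] mat_one_def)
    finally show ?case .
  next
    case (add s t)
    then show ?case by (simp add: \<Delta> \<epsilon> linear_mapsD[OF lin] B.smult_add_left)
  next
    case (mult s t)
    then show ?case
      by (simp add: \<Delta> \<epsilon> convolve_left_mult[OF A B S] B.smult_smult)
  next
    case (smult c t)
    then show ?case by (simp add: \<Delta> \<epsilon> linear_mapsD[OF lin] B.smult_smult)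
  qed
qed


section \<open>Galois maps of arbitrary linear maps\<close>

text \<open>The shape of \<open>\<kappa>\<^sub>l\<close> and \<open>\<kappa>\<^sub>r\<close> with an arbitrary linear map \<open>\<gamma>\<close> in place of the coaction. The
  inverses have the same shape, with a different \<open>\<gamma>\<close>, and this makes the two directions of
  bijectivity instances of one statement.\<close>

definition galois_left ::
  "('k::field, 'p, 's) module_scheme \<Rightarrow> ('k, 'z, 't) module_scheme \<Rightarrow>
   ('a \<Rightarrow> ('p \<times> 'z \<Rightarrow>\<^sub>0 'k) set) \<Rightarrow> ('a \<times> 'z \<Rightarrow>\<^sub>0 'k) set \<Rightarrow> ('p \<times> 'z \<Rightarrow>\<^sub>0 'k) set" where
  "galois_left P Z \<gamma> =
     tensor_map P Z id (multiplication Z) \<circ> tensor_assoc P Z Z \<circ> tensor_map (tensor P Z) Z \<gamma> id"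

definition galois_right ::
  "('k::field, 'p, 's) module_scheme \<Rightarrow> ('k, 'z, 't) module_scheme \<Rightarrow>
   ('a \<Rightarrow> ('z \<times> 'p \<Rightarrow>\<^sub>0 'k) set) \<Rightarrow> ('z \<times> 'a \<Rightarrow>\<^sub>0 'k) set \<Rightarrow> ('z \<times> 'p \<Rightarrow>\<^sub>0 'k) set" where
  "galois_right P Z \<gamma> =
     tensor_map Z P (multiplication Z) id \<circ> tensor_assoc_inv Z Z P \<circ> tensor_map Z (tensor Z P) id \<gamma>"

context
  fixes A :: "('k::field, 'a, 's) module_scheme" and P :: "('k, 'p, 't) module_scheme"
    and Z :: "('k, 'z, 'u) module_scheme"
  assumes A: "assoc_algebra A" and P: "assoc_algebra P" and Z: "assoc_algebra Z"
begin

interpretation AZ: tensor_product A Z by (rule tensor_productI[OF A Z])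
interpretation PZ: tensor_product P Z by (rule tensor_productI[OF P Z])
interpretation ZA: tensor_product Z A by (rule tensor_productI[OF Z A])
interpretation ZP: tensor_product Z P by (rule tensor_productI[OF Z P])
interpretation ZZ: tensor_product Z Z by (rule tensor_productI[OF Z Z])
interpretation PZ_Z: tensor_product "tensor P Z" Z by (rule tensor_productI[OF PZ.tensor_assoc_algebra Z])
interpretation Z_ZP: tensor_product Z "tensor Z P" by (rule tensor_productI[OF Z ZP.tensor_assoc_algebra])
interpretation TAZ: assoc_algebra "tensor A Z" by (rule AZ.tensor_assoc_algebra)
interpretation TZA: assoc_algebra "tensor Z A" by (rule ZA.tensor_assoc_algebra)

lemma galois_left_linear:
  assumes "\<gamma> \<in> linear_maps A (tensor P Z)"
  shows "galois_left P Z \<gamma> \<in> linear_maps (tensor A Z) (tensor P Z)"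
  unfolding galois_left_def comp_def
  by (rule linear_maps_comp[OF _ linear_maps_comp[OF tensor_assoc_linear[OF P Z Z]
        tensor_map_linear[OF A Z PZ.tensor_assoc_algebra Z assms linear_maps_id]]])
    (rule tensor_map_linear[OF P ZZ.tensor_assoc_algebra P Z linear_maps_id multiplication_linear[OF Z]])

lemma galois_right_linear:
  assumes "\<gamma> \<in> linear_maps A (tensor Z P)"
  shows "galois_right P Z \<gamma> \<in> linear_maps (tensor Z A) (tensor Z P)"
  unfolding galois_right_def comp_def
  by (rule linear_maps_comp[OF _ linear_maps_comp[OF tensor_assoc_inv_linear[OF Z Z P]
        tensor_map_linear[OF Z A Z ZP.tensor_assoc_algebra linear_maps_id assms]]])
    (rule tensor_map_linear[OF ZZ.tensor_assoc_algebra P Z P multiplication_linear[OF Z] linear_maps_id])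

lemma galois_left_pure:
  assumes \<gamma>: "\<gamma> \<in> linear_maps A (tensor P Z)" and x: "x \<in> carrier A" and y: "y \<in> carrier Z"
  shows "galois_left P Z \<gamma> (pure_tensor A Z x y) = \<gamma> x \<otimes>\<^bsub>tensor P Z\<^esub> pure_tensor P Z \<one>\<^bsub>P\<^esub> y"
proof -
  let ?h = "\<lambda>s. tensor_map P Z id (multiplication Z) (tensor_assoc P Z Z (pure_tensor (tensor P Z) Z s y))"
  have lin: "?h \<in> linear_maps (tensor P Z) (tensor P Z)"
    by (rule linear_maps_comp[OF tensor_map_linear[OF P ZZ.tensor_assoc_algebra P Z linear_maps_id
            multiplication_linear[OF Z]]
          linear_maps_comp[OF tensor_assoc_linear[OF P Z Z] PZ_Z.pure_linear_left[OF y]]])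
  have "?h s = s \<otimes>\<^bsub>tensor P Z\<^esub> pure_tensor P Z \<one>\<^bsub>P\<^esub> y" if "s \<in> carrier (tensor P Z)" for s
  proof (rule PZ.tensor_linear_ext[OF lin PZ_Z.A.mult_linear(1)])
    fix p z assume pz: "p \<in> carrier P" "z \<in> carrier Z"
    show "?h (pure_tensor P Z p z) = pure_tensor P Z p z \<otimes>\<^bsub>tensor P Z\<^esub> pure_tensor P Z \<one>\<^bsub>P\<^esub> y"
      unfolding tensor_assoc_pure[OF P Z Z pz y]
        tensor_map_pure[OF P ZZ.tensor_assoc_algebra P Z linear_maps_id multiplication_linear[OF Z]
          pz(1) ZZ.pure_closed[OF pz(2) y]]
      using pz y by (simp add: multiplication_pure[OF Z] PZ.pure_mult)
  qed (use that y in \<open>simp_all add: PZ.pure_closed\<close>)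
  then show ?thesis
    using x y linear_mapsD(1)[OF \<gamma> x]
    by (simp add: galois_left_def tensor_map_pure[OF A Z PZ.tensor_assoc_algebra Z \<gamma> linear_maps_id])
qed

lemma galois_right_pure:
  assumes \<gamma>: "\<gamma> \<in> linear_maps A (tensor Z P)" and x: "x \<in> carrier A" and y: "y \<in> carrier Z"
  shows "galois_right P Z \<gamma> (pure_tensor Z A y x) = pure_tensor Z P y \<one>\<^bsub>P\<^esub> \<otimes>\<^bsub>tensor Z P\<^esub> \<gamma> x"
proof -
  let ?h = "\<lambda>s. tensor_map Z P (multiplication Z) id (tensor_assoc_inv Z Z P (pure_tensor Z (tensor Z P) y s))"
  have lin: "?h \<in> linear_maps (tensor Z P) (tensor Z P)"
    by (rule linear_maps_comp[OF tensor_map_linear[OF ZZ.tensor_assoc_algebra P Z P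
            multiplication_linear[OF Z] linear_maps_id]
          linear_maps_comp[OF tensor_assoc_inv_linear[OF Z Z P] Z_ZP.pure_linear_right[OF y]]])
  have "?h s = pure_tensor Z P y \<one>\<^bsub>P\<^esub> \<otimes>\<^bsub>tensor Z P\<^esub> s" if "s \<in> carrier (tensor Z P)" for s
  proof (rule ZP.tensor_linear_ext[OF lin Z_ZP.B.mult_linear(2)])
    fix z p assume zp: "z \<in> carrier Z" "p \<in> carrier P"
    show "?h (pure_tensor Z P z p) = pure_tensor Z P y \<one>\<^bsub>P\<^esub> \<otimes>\<^bsub>tensor Z P\<^esub> pure_tensor Z P z p"
      unfolding tensor_assoc_inv_pure[OF Z Z P y zp]
        tensor_map_pure[OF ZZ.tensor_assoc_algebra P Z P multiplication_linear[OF Z] linear_maps_id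
          ZZ.pure_closed[OF y zp(1)] zp(2)]
      using zp y by (simp add: multiplication_pure[OF Z] ZP.pure_mult)
  qed (use that y in \<open>simp_all add: ZP.pure_closed\<close>)
  then show ?thesis
    using x y linear_mapsD(1)[OF \<gamma> x]
    by (simp add: galois_right_def tensor_map_pure[OF Z A Z ZP.tensor_assoc_algebra linear_maps_id \<gamma>])
qed

text \<open>Galois maps are equivariant under multiplication by \<open>Z\<close> on the side not touched by \<open>\<gamma>\<close>; hence a
  composite of two of them is determined by its values on \<open>x \<otimes> 1\<close>.\<close>

lemma galois_left_translate:
  assumes \<gamma>: "\<gamma> \<in> linear_maps A (tensor P Z)" and y: "y \<in> carrier Z" and t: "t \<in> carrier (tensor A Z)"
  shows "galois_left P Z \<gamma> (t \<otimes>\<^bsub>tensor A Z\<^esub> pure_tensor A Z \<one>\<^bsub>A\<^esub> y)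
    = galois_left P Z \<gamma> t \<otimes>\<^bsub>tensor P Z\<^esub> pure_tensor P Z \<one>\<^bsub>P\<^esub> y"
  using t
proof (induction rule: AZ.tensor_induct)
  case (pure x z)
  then show ?case
    using y linear_mapsD(1)[OF \<gamma>]
    by (simp add: AZ.pure_mult galois_left_pure[OF \<gamma>] PZ_Z.A.A.m_assoc PZ.pure_closed PZ.pure_mult)
next
  case (add s t)
  then show ?case
    using y by (simp add: TAZ.A.l_distr PZ_Z.A.A.l_distr linear_mapsD[OF galois_left_linear[OF \<gamma>]]
        AZ.pure_closed PZ.pure_closed)
qed

lemma galois_right_translate:
  assumes \<gamma>: "\<gamma> \<in> linear_maps A (tensor Z P)" and y: "y \<in> carrier Z" and t: "t \<in> carrier (tensor Z A)"
  shows "galois_right P Z \<gamma> (pure_tensor Z A y \<one>\<^bsub>A\<^esub> \<otimes>\<^bsub>tensor Z A\<^esub> t)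
    = pure_tensor Z P y \<one>\<^bsub>P\<^esub> \<otimes>\<^bsub>tensor Z P\<^esub> galois_right P Z \<gamma> t"
  using t
proof (induction rule: ZA.tensor_induct)
  case (pure z x)
  then show ?case
    using y linear_mapsD(1)[OF \<gamma>]
    by (simp add: ZA.pure_mult galois_right_pure[OF \<gamma>] Z_ZP.B.A.m_assoc[symmetric] ZP.pure_closed ZP.pure_mult)
next
  case (add s t)
  then show ?case
    using y by (simp add: TZA.A.r_distr Z_ZP.B.A.r_distr linear_mapsD[OF galois_right_linear[OF \<gamma>]]
        ZA.pure_closed ZP.pure_closed)
qed

end

lemma galois_left_cancel:
  assumes A: "assoc_algebra A" and P: "assoc_algebra P" and Z: "assoc_algebra Z"
    and \<gamma>: "\<gamma> \<in> linear_maps A (tensor P Z)" and \<delta>: "\<delta> \<in> linear_maps P (tensor A Z)"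
    and \<delta>\<gamma>: "\<And>x. x \<in> carrier A \<Longrightarrow> galois_left A Z \<delta> (\<gamma> x) = pure_tensor A Z x \<one>\<^bsub>Z\<^esub>"
    and t: "t \<in> carrier (tensor A Z)"
  shows "galois_left A Z \<delta> (galois_left P Z \<gamma> t) = t"
proof -
  interpret AZ: tensor_product A Z by (rule tensor_productI[OF A Z])
  note \<gamma>' = galois_left_linear[OF A P Z \<gamma>] and \<delta>' = galois_left_linear[OF P A Z \<delta>]
  show ?thesis
    using t
  proof (induction rule: AZ.tensor_induct)
    case (pure x y)
    then show ?case
      by (simp add: galois_left_pure[OF A P Z \<gamma>] galois_left_translate[OF P A Z \<delta>]
          linear_mapsD(1)[OF \<gamma>] \<delta>\<gamma> AZ.pure_mult)
  next
    case (add s t)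
    then show ?case
      by (simp add: linear_mapsD[OF \<gamma>'] linear_mapsD[OF \<delta>'])
  qed
qed

lemma galois_right_cancel:
  assumes A: "assoc_algebra A" and P: "assoc_algebra P" and Z: "assoc_algebra Z"
    and \<gamma>: "\<gamma> \<in> linear_maps A (tensor Z P)" and \<delta>: "\<delta> \<in> linear_maps P (tensor Z A)"
    and \<delta>\<gamma>: "\<And>x. x \<in> carrier A \<Longrightarrow> galois_right A Z \<delta> (\<gamma> x) = pure_tensor Z A \<one>\<^bsub>Z\<^esub> x"
    and t: "t \<in> carrier (tensor Z A)"
  shows "galois_right A Z \<delta> (galois_right P Z \<gamma> t) = t"
proof -
  interpret ZA: tensor_product Z A by (rule tensor_productI[OF Z A])
  note \<gamma>' = galois_right_linear[OF A P Z \<gamma>] and \<delta>' = galois_right_linear[OF P A Z \<delta>]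
  show ?thesis
    using t
  proof (induction rule: ZA.tensor_induct)
    case (pure y x)
    then show ?case
      by (simp add: galois_right_pure[OF A P Z \<gamma>] galois_right_translate[OF P A Z \<delta>]
          linear_mapsD(1)[OF \<gamma>] \<delta>\<gamma> ZA.pure_mult)
  next
    case (add s t)
    then show ?case
      by (simp add: linear_mapsD[OF \<gamma>'] linear_mapsD[OF \<delta>'])
  qed
qed

lemma galois_left_bij:
  assumes A: "assoc_algebra A" and P: "assoc_algebra P" and Z: "assoc_algebra Z"
    and \<gamma>: "\<gamma> \<in> linear_maps A (tensor P Z)" and \<delta>: "\<delta> \<in> linear_maps P (tensor A Z)"
    and "\<And>x. x \<in> carrier A \<Longrightarrow> galois_left A Z \<delta> (\<gamma> x) = pure_tensor A Z x \<one>\<^bsub>Z\<^esub>"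
    and "\<And>x. x \<in> carrier P \<Longrightarrow> galois_left P Z \<gamma> (\<delta> x) = pure_tensor P Z x \<one>\<^bsub>Z\<^esub>"
  shows "bij_betw (galois_left P Z \<gamma>) (carrier (tensor A Z)) (carrier (tensor P Z))"
proof (rule bij_betw_byWitness)
  show "\<forall>t\<in>carrier (tensor A Z). galois_left A Z \<delta> (galois_left P Z \<gamma> t) = t"
    using galois_left_cancel[OF A P Z \<gamma> \<delta> assms(6)] by blast
  show "\<forall>t\<in>carrier (tensor P Z). galois_left P Z \<gamma> (galois_left A Z \<delta> t) = t"
    using galois_left_cancel[OF P A Z \<delta> \<gamma> assms(7)] by blast
qed (auto simp: linear_mapsD[OF galois_left_linear[OF A P Z \<gamma>]] linear_mapsD[OF galois_left_linear[OF P A Z \<delta>]])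

lemma galois_right_bij:
  assumes A: "assoc_algebra A" and P: "assoc_algebra P" and Z: "assoc_algebra Z"
    and \<gamma>: "\<gamma> \<in> linear_maps A (tensor Z P)" and \<delta>: "\<delta> \<in> linear_maps P (tensor Z A)"
    and "\<And>x. x \<in> carrier A \<Longrightarrow> galois_right A Z \<delta> (\<gamma> x) = pure_tensor Z A \<one>\<^bsub>Z\<^esub> x"
    and "\<And>x. x \<in> carrier P \<Longrightarrow> galois_right P Z \<gamma> (\<delta> x) = pure_tensor Z P \<one>\<^bsub>Z\<^esub> x"
  shows "bij_betw (galois_right P Z \<gamma>) (carrier (tensor Z A)) (carrier (tensor Z P))"
proof (rule bij_betw_byWitness)
  show "\<forall>t\<in>carrier (tensor Z A). galois_right A Z \<delta> (galois_right P Z \<gamma> t) = t"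
    using galois_right_cancel[OF A P Z \<gamma> \<delta> assms(6)] by blast
  show "\<forall>t\<in>carrier (tensor Z P). galois_right P Z \<gamma> (galois_right A Z \<delta> t) = t"
    using galois_right_cancel[OF P A Z \<delta> \<gamma> assms(7)] by blast
qed (auto simp: linear_mapsD[OF galois_right_linear[OF A P Z \<gamma>]] linear_mapsD[OF galois_right_linear[OF P A Z \<delta>]])

text \<open>The end of each inversion argument: after coassociativity one tensor factor carries the left-hand
  side \<open>N \<circ> D\<close> of an antipode axiom, which becomes a scalar and can be moved across the tensor sign,
  where the counit axiom applies.\<close>

lemma collapse_right:
  assumes P: "assoc_algebra P" and C: "assoc_algebra C" and U: "assoc_algebra U" and Z: "assoc_algebra Z"
    and D: "D \<in> linear_maps C U" and N: "N \<in> linear_maps U Z"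
    and \<epsilon>: "\<epsilon> \<in> algebra_homs C field_algebra"
    and ND: "\<And>c. c \<in> carrier C \<Longrightarrow> N (D c) = \<epsilon> c \<odot>\<^bsub>Z\<^esub> \<one>\<^bsub>Z\<^esub>"
    and s: "s \<in> carrier (tensor P C)"
  shows "tensor_map P Z id N (tensor_map P U id D s)
    = pure_tensor P Z (tensor_lift P (\<lambda>(x, y). \<epsilon> y \<odot>\<^bsub>P\<^esub> x) s) \<one>\<^bsub>Z\<^esub>"
proof -
  interpret PC: tensor_product P C by (rule tensor_productI[OF P C])
  interpret PZ: tensor_product P Z by (rule tensor_productI[OF P Z])
  have l: "(\<lambda>s. tensor_map P Z id N (tensor_map P U id D s)) \<in> linear_maps (tensor P C) (tensor P Z)"
    by (rule linear_maps_comp[OF tensor_map_linear[OF P U P Z linear_maps_id N]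
          tensor_map_linear[OF P C P U linear_maps_id D]])
  have r: "(\<lambda>s. pure_tensor P Z (tensor_lift P (\<lambda>(x, y). \<epsilon> y \<odot>\<^bsub>P\<^esub> x) s) \<one>\<^bsub>Z\<^esub>)
      \<in> linear_maps (tensor P C) (tensor P Z)"
    by (rule linear_maps_comp[OF PZ.pure_linear_left algebra_homsD(1)[OF counit_lift_right_hom[OF P C \<epsilon>]]]) simp
  show ?thesis
    by (rule PC.tensor_linear_ext[OF l r _ s])
      (simp add: tensor_map_pure[OF P C P U linear_maps_id D] tensor_map_pure[OF P U P Z linear_maps_id N]
        linear_mapsD(1)[OF D] ND counit_lift_right_pure[OF P C \<epsilon>] PZ.pure_smult_left PZ.pure_smult_right)
qed

lemma collapse_left:
  assumes P: "assoc_algebra P" and C: "assoc_algebra C" and U: "assoc_algebra U" and Z: "assoc_algebra Z"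
    and D: "D \<in> linear_maps C U" and N: "N \<in> linear_maps U Z"
    and \<epsilon>: "\<epsilon> \<in> algebra_homs C field_algebra"
    and ND: "\<And>c. c \<in> carrier C \<Longrightarrow> N (D c) = \<epsilon> c \<odot>\<^bsub>Z\<^esub> \<one>\<^bsub>Z\<^esub>"
    and s: "s \<in> carrier (tensor C P)"
  shows "tensor_map Z P N id (tensor_map U P D id s)
    = pure_tensor Z P \<one>\<^bsub>Z\<^esub> (tensor_lift P (\<lambda>(x, y). \<epsilon> x \<odot>\<^bsub>P\<^esub> y) s)"
proof -
  interpret CP: tensor_product C P by (rule tensor_productI[OF C P])
  interpret ZP: tensor_product Z P by (rule tensor_productI[OF Z P])
  have l: "(\<lambda>s. tensor_map Z P N id (tensor_map U P D id s)) \<in> linear_maps (tensor C P) (tensor Z P)"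
    by (rule linear_maps_comp[OF tensor_map_linear[OF U P Z P N linear_maps_id]
          tensor_map_linear[OF C P U P D linear_maps_id]])
  have r: "(\<lambda>s. pure_tensor Z P \<one>\<^bsub>Z\<^esub> (tensor_lift P (\<lambda>(x, y). \<epsilon> x \<odot>\<^bsub>P\<^esub> y) s))
      \<in> linear_maps (tensor C P) (tensor Z P)"
    by (rule linear_maps_comp[OF ZP.pure_linear_right algebra_homsD(1)[OF counit_lift_left_hom[OF C P \<epsilon>]]]) simp
  show ?thesis
    by (rule CP.tensor_linear_ext[OF l r _ s])
      (simp add: tensor_map_pure[OF C P U P D linear_maps_id] tensor_map_pure[OF U P Z P N linear_maps_id]
        linear_mapsD(1)[OF D] ND counit_lift_left_pure[OF C P \<epsilon>] ZP.pure_smult_left ZP.pure_smult_right)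
qed


context
  fixes P :: "('k::field, 'p, 's) module_scheme" and Y :: "('k, 'y, 't) module_scheme"
    and Z :: "('k, 'z, 'u) module_scheme" and S :: "'y \<Rightarrow> 'z"
  assumes P: "assoc_algebra P" and Y: "assoc_algebra Y" and Z: "assoc_algebra Z"
    and S: "S \<in> anti_homs Y Z"
begin

interpretation PY: tensor_product P Y by (rule tensor_productI[OF P Y])
interpretation YP: tensor_product Y P by (rule tensor_productI[OF Y P])
interpretation PZ: tensor_product P Z by (rule tensor_productI[OF P Z])
interpretation ZP: tensor_product Z P by (rule tensor_productI[OF Z P])
interpretation YZ: tensor_product Y Z by (rule tensor_productI[OF Y Z])
interpretation ZY: tensor_product Z Y by (rule tensor_productI[OF Z Y])
interpretation PY_Z: tensor_product "tensor P Y" Z by (rule tensor_productI[OF PY.tensor_assoc_algebra Z])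
interpretation PZ_Y: tensor_product "tensor P Z" Y by (rule tensor_productI[OF PZ.tensor_assoc_algebra Y])
interpretation Z_YP: tensor_product Z "tensor Y P" by (rule tensor_productI[OF Z YP.tensor_assoc_algebra])
interpretation Y_ZP: tensor_product Y "tensor Z P" by (rule tensor_productI[OF Y ZP.tensor_assoc_algebra])

text \<open>In Sweedler notation, the following four lemmas regroup \<open>(p \<otimes> S q) (1 \<otimes> r)\<close>, \<open>(p \<otimes> z) (1 \<otimes> S q)\<close> and their
  mirror images so that the antipode and its neighbour form one convolution.\<close>

lemma absorb_left_antipode:
  assumes r: "r \<in> carrier Z" and w: "w \<in> carrier (tensor P Y)"
  shows "tensor_map P Z id S w \<otimes>\<^bsub>tensor P Z\<^esub> pure_tensor P Z \<one>\<^bsub>P\<^esub> r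
    = tensor_map P Z id (convolve_left Z S) (tensor_assoc P Y Z (pure_tensor (tensor P Y) Z w r))"
proof -
  let ?h = "\<lambda>w. tensor_map P Z id (convolve_left Z S) (tensor_assoc P Y Z (pure_tensor (tensor P Y) Z w r))"
  let ?g = "\<lambda>w. tensor_map P Z id S w \<otimes>\<^bsub>tensor P Z\<^esub> pure_tensor P Z \<one>\<^bsub>P\<^esub> r"
  have lin: "?h \<in> linear_maps (tensor P Y) (tensor P Z)"
    by (rule linear_maps_comp[OF tensor_map_linear[OF P YZ.tensor_assoc_algebra P Z linear_maps_id convolve_left_linear[OF Z Y S]]
          linear_maps_comp[OF tensor_assoc_linear[OF P Y Z] PY_Z.pure_linear_left[OF r]]])
  note lin' = tensor_map_linear[OF P Y P Z linear_maps_id anti_homsD(1)[OF S]]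
  have "?h w = ?g w"
  proof (rule PY.tensor_linear_ext[OF lin])
    show "?g \<in> linear_maps (tensor P Y) (tensor P Z)"
      by (rule linear_maps_comp[OF PZ_Y.A.mult_linear(1) lin']) (simp add: PZ.pure_closed r)
  next
    fix p q assume pure: "p \<in> carrier P" "q \<in> carrier Y"
    show "?h (pure_tensor P Y p q) = ?g (pure_tensor P Y p q)"
      unfolding tensor_assoc_pure[OF P Y Z pure r] tensor_map_pure[OF P Y P Z linear_maps_id anti_homsD(1)[OF S] pure]
        tensor_map_pure[OF P YZ.tensor_assoc_algebra P Z linear_maps_id convolve_left_linear[OF Z Y S] pure(1)
          YZ.pure_closed[OF pure(2) r]]
      using r pure by (simp add: convolve_left_pure[OF Z Y S] PZ.pure_mult anti_homsD[OF S])
  qed (rule w)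
  then show ?thesis ..
qed

lemma absorb_right_antipode:
  assumes q: "q \<in> carrier Y" and v: "v \<in> carrier (tensor P Z)"
  shows "v \<otimes>\<^bsub>tensor P Z\<^esub> pure_tensor P Z \<one>\<^bsub>P\<^esub> (S q)
    = tensor_map P Z id (convolve_right Z S) (tensor_assoc P Z Y (pure_tensor (tensor P Z) Y v q))"
proof -
  let ?h = "\<lambda>v. tensor_map P Z id (convolve_right Z S) (tensor_assoc P Z Y (pure_tensor (tensor P Z) Y v q))"
  let ?g = "\<lambda>v. v \<otimes>\<^bsub>tensor P Z\<^esub> pure_tensor P Z \<one>\<^bsub>P\<^esub> (S q)"
  have lin: "?h \<in> linear_maps (tensor P Z) (tensor P Z)"
    by (rule linear_maps_comp[OF tensor_map_linear[OF P ZY.tensor_assoc_algebra P Z linear_maps_id convolve_right_linear[OF Z Y S]]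
          linear_maps_comp[OF tensor_assoc_linear[OF P Z Y] PZ_Y.pure_linear_left[OF q]]])
  have "?h v = ?g v"
  proof (rule PZ.tensor_linear_ext[OF lin])
    show "?g \<in> linear_maps (tensor P Z) (tensor P Z)"
      by (rule PZ_Y.A.mult_linear(1)) (simp add: PZ.pure_closed q anti_homsD[OF S])
  next
    fix p z assume pure: "p \<in> carrier P" "z \<in> carrier Z"
    show "?h (pure_tensor P Z p z) = ?g (pure_tensor P Z p z)"
      unfolding tensor_assoc_pure[OF P Z Y pure q]
        tensor_map_pure[OF P ZY.tensor_assoc_algebra P Z linear_maps_id convolve_right_linear[OF Z Y S] pure(1)
          ZY.pure_closed[OF pure(2) q]]
      using q pure by (simp add: convolve_right_pure[OF Z Y S] PZ.pure_mult anti_homsD[OF S])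
  qed (rule v)
  then show ?thesis ..
qed

lemma absorb_antipode_right:
  assumes r: "r \<in> carrier Z" and w: "w \<in> carrier (tensor Y P)"
  shows "pure_tensor Z P r \<one>\<^bsub>P\<^esub> \<otimes>\<^bsub>tensor Z P\<^esub> tensor_map Z P S id w
    = tensor_map Z P (convolve_right Z S) id (tensor_assoc_inv Z Y P (pure_tensor Z (tensor Y P) r w))"
proof -
  let ?h = "\<lambda>w. tensor_map Z P (convolve_right Z S) id (tensor_assoc_inv Z Y P (pure_tensor Z (tensor Y P) r w))"
  let ?g = "\<lambda>w. pure_tensor Z P r \<one>\<^bsub>P\<^esub> \<otimes>\<^bsub>tensor Z P\<^esub> tensor_map Z P S id w"
  have lin: "?h \<in> linear_maps (tensor Y P) (tensor Z P)"
    by (rule linear_maps_comp[OF tensor_map_linear[OF ZY.tensor_assoc_algebra P Z P convolve_right_linear[OF Z Y S] linear_maps_id]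
          linear_maps_comp[OF tensor_assoc_inv_linear[OF Z Y P] Z_YP.pure_linear_right[OF r]]])
  note lin' = tensor_map_linear[OF Y P Z P anti_homsD(1)[OF S] linear_maps_id]
  have "?h w = ?g w"
  proof (rule YP.tensor_linear_ext[OF lin])
    show "?g \<in> linear_maps (tensor Y P) (tensor Z P)"
      by (rule linear_maps_comp[OF Y_ZP.B.mult_linear(2) lin']) (simp add: ZP.pure_closed r)
  next
    fix q p assume pure: "q \<in> carrier Y" "p \<in> carrier P"
    show "?h (pure_tensor Y P q p) = ?g (pure_tensor Y P q p)"
      unfolding tensor_assoc_inv_pure[OF Z Y P r pure] tensor_map_pure[OF Y P Z P anti_homsD(1)[OF S] linear_maps_id pure]
        tensor_map_pure[OF ZY.tensor_assoc_algebra P Z P convolve_right_linear[OF Z Y S] linear_maps_id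
          ZY.pure_closed[OF r pure(1)] pure(2)]
      using r pure by (simp add: convolve_right_pure[OF Z Y S] ZP.pure_mult anti_homsD[OF S])
  qed (rule w)
  then show ?thesis ..
qed

lemma absorb_antipode_left:
  assumes q: "q \<in> carrier Y" and v: "v \<in> carrier (tensor Z P)"
  shows "pure_tensor Z P (S q) \<one>\<^bsub>P\<^esub> \<otimes>\<^bsub>tensor Z P\<^esub> v
    = tensor_map Z P (convolve_left Z S) id (tensor_assoc_inv Y Z P (pure_tensor Y (tensor Z P) q v))"
proof -
  let ?h = "\<lambda>v. tensor_map Z P (convolve_left Z S) id (tensor_assoc_inv Y Z P (pure_tensor Y (tensor Z P) q v))"
  let ?g = "\<lambda>v. pure_tensor Z P (S q) \<one>\<^bsub>P\<^esub> \<otimes>\<^bsub>tensor Z P\<^esub> v"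
  have lin: "?h \<in> linear_maps (tensor Z P) (tensor Z P)"
    by (rule linear_maps_comp[OF tensor_map_linear[OF YZ.tensor_assoc_algebra P Z P convolve_left_linear[OF Z Y S] linear_maps_id]
          linear_maps_comp[OF tensor_assoc_inv_linear[OF Y Z P] Y_ZP.pure_linear_right[OF q]]])
  have "?h v = ?g v"
  proof (rule ZP.tensor_linear_ext[OF lin])
    show "?g \<in> linear_maps (tensor Z P) (tensor Z P)"
      by (rule Y_ZP.B.mult_linear(2)) (simp add: ZP.pure_closed q anti_homsD[OF S])
  next
    fix z p assume pure: "z \<in> carrier Z" "p \<in> carrier P"
    show "?h (pure_tensor Z P z p) = ?g (pure_tensor Z P z p)"
      unfolding tensor_assoc_inv_pure[OF Y Z P q pure]
        tensor_map_pure[OF YZ.tensor_assoc_algebra P Z P convolve_left_linear[OF Z Y S] linear_maps_id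
          YZ.pure_closed[OF q pure(1)] pure(2)]
      using q pure by (simp add: convolve_left_pure[OF Z Y S] ZP.pure_mult anti_homsD[OF S])
  qed (rule v)
  then show ?thesis ..
qed

end

section \<open>Bijectivity of the Galois maps of \<open>\<B>(E,F)\<close>\<close>

text \<open>The inverse is the Galois map of \<open>\<delta>(a) = a\<^sub>1 \<otimes> S(a\<^sub>2)\<close>, where \<open>a\<^sub>1 \<otimes> a\<^sub>2\<close> lies in
  \<open>\<B>(E,F) \<otimes> \<B>(F,E)\<close>: passing through \<open>\<B>(F,E)\<close> is what allows the antipode to land in \<open>\<B>(E,F)\<close>.\<close>

lemma BB_galois_left_bij:
  assumes E: "invertible E" and F: "invertible F"
  shows "bij_betw (galois_left (BB_algebra E E) (BB_algebra E F) (BB_comult E E F))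
    (carrier (tensor (BB_algebra E F) (BB_algebra E F))) (carrier (tensor (BB_algebra E E) (BB_algebra E F)))"
proof -
  let ?A = "BB_algebra E E" and ?Z = "BB_algebra E F" and ?Y = "BB_algebra F E"
  let ?S = "BB_antipode F E"
  let ?\<delta> = "\<lambda>x. tensor_map ?Z ?Z id ?S (BB_comult E F E x)"
  have A: "assoc_algebra ?A" and Z: "assoc_algebra ?Z" and Y: "assoc_algebra ?Y"
    by (rule BB_algebra_assoc)+
  interpret AZ: tensor_product ?A ?Z by (rule tensor_productI[OF A Z])
  interpret ZY: tensor_product ?Z ?Y by (rule tensor_productI[OF Z Y])
  note ZYa = tensor_is_algebra[OF Z Y] and YZa = tensor_is_algebra[OF Y Z] and AZa = tensor_is_algebra[OF A Z]
  note S = BB_antipode_hom[OF F E] and B = BB_algebra_assoc[of F F]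
  note \<alpha> = algebra_homsD(1)[OF BB_comult_hom[OF E, of E F]]
  note \<Delta> = algebra_homsD(1)[OF BB_comult_hom[OF F, of E E]]
  note conv_l = convolve_left_linear[OF Z Y S] and conv_r = convolve_right_linear[OF Z Y S]
  note idS = tensor_map_linear[OF Z Y Z Z linear_maps_id anti_homsD(1)[OF S]]
  have \<delta>: "?\<delta> \<in> linear_maps ?A (tensor ?Z ?Z)"
    by (rule linear_maps_comp[OF idS \<Delta>])
  \<comment> \<open>\<open>x\<^sub>1 \<otimes> S(x\<^sub>2) x\<^sub>3 = x \<otimes> 1\<close>\<close>
  have 1: "galois_left ?Z ?Z ?\<delta> (BB_comult E E F x) = pure_tensor ?Z ?Z x \<one>\<^bsub>?Z\<^esub>"
    if x: "x \<in> carrier ?Z" for x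
  proof -
    let ?h = "\<lambda>t. tensor_map ?Z ?Z id (convolve_left ?Z ?S)
      (tensor_assoc ?Z ?Y ?Z (tensor_map (tensor ?Z ?Y) ?Z (BB_comult E F E) id t))"
    have h: "?h \<in> linear_maps (tensor ?A ?Z) (tensor ?Z ?Z)"
      by (rule linear_maps_comp[OF tensor_map_linear[OF Z YZa Z Z linear_maps_id conv_l]
            linear_maps_comp[OF tensor_assoc_linear[OF Z Y Z] tensor_map_linear[OF A Z ZYa Z \<Delta> linear_maps_id]]])
    have "galois_left ?Z ?Z ?\<delta> (BB_comult E E F x) = ?h (BB_comult E E F x)"
    proof (rule AZ.tensor_linear_ext[OF galois_left_linear[OF A Z Z \<delta>] h])
      fix a r assume a: "a \<in> carrier ?A" and r: "r \<in> carrier ?Z"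
      show "galois_left ?Z ?Z ?\<delta> (pure_tensor ?A ?Z a r) = ?h (pure_tensor ?A ?Z a r)"
        unfolding galois_left_pure[OF A Z Z \<delta> a r] tensor_map_pure[OF A Z ZYa Z \<Delta> linear_maps_id a r]
        using absorb_left_antipode[OF Z Y Z S r linear_mapsD(1)[OF \<Delta> a]] by simp
    qed (rule linear_mapsD(1)[OF \<alpha> x])
    also have "\<dots> = tensor_map ?Z ?Z id (convolve_left ?Z ?S)
        (tensor_map ?Z (tensor ?Y ?Z) id (BB_comult F E F) (BB_comult E F F x))"
      by (simp only: BB_coassoc[OF F E x])
    also have "\<dots> = pure_tensor ?Z ?Z x \<one>\<^bsub>?Z\<^esub>"
      using collapse_right[OF Z B YZa Z algebra_homsD(1)[OF BB_comult_hom[OF E]] conv_l BB_counit_hom[OF F]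
          BB_antipode_left[OF F E] algebra_homsD(2)[OF BB_comult_hom[OF F] x]]
      by (simp add: BB_counit_right[OF F x])
    finally show ?thesis .
  qed
  \<comment> \<open>\<open>a\<^sub>1 \<otimes> a\<^sub>2 S(a\<^sub>3) = a \<otimes> 1\<close>\<close>
  have 2: "galois_left ?A ?Z (BB_comult E E F) (?\<delta> x) = pure_tensor ?A ?Z x \<one>\<^bsub>?Z\<^esub>"
    if x: "x \<in> carrier ?A" for x
  proof -
    let ?h = "\<lambda>w. tensor_map ?A ?Z id (convolve_right ?Z ?S)
      (tensor_assoc ?A ?Z ?Y (tensor_map (tensor ?A ?Z) ?Y (BB_comult E E F) id w))"
    have h: "?h \<in> linear_maps (tensor ?Z ?Y) (tensor ?A ?Z)"
      by (rule linear_maps_comp[OF tensor_map_linear[OF A ZYa A Z linear_maps_id conv_r]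
            linear_maps_comp[OF tensor_assoc_linear[OF A Z Y] tensor_map_linear[OF Z Y AZa Y \<alpha> linear_maps_id]]])
    have "galois_left ?A ?Z (BB_comult E E F) (?\<delta> x) = ?h (BB_comult E F E x)"
    proof (rule ZY.tensor_linear_ext[OF linear_maps_comp[OF galois_left_linear[OF Z A Z \<alpha>] idS] h])
      fix p q assume p: "p \<in> carrier ?Z" and q: "q \<in> carrier ?Y"
      show "galois_left ?A ?Z (BB_comult E E F) (tensor_map ?Z ?Z id ?S (pure_tensor ?Z ?Y p q))
          = ?h (pure_tensor ?Z ?Y p q)"
        unfolding tensor_map_pure[OF Z Y Z Z linear_maps_id anti_homsD(1)[OF S] p q] id_apply[of p] id_apply[of q]
          galois_left_pure[OF Z A Z \<alpha> p anti_homsD(2)[OF S q]]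
          tensor_map_pure[OF Z Y AZa Y \<alpha> linear_maps_id p q]
        by (rule absorb_right_antipode[OF A Y Z S q linear_mapsD(1)[OF \<alpha> p]])
    qed (rule linear_mapsD(1)[OF \<Delta> x])
    also have "\<dots> = tensor_map ?A ?Z id (convolve_right ?Z ?S)
        (tensor_map ?A (tensor ?Z ?Y) id (BB_comult E F E) (BB_comult E E E x))"
      by (simp only: BB_coassoc[OF E F x])
    also have "\<dots> = pure_tensor ?A ?Z x \<one>\<^bsub>?Z\<^esub>"
      using collapse_right[OF A A ZYa Z \<Delta> conv_r BB_counit_hom[OF E]
          BB_antipode_right[OF E F] algebra_homsD(2)[OF BB_comult_hom[OF E] x]]
      by (simp add: BB_counit_right[OF E x])
    finally show ?thesis .
  qed
  show ?thesis
    by (rule galois_left_bij[OF Z A Z \<alpha> \<delta> 1 2])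
qed

text \<open>The mirror image, with \<open>\<delta>(b) = S(b\<^sub>1) \<otimes> b\<^sub>2\<close> and \<open>b\<^sub>1 \<otimes> b\<^sub>2\<close> in \<open>\<B>(F,E) \<otimes> \<B>(E,F)\<close>.\<close>

lemma BB_galois_right_bij:
  assumes E: "invertible E" and F: "invertible F"
  shows "bij_betw (galois_right (BB_algebra F F) (BB_algebra E F) (BB_comult E F F))
    (carrier (tensor (BB_algebra E F) (BB_algebra E F))) (carrier (tensor (BB_algebra E F) (BB_algebra F F)))"
proof -
  let ?B = "BB_algebra F F" and ?Z = "BB_algebra E F" and ?Y = "BB_algebra F E"
  let ?S = "BB_antipode F E"
  let ?\<delta> = "\<lambda>x. tensor_map ?Z ?Z ?S id (BB_comult F E F x)"
  have B: "assoc_algebra ?B" and Z: "assoc_algebra ?Z" and Y: "assoc_algebra ?Y"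
    by (rule BB_algebra_assoc)+
  interpret ZB: tensor_product ?Z ?B by (rule tensor_productI[OF Z B])
  interpret YZ: tensor_product ?Y ?Z by (rule tensor_productI[OF Y Z])
  note ZYa = tensor_is_algebra[OF Z Y] and YZa = tensor_is_algebra[OF Y Z] and ZBa = tensor_is_algebra[OF Z B]
  note S = BB_antipode_hom[OF F E] and A = BB_algebra_assoc[of E E]
  note \<beta> = algebra_homsD(1)[OF BB_comult_hom[OF F, of E F]]
  note \<Delta> = algebra_homsD(1)[OF BB_comult_hom[OF E, of F F]]
  note \<Delta>' = BB_comult_hom[OF F, of E E]
  note conv_l = convolve_left_linear[OF Z Y S] and conv_r = convolve_right_linear[OF Z Y S]
  note Sid = tensor_map_linear[OF Y Z Z Z anti_homsD(1)[OF S] linear_maps_id]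
  have \<delta>: "?\<delta> \<in> linear_maps ?B (tensor ?Z ?Z)"
    by (rule linear_maps_comp[OF Sid \<Delta>])
  \<comment> \<open>\<open>x\<^sub>1 S(x\<^sub>2) \<otimes> x\<^sub>3 = 1 \<otimes> x\<close>\<close>
  have 1: "galois_right ?Z ?Z ?\<delta> (BB_comult E F F x) = pure_tensor ?Z ?Z \<one>\<^bsub>?Z\<^esub> x"
    if x: "x \<in> carrier ?Z" for x
  proof -
    let ?h = "\<lambda>t. tensor_map ?Z ?Z (convolve_right ?Z ?S) id
      (tensor_assoc_inv ?Z ?Y ?Z (tensor_map ?Z (tensor ?Y ?Z) id (BB_comult F E F) t))"
    have h: "?h \<in> linear_maps (tensor ?Z ?B) (tensor ?Z ?Z)"
      by (rule linear_maps_comp[OF tensor_map_linear[OF ZYa Z Z Z conv_r linear_maps_id]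
            linear_maps_comp[OF tensor_assoc_inv_linear[OF Z Y Z] tensor_map_linear[OF Z B Z YZa linear_maps_id \<Delta>]]])
    have "galois_right ?Z ?Z ?\<delta> (BB_comult E F F x) = ?h (BB_comult E F F x)"
    proof (rule ZB.tensor_linear_ext[OF galois_right_linear[OF B Z Z \<delta>] h])
      fix r b assume r: "r \<in> carrier ?Z" and b: "b \<in> carrier ?B"
      show "galois_right ?Z ?Z ?\<delta> (pure_tensor ?Z ?B r b) = ?h (pure_tensor ?Z ?B r b)"
        unfolding galois_right_pure[OF B Z Z \<delta> b r] tensor_map_pure[OF Z B Z YZa linear_maps_id \<Delta> r b]
        using absorb_antipode_right[OF Z Y Z S r linear_mapsD(1)[OF \<Delta> b]] by simp
    qed (rule linear_mapsD(1)[OF \<beta> x])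
    also have "\<dots> = tensor_map ?Z ?Z (convolve_right ?Z ?S) id
        (tensor_map (tensor ?Z ?Y) ?Z (BB_comult E F E) id (BB_comult E E F x))"
      unfolding BB_coassoc[OF F E x, symmetric]
      by (subst tensor_assoc_inv_assoc[OF Z Y Z])
        (auto intro!: linear_mapsD(1)[OF tensor_map_linear[OF A Z ZYa Z algebra_homsD(1)[OF \<Delta>'] linear_maps_id]]
          algebra_homsD(2)[OF BB_comult_hom[OF E] x])
    also have "\<dots> = pure_tensor ?Z ?Z \<one>\<^bsub>?Z\<^esub> x"
      using collapse_left[OF Z A ZYa Z algebra_homsD(1)[OF \<Delta>'] conv_r BB_counit_hom[OF E]
          BB_antipode_right[OF E F] algebra_homsD(2)[OF BB_comult_hom[OF E] x]]
      by (simp add: BB_counit_left[OF E x])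
    finally show ?thesis .
  qed
  \<comment> \<open>\<open>S(b\<^sub>1) b\<^sub>2 \<otimes> b\<^sub>3 = 1 \<otimes> b\<close>\<close>
  have 2: "galois_right ?B ?Z (BB_comult E F F) (?\<delta> x) = pure_tensor ?Z ?B \<one>\<^bsub>?Z\<^esub> x"
    if x: "x \<in> carrier ?B" for x
  proof -
    let ?h = "\<lambda>w. tensor_map ?Z ?B (convolve_left ?Z ?S) id
      (tensor_assoc_inv ?Y ?Z ?B (tensor_map ?Y (tensor ?Z ?B) id (BB_comult E F F) w))"
    have h: "?h \<in> linear_maps (tensor ?Y ?Z) (tensor ?Z ?B)"
      by (rule linear_maps_comp[OF tensor_map_linear[OF YZa B Z B conv_l linear_maps_id]
            linear_maps_comp[OF tensor_assoc_inv_linear[OF Y Z B] tensor_map_linear[OF Y Z Y ZBa linear_maps_id \<beta>]]])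
    have "galois_right ?B ?Z (BB_comult E F F) (?\<delta> x) = ?h (BB_comult F E F x)"
    proof (rule YZ.tensor_linear_ext[OF linear_maps_comp[OF galois_right_linear[OF Z B Z \<beta>] Sid] h])
      fix q p assume q: "q \<in> carrier ?Y" and p: "p \<in> carrier ?Z"
      show "galois_right ?B ?Z (BB_comult E F F) (tensor_map ?Z ?Z ?S id (pure_tensor ?Y ?Z q p))
          = ?h (pure_tensor ?Y ?Z q p)"
        unfolding tensor_map_pure[OF Y Z Z Z anti_homsD(1)[OF S] linear_maps_id q p] id_apply[of p] id_apply[of q]
          galois_right_pure[OF Z B Z \<beta> p anti_homsD(2)[OF S q]]
          tensor_map_pure[OF Y Z Y ZBa linear_maps_id \<beta> q p]
        by (rule absorb_antipode_left[OF B Y Z S q linear_mapsD(1)[OF \<beta> p]])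
    qed (rule linear_mapsD(1)[OF \<Delta> x])
    also have "\<dots> = tensor_map ?Z ?B (convolve_left ?Z ?S) id
        (tensor_map (tensor ?Y ?Z) ?B (BB_comult F E F) id (BB_comult F F F x))"
      unfolding BB_coassoc[OF E F x, symmetric]
      by (subst tensor_assoc_inv_assoc[OF Y Z B])
        (auto intro!: linear_mapsD(1)[OF tensor_map_linear[OF B B YZa B \<Delta> linear_maps_id]]
          algebra_homsD(2)[OF BB_comult_hom[OF F] x])
    also have "\<dots> = pure_tensor ?Z ?B \<one>\<^bsub>?Z\<^esub> x"
      using collapse_left[OF B B YZa Z \<Delta> conv_l BB_counit_hom[OF F]
          BB_antipode_left[OF F E] algebra_homsD(2)[OF BB_comult_hom[OF F] x]]
      by (simp add: BB_counit_left[OF F x])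
    finally show ?thesis .
  qed
  show ?thesis
    by (rule galois_right_bij[OF Z B Z \<beta> \<delta> 1 2])
qed


section \<open>The Hopf algebras \<open>\<B>(E)\<close> and the bigalois extension \<open>\<B>(E,F)\<close>\<close>

lemma B_relations_eq: "B_relations E = BB_relations E E"
  by (simp add: B_relations_def BB_relations_def)

lemma B_gen_eq: "B_gen E = BB_gen E E"
  by (simp add: B_gen_def BB_gen_def B_relations_eq fun_eq_iff)

text \<open>The Hopf algebra record extends the underlying algebra by further fields, so it is formally a
  different object; all constructions depend only on the algebra fields and can be transferred.\<close>

lemma B_hopf_simps:
  "carrier (B_hopf E) = carrier (BB_algebra E E)" "monoid.mult (B_hopf E) = monoid.mult (BB_algebra E E)"
  "one (B_hopf E) = one (BB_algebra E E)" "ring.zero (B_hopf E) = ring.zero (BB_algebra E E)"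
  "add (B_hopf E) = add (BB_algebra E E)" "module.smult (B_hopf E) = module.smult (BB_algebra E E)"
  "comult (B_hopf E) = BB_comult E E E" "counit (B_hopf E) = BB_counit E"
  "antipode (B_hopf E) = BB_antipode E E"
  by (simp_all add: B_hopf_def Let_def B_relations_eq B_gen_eq BB_algebra_def BB_comult_def BB_counit_def
      BB_antipode_def twisted_transpose_def)

lemma B_hopf_tensor:
  "tensor (B_hopf E) V = tensor (BB_algebra E E) V" "tensor V (B_hopf E) = tensor V (BB_algebra E E)"
  "pure_tensor (B_hopf E) V = pure_tensor (BB_algebra E E) V"
  "pure_tensor V (B_hopf E) = pure_tensor V (BB_algebra E E)"
  by (simp_all add: fun_eq_iff tensor_def pure_tensor_def DirProd_def bilinearity_span_def
      bilinearity_relations_def B_hopf_simps)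

lemma B_hopf_lift:
  "tensor_lift (B_hopf E) f = tensor_lift (BB_algebra E E) f"
  by (simp add: fun_eq_iff tensor_lift_def linear_extension_def finsum_def finprod_def B_hopf_simps)

lemma B_hopf_maps:
  "linear_maps (B_hopf E) V = linear_maps (BB_algebra E E) V"
  "linear_maps V (B_hopf E) = linear_maps V (BB_algebra E E)"
  "algebra_homs (B_hopf E) V = algebra_homs (BB_algebra E E) V"
  by (simp_all add: algebra_homs_def linear_maps_def ring_hom_def B_hopf_simps)

lemma B_hopf_multiplication: "multiplication (B_hopf E) = multiplication (BB_algebra E E)"
  by (simp add: multiplication_def B_hopf_lift B_hopf_simps)

lemma B_hopf_tensor_map:
  "tensor_map (B_hopf E) V = tensor_map (BB_algebra E E) V"
  "tensor_map V (B_hopf E) = tensor_map V (BB_algebra E E)"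
  by (simp_all add: tensor_map_def fun_eq_iff B_hopf_tensor)

lemma B_hopf_assoc:
  "tensor_assoc (B_hopf E) V U = tensor_assoc (BB_algebra E E) V U"
  "tensor_assoc V (B_hopf E) U = tensor_assoc V (BB_algebra E E) U"
  "tensor_assoc V U (B_hopf E) = tensor_assoc V U (BB_algebra E E)"
  "tensor_assoc_inv V U (B_hopf E) = tensor_assoc_inv V U (BB_algebra E E)"
  by (simp_all add: tensor_assoc_def tensor_assoc_inv_def B_hopf_tensor)

lemmas B_hopf_transfer = B_hopf_simps B_hopf_tensor B_hopf_lift B_hopf_maps B_hopf_multiplication
  B_hopf_tensor_map B_hopf_assoc

lemma B_hopf_assoc_algebra: "assoc_algebra (B_hopf E)"
proof -
  interpret A: assoc_algebra "BB_algebra E E" by (rule BB_algebra_assoc)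
  show ?thesis
  proof (rule assoc_algebraI)
    show "ring (B_hopf E)"
    proof (rule ringI)
      show "abelian_group (B_hopf E)"
        by (rule abelian_groupI) (auto simp: B_hopf_simps A.A.a_ac intro: A.A.l_neg A.A.a_inv_closed)
      show "Group.monoid (B_hopf E)"
        by (rule monoidI) (auto simp: B_hopf_simps A.A.m_assoc)
    qed (auto simp: B_hopf_simps A.A.l_distr A.A.r_distr)
  qed (auto simp: B_hopf_simps A.smult_add_left A.smult_add_right A.smult_smult A.smult_mult_left
      A.smult_mult_right)
qed

lemma B_hopf_algebra:
  assumes E: "invertible E"
  shows "hopf_algebra (B_hopf E)"
proof (intro hopf_algebra.intro hopf_algebra_axioms.intro B_hopf_assoc_algebra, unfold B_hopf_transfer)
  show "BB_comult E E E \<in> algebra_homs (BB_algebra E E) (tensor (BB_algebra E E) (BB_algebra E E))"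
    by (rule BB_comult_hom[OF E])
  show "BB_counit E \<in> algebra_homs (BB_algebra E E) field_algebra"
    by (rule BB_counit_hom[OF E])
  show "BB_antipode E E \<in> linear_maps (BB_algebra E E) (BB_algebra E E)"
    by (rule anti_homsD(1)[OF BB_antipode_hom[OF E E]])
qed (erule BB_coassoc[OF E E] BB_counit_left[OF E] BB_counit_right[OF E]
      BB_antipode_left[OF E E, unfolded convolve_left_def]
      BB_antipode_right[OF E E, unfolded convolve_right_def])+

lemma BB_left_coaction_eq: "BB_left_coaction E F = BB_comult E E F"
  by (simp add: BB_left_coaction_def BB_comult_def B_hopf_tensor B_gen_eq Let_def)

lemma BB_right_coaction_eq: "BB_right_coaction E F = BB_comult E F F"
  by (simp add: BB_right_coaction_def BB_comult_def B_hopf_tensor B_gen_eq Let_def)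

lemma kappa_left_eq: "kappa_left (B_hopf E) (BB_algebra E F) \<alpha> = galois_left (BB_algebra E E) (BB_algebra E F) \<alpha>"
  by (simp only: kappa_left_def galois_left_def B_hopf_transfer)

lemma kappa_right_eq: "kappa_right (B_hopf F) (BB_algebra E F) \<beta> = galois_right (BB_algebra F F) (BB_algebra E F) \<beta>"
  by (simp only: kappa_right_def galois_right_def B_hopf_transfer)

lemma BB_left_galois:
  assumes E: "invertible E" and F: "invertible F"
    and nonzero: "carrier (BB_algebra E F) \<noteq> {\<zero>\<^bsub>BB_algebra E F\<^esub>}"
  shows "left_galois_extension (B_hopf E) (BB_algebra E F) (BB_left_coaction E F)"
  unfolding BB_left_coaction_eq
  by (intro left_galois_extension.intro left_comodule_algebra.intro left_comodule_algebra_axioms.intro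
      left_galois_extension_axioms.intro B_hopf_algebra[OF E] BB_algebra_assoc nonzero;
      unfold B_hopf_transfer kappa_left_eq)
    (rule BB_comult_hom[OF E] BB_galois_left_bij[OF E F] | erule BB_coassoc[OF E E] BB_counit_left[OF E])+

lemma BB_right_galois:
  assumes E: "invertible E" and F: "invertible F"
    and nonzero: "carrier (BB_algebra E F) \<noteq> {\<zero>\<^bsub>BB_algebra E F\<^esub>}"
  shows "right_galois_extension (B_hopf F) (BB_algebra E F) (BB_right_coaction E F)"
  unfolding BB_right_coaction_eq
  by (intro right_galois_extension.intro right_comodule_algebra.intro right_comodule_algebra_axioms.intro
      right_galois_extension_axioms.intro B_hopf_algebra[OF F] BB_algebra_assoc nonzero;
      unfold B_hopf_transfer kappa_right_eq)
    (rule BB_comult_hom[OF F] BB_galois_right_bij[OF E F] | erule BB_coassoc[OF F F] BB_counit_right[OF F])+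

theorem proposition3p3:
  fixes E :: "'k::alg_closed_field^'m^'m" and F :: "'k^'n^'n"
  assumes "invertible E" and "invertible F"
    and "carrier (BB_algebra E F) \<noteq> {\<zero>\<^bsub>BB_algebra E F\<^esub>}"
  shows "bigalois_extension (B_hopf E) (B_hopf F) (BB_algebra E F)
           (BB_left_coaction E F) (BB_right_coaction E F)"
proof (intro bigalois_extension.intro bigalois_extension_axioms.intro)
  show "left_galois_extension (B_hopf E) (BB_algebra E F) (BB_left_coaction E F)"
    by (rule BB_left_galois[OF assms])
  show "right_galois_extension (B_hopf F) (BB_algebra E F) (BB_right_coaction E F)"
    by (rule BB_right_galois[OF assms])
next
  fix z assume "z \<in> carrier (BB_algebra E F)"
  then show "tensor_assoc (B_hopf E) (BB_algebra E F) (B_hopf F)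
      (tensor_map (tensor (B_hopf E) (BB_algebra E F)) (B_hopf F) (BB_left_coaction E F) id
        (BB_right_coaction E F z))
    = tensor_map (B_hopf E) (tensor (BB_algebra E F) (B_hopf F)) id (BB_right_coaction E F)
        (BB_left_coaction E F z)"
    unfolding BB_left_coaction_eq BB_right_coaction_eq B_hopf_transfer
    by (rule BB_coassoc[OF assms(1,2)])
qed

end
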